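(* Let $h$ be a mixing density that is strictly positive in a neighborhood of the origin (i.e. on some interval $(0,\epsilon)$, $\epsilon>0$). If there exist $\zeta\in(1,2)$ and $\eta>0$ such that $$\int_0^\eta\frac{u^{d/2}h(u)}{\int_0^{\zeta u}v^{d/2}h(v)\,dv}\,du<\infty,$$ then the DA Markov operator $K$ is trace-class.
   Context: Setting and standing assumptions. $n,p,d$ are positive integers, $a\in\mathbb{R}$, $\mathbb{R}_+=(0,\infty)$, and $\mathcal{S}_d$ is the space of $d\times d$ (real symmetric) positive definite matrices. $X$ is a fixed $n\times p$ real matrix with $i$th row $x_i^T$, $y$ is a fixed $n\times d$ real matrix with $i$th row $y_i^T$, and $\Lambda=(X:y)$ is the $n\times(p+d)$ concatenated matrix. A mixing density is a probability density $h:(0,\infty)\to[0,\infty)$. Throughout it is assumed that (S1) $\mathrm{rank}(\Lambda)=p+d$; (S2) $n>p+2d-2a$; (S3) $\int_0^\infty u^{d/2}h(u)\,du<\infty$; (S4) $\int_0^\infty u^{-\frac{n-p+2a-2d-1}{2}}h(u)\,du<\infty$. Posterior. For $\beta\in\mathbb{R}^{p\times d}$, $\Sigma\in\mathcal{S}_d$ let $$f(y|\beta,\Sigma)=\prod_{i=1}^n\left[\int_0^\infty \frac{u^{d/2}}{(2\pi)^{d/2}|\Sigma|^{1/2}}\exp\left\{-\frac u2 (y_i-\beta^Tx_i)^T\Sigma^{-1}(y_i-\beta^Tx_i)\right\}h(u)\,du\right],$$ the prior be $\omega(\beta,\Sigma)= |\Sigma|^{-a}I_{\mathcal{S}_d}(\Sigma)$,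 and $\pi(\beta,\Sigma|y)=f(y|\beta,\Sigma)\omega(\beta,\Sigma)/m(y)$, where $m(y)=\int_{\mathcal{S}_d}\int_{\mathbb{R}^{p\times d}}f(y|\beta,\Sigma)\omega(\beta,\Sigma)\,d\beta\,d\Sigma$, which is finite under (S1)–(S4). DA Markov chain. For $s\ge0$ let $\psi(u;s)=b(s)u^{d/2}e^{-su/2}h(u)$, $u\in\mathbb{R}_+$, with $b(s)$ the normalizing constant making it a probability density. For $z\in\mathbb{R}_+^n$ let $Q=Q(z)$ be the $n\times n$ diagonal matrix with $i$th diagonal element $z_i^{-1}$, $\Omega=(X^TQ^{-1}X)^{-1}$, $\mu=(X^TQ^{-1}X)^{-1}X^TQ^{-1}y$. Let $\pi(z|\beta,\Sigma,y)=\prod_{i=1}^n\psi\big(z_i;(\beta^Tx_i-y_i)^T\Sigma^{-1}(\beta^Tx_i-y_i)\big)$; let $\pi(\Sigma|z,y)$ be the $\mathrm{IW}_d\big(n-p+2a-d-1,(y^TQ^{-1}y-\mu^T\Omega^{-1}\mu)^{-1}\big)$ density; and let $\pi(\beta|\Sigma,z,y)$ be the $\mathrm{N}_{p,d}(\mu,\Omega,\Sigma)$ density. Here $\mathrm{N}_{r,c}(\theta,A,B)$ (matrix normal; $\theta$ is $r\times c$, $A$ is $r\times r$ and $B$ is $c\times c$ positive definite) has density $(2\pi)^{-rc/2}|A|^{-c/2}|B|^{-r/2}\exp[-\frac12\mathrm{tr}\{A^{-1}(z-\theta)B^{-1}(z-\theta)^T\}]$ on $\mathbb{R}^{r\times c}$,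 and $\mathrm{IW}_r(m,\Theta)$ (inverse Wishart; $m>r-1$, $\Theta$ is $r\times r$ positive definite) has density proportional to $|w|^{-\frac{m+r+1}{2}}\exp\{-\frac12\mathrm{tr}(\Theta^{-1}w^{-1})\}$ on $\mathcal{S}_r$. The DA Markov chain on $\mathsf{X}=\mathbb{R}^{p\times d}\times\mathcal{S}_d$ has transition density $$k\big((\beta',\Sigma')|(\beta,\Sigma)\big)=\int_{\mathbb{R}_+^n}\pi(\beta'|\Sigma',z,y)\,\pi(\Sigma'|z,y)\,\pi(z|\beta,\Sigma,y)\,dz.$$ Operator. $L_0^2$ is the Hilbert space of functions $f:\mathsf{X}\to\mathbb{R}$ with $\int_{\mathsf{X}} f^2\,\pi(\cdot|y)<\infty$ and $\int_{\mathsf{X}} f\,\pi(\cdot|y)=0$, with inner product $\langle f_1,f_2\rangle=\int_{\mathsf{X}} f_1f_2\,\pi(\beta,\Sigma|y)\,d\beta\,d\Sigma$. The DA Markov operator $K:L_0^2\to L_0^2$ is $(Kf)(\beta,\Sigma)=\int_{\mathsf{X}}f(\beta',\Sigma')\,k((\beta',\Sigma')|(\beta,\Sigma))\,d\beta'\,d\Sigma'$; it is self-adjoint and positive. Such an operator is trace-class if it is compact and its eigenvalues are summable. *)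

theory Defs
  imports "HOL-Analysis.Analysis"
begin

section \<open>Positive self-adjoint trace-class operators on a space of mean-zero functions\<close>

text \<open>
  \<open>L\<^sub>0\<^sup>2(P)\<close> is represented by its functions, so that every identification is made up to
  \<open>P\<close>-null sets; operators act on representatives.
\<close>

definition L2_zero :: "'a measure \<Rightarrow> ('a \<Rightarrow> real) set" where
  "L2_zero P = {f \<in> borel_measurable P. integrable P (\<lambda>x. (f x)\<^sup>2) \<and> (\<integral>x. f x \<partial>P) = 0}"

definition L2_inner :: "'a measure \<Rightarrow> ('a \<Rightarrow> real) \<Rightarrow> ('a \<Rightarrow> real) \<Rightarrow> real" where
  "L2_inner P f g = (\<integral>x. f x * g x \<partial>P)"

definition L2_dist :: "'a measure \<Rightarrow> ('a \<Rightarrow> real) \<Rightarrow> ('a \<Rightarrow> real) \<Rightarrow> real" where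
  "L2_dist P f g = sqrt (L2_inner P (\<lambda>x. f x - g x) (\<lambda>x. f x - g x))"

text \<open>
  Linearity and compatibility with almost-everywhere equality need not be listed: both follow,
  modulo null sets, from the symmetry condition.
\<close>

definition positive_selfadjoint :: "'a measure \<Rightarrow> (('a \<Rightarrow> real) \<Rightarrow> ('a \<Rightarrow> real)) \<Rightarrow> bool" where
  "positive_selfadjoint P K \<longleftrightarrow>
     (\<forall>f\<in>L2_zero P. K f \<in> L2_zero P) \<and>
     (\<forall>f\<in>L2_zero P. \<forall>g\<in>L2_zero P. L2_inner P (K f) g = L2_inner P f (K g)) \<and>
     (\<forall>f\<in>L2_zero P. L2_inner P (K f) f \<ge> 0)"

definition compact_operator :: "'a measure \<Rightarrow> (('a \<Rightarrow> real) \<Rightarrow> ('a \<Rightarrow> real)) \<Rightarrow> bool" where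
  "compact_operator P K \<longleftrightarrow>
     (\<forall>F :: nat \<Rightarrow> 'a \<Rightarrow> real. \<forall>B.
        (\<forall>k. F k \<in> L2_zero P \<and> L2_inner P (F k) (F k) \<le> B) \<longrightarrow>
        (\<exists>g\<in>L2_zero P. \<exists>r :: nat \<Rightarrow> nat. strict_mono r \<and>
           (\<lambda>k. L2_dist P (K (F (r k))) g) \<longlonglongrightarrow> 0))"

definition eigenspace ::
  "'a measure \<Rightarrow> (('a \<Rightarrow> real) \<Rightarrow> ('a \<Rightarrow> real)) \<Rightarrow> real \<Rightarrow> ('a \<Rightarrow> real) set" where
  "eigenspace P K l = {f \<in> L2_zero P. AE x in P. K f x = l * f x}"

definition eigenvalues :: "'a measure \<Rightarrow> (('a \<Rightarrow> real) \<Rightarrow> ('a \<Rightarrow> real)) \<Rightarrow> real set" where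
  "eigenvalues P K = {l. \<exists>f\<in>eigenspace P K l. \<not> (AE x in P. f x = 0)}"

text \<open>The dimension of \<open>V\<close> modulo \<open>P\<close>-null functions, possibly infinite.\<close>

definition AE_dim :: "'a measure \<Rightarrow> ('a \<Rightarrow> real) set \<Rightarrow> ennreal" where
  "AE_dim P V =
     (SUP m \<in> {m :: nat. \<exists>F :: nat \<Rightarrow> 'a \<Rightarrow> real. (\<forall>i<m. F i \<in> V) \<and>
        (\<forall>c :: nat \<Rightarrow> real. (AE x in P. (\<Sum>i<m. c i * F i x) = 0) \<longrightarrow> (\<forall>i<m. c i = 0))}.
      of_nat m)"

text \<open>
  The eigenvalues are summed with multiplicity. They are nonnegative by positivity, so nothing is
  lost by \<open>ennreal\<close>; a possibly infinite-dimensional kernel contributes \<open>0 * \<infinity> = 0\<close>.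
\<close>

definition trace_class :: "'a measure \<Rightarrow> (('a \<Rightarrow> real) \<Rightarrow> ('a \<Rightarrow> real)) \<Rightarrow> bool" where
  "trace_class P K \<longleftrightarrow>
     positive_selfadjoint P K \<and> compact_operator P K \<and>
     (\<Sum>\<^sub>\<infinity>l\<in>eigenvalues P K. ennreal l * AE_dim P (eigenspace P K l)) < \<infinity>"


section \<open>Matrices and matrix-variate densities\<close>

definition pos_def :: "real^'d^'d \<Rightarrow> bool" where
  "pos_def A \<longleftrightarrow> transpose A = A \<and> (\<forall>v. v \<noteq> 0 \<longrightarrow> v \<bullet> (A *v v) > 0)"

text \<open>
  Lebesgue measure on the symmetric matrices in terms of their \<open>d(d+1)/2\<close> free entries. The
  unordered pairs \<open>{i, j}\<close> (including \<open>i = j\<close>) index these entries.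
\<close>

definition sym_lborel :: "(real^'d^'d) measure" where
  "sym_lborel =
     distr (Pi\<^sub>M (range (\<lambda>(i :: 'd, j). {i, j})) (\<lambda>_. lborel)) borel (\<lambda>v. \<chi> i j. v {i, j})"

definition pd_lborel :: "(real^'d^'d) measure" where
  "pd_lborel = restrict_space sym_lborel {S. pos_def S}"

definition matrix_normal_density ::
  "real^'c^'r \<Rightarrow> real^'r^'r \<Rightarrow> real^'c^'c \<Rightarrow> real^'c^'r \<Rightarrow> real" where
  "matrix_normal_density \<theta> A B z =
     (2 * pi) powr (- (real CARD('r) * real CARD('c)) / 2) *
     det A powr (- real CARD('c) / 2) * det B powr (- real CARD('r) / 2) *
     exp (- (1/2) * trace (matrix_inv A ** (z - \<theta>) ** matrix_inv B ** transpose (z - \<theta>)))"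

definition inv_wishart_kernel :: "real \<Rightarrow> real^'r^'r \<Rightarrow> real^'r^'r \<Rightarrow> real" where
  "inv_wishart_kernel m \<Theta> w =
     det w powr (- (m + real CARD('r) + 1) / 2) *
     exp (- (1/2) * trace (matrix_inv \<Theta> ** matrix_inv w))"

definition inv_wishart_density :: "real \<Rightarrow> real^'r^'r \<Rightarrow> real^'r^'r \<Rightarrow> real" where
  "inv_wishart_density m \<Theta> w =
     inv_wishart_kernel m \<Theta> w / (\<integral>v. inv_wishart_kernel m \<Theta> v \<partial>pd_lborel)"


section \<open>The regression model and its posterior\<close>

definition mixing_density :: "(real \<Rightarrow> real) \<Rightarrow> bool" where
  "mixing_density h \<longleftrightarrow>
     (\<forall>u>0. h u \<ge> 0) \<and> set_integrable lborel {0<..} h \<and> (LBINT u:{0<..}. h u) = 1"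

definition concat_cols :: "real^'p^'n \<Rightarrow> real^'d^'n \<Rightarrow> real^('p + 'd)^'n" where
  "concat_cols X y = (\<chi> i j. case j of Inl k \<Rightarrow> X $ i $ k | Inr k \<Rightarrow> y $ i $ k)"

definition sq_resid ::
  "real^'p^'n \<Rightarrow> real^'d^'n \<Rightarrow> real^'d^'p \<Rightarrow> real^'d^'d \<Rightarrow> 'n \<Rightarrow> real" where
  "sq_resid X y \<beta> \<Sigma> i =
     (y $ i - transpose \<beta> *v (X $ i)) \<bullet> (matrix_inv \<Sigma> *v (y $ i - transpose \<beta> *v (X $ i)))"

definition likelihood ::
  "(real \<Rightarrow> real) \<Rightarrow> real^'p^'n \<Rightarrow> real^'d^'n \<Rightarrow> real^'d^'p \<Rightarrow> real^'d^'d \<Rightarrow> real" where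
  "likelihood h X y \<beta> \<Sigma> =
     (\<Prod>i\<in>UNIV. LBINT u:{0<..}.
        u powr (real CARD('d) / 2) / ((2 * pi) powr (real CARD('d) / 2) * sqrt (det \<Sigma>)) *
        exp (- (u / 2) * sq_resid X y \<beta> \<Sigma> i) * h u)"

definition prior :: "real \<Rightarrow> real^'d^'p \<Rightarrow> real^'d^'d \<Rightarrow> real" where
  "prior a \<beta> \<Sigma> = det \<Sigma> powr (- a) * indicator {S. pos_def S} \<Sigma>"

text \<open>The state space together with \<open>d\<beta> d\<Sigma>\<close>; its underlying set is \<open>UNIV \<times> {S. pos_def S}\<close>.\<close>

definition state_lborel :: "((real^'d^'p) \<times> (real^'d^'d)) measure" where
  "state_lborel = lborel \<Otimes>\<^sub>M pd_lborel"

definition marginal ::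
  "(real \<Rightarrow> real) \<Rightarrow> real \<Rightarrow> real^'p^'n \<Rightarrow> real^'d^'n \<Rightarrow> real" where
  "marginal h a X y =
     (\<integral>(\<beta> :: real^'d^'p, \<Sigma>). likelihood h X y \<beta> \<Sigma> * prior a \<beta> \<Sigma> \<partial>state_lborel)"

definition posterior_density ::
  "(real \<Rightarrow> real) \<Rightarrow> real \<Rightarrow> real^'p^'n \<Rightarrow> real^'d^'n \<Rightarrow> (real^'d^'p) \<times> (real^'d^'d) \<Rightarrow> real" where
  "posterior_density h a X y =
     (\<lambda>(\<beta>, \<Sigma>). likelihood h X y \<beta> \<Sigma> * prior a \<beta> \<Sigma> / marginal h a X y)"

definition posterior ::
  "(real \<Rightarrow> real) \<Rightarrow> real \<Rightarrow> real^'p^'n \<Rightarrow> real^'d^'n \<Rightarrow> ((real^'d^'p) \<times> (real^'d^'d)) measure" where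
  "posterior h a X y = density state_lborel (\<lambda>x. ennreal (posterior_density h a X y x))"


section \<open>The data augmentation chain and its operator\<close>

definition psi :: "nat \<Rightarrow> (real \<Rightarrow> real) \<Rightarrow> real \<Rightarrow> real \<Rightarrow> real" where
  "psi d h u s =
     u powr (real d / 2) * exp (- s * u / 2) * h u /
     (LBINT v:{0<..}. v powr (real d / 2) * exp (- s * v / 2) * h v)"

definition Q_mat :: "real^'n \<Rightarrow> real^'n^'n" where
  "Q_mat z = (\<chi> i j. if i = j then inverse (z $ i) else 0)"

definition Omega_mat :: "real^'p^'n \<Rightarrow> real^'n \<Rightarrow> real^'p^'p" where
  "Omega_mat X z = matrix_inv (transpose X ** matrix_inv (Q_mat z) ** X)"

definition mu_mat :: "real^'p^'n \<Rightarrow> real^'d^'n \<Rightarrow> real^'n \<Rightarrow> real^'d^'p" where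
  "mu_mat X y z =
     matrix_inv (transpose X ** matrix_inv (Q_mat z) ** X) **
     transpose X ** matrix_inv (Q_mat z) ** y"

definition z_cond_density ::
  "(real \<Rightarrow> real) \<Rightarrow> real^'p^'n \<Rightarrow> real^'d^'n \<Rightarrow> real^'d^'p \<Rightarrow> real^'d^'d \<Rightarrow> real^'n \<Rightarrow> real" where
  "z_cond_density h X y \<beta> \<Sigma> z = (\<Prod>i\<in>UNIV. psi CARD('d) h (z $ i) (sq_resid X y \<beta> \<Sigma> i))"

definition Sigma_cond_density ::
  "real \<Rightarrow> real^'p^'n \<Rightarrow> real^'d^'n \<Rightarrow> real^'n \<Rightarrow> real^'d^'d \<Rightarrow> real" where
  "Sigma_cond_density a X y z \<Sigma> =
     inv_wishart_density
       (real CARD('n) - real CARD('p) + 2 * a - real CARD('d) - 1)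
       (matrix_inv (transpose y ** matrix_inv (Q_mat z) ** y -
          transpose (mu_mat X y z) ** matrix_inv (Omega_mat X z) ** mu_mat X y z))
       \<Sigma>"

definition beta_cond_density ::
  "real^'p^'n \<Rightarrow> real^'d^'n \<Rightarrow> real^'d^'d \<Rightarrow> real^'n \<Rightarrow> real^'d^'p \<Rightarrow> real" where
  "beta_cond_density X y \<Sigma> z \<beta> = matrix_normal_density (mu_mat X y z) (Omega_mat X z) \<Sigma> \<beta>"

text \<open>\<open>DA_density h a X y x' x\<close> is the density of moving to \<open>x'\<close> from \<open>x\<close>.\<close>

definition DA_density ::
  "(real \<Rightarrow> real) \<Rightarrow> real \<Rightarrow> real^'p^'n \<Rightarrow> real^'d^'n \<Rightarrow>
   (real^'d^'p) \<times> (real^'d^'d) \<Rightarrow> (real^'d^'p) \<times> (real^'d^'d) \<Rightarrow> real" where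
  "DA_density h a X y = (\<lambda>(\<beta>', \<Sigma>') (\<beta>, \<Sigma>).
     LBINT z:{z. \<forall>i. z $ i > 0}.
       beta_cond_density X y \<Sigma>' z \<beta>' * Sigma_cond_density a X y z \<Sigma>' *
       z_cond_density h X y \<beta> \<Sigma> z)"

definition DA_operator ::
  "(real \<Rightarrow> real) \<Rightarrow> real \<Rightarrow> real^'p^'n \<Rightarrow> real^'d^'n \<Rightarrow>
   ((real^'d^'p) \<times> (real^'d^'d) \<Rightarrow> real) \<Rightarrow> ((real^'d^'p) \<times> (real^'d^'d) \<Rightarrow> real)" where
  "DA_operator h a X y f = (\<lambda>x. \<integral>x'. f x' * DA_density h a X y x' x \<partial>state_lborel)"

end

(*
  Under the posterior the chain alternates x -> z -> x', so K = A* A, where A averages a function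
  of x against the conditional law of x given z; with respect to the two marginal laws A has the
  kernel W(x, z) = p(x, z) / (p(x) p(z)).  By Bessel's inequality every finite orthonormal family e
  satisfies sum <K e, e> <= ||W||^2, and such a bound makes a positive operator trace-class: an
  orthonormal family nearly attaining the supremum of the left-hand side leaves a form of small
  norm on its orthogonal complement, which gives compactness.

  Since b(s)^-1 >= exp(-s t/2) int_0^t v^(d/2) h(v) dv, the choice t = zeta min(u, eta) gives
  psi(u; s) <= g(u) exp((zeta - 1) s u / 2) with g integrable by hypothesis.  Inserting this in
  ||W||^2 = int int p(x | z) p(z | x) dx dz replaces z by (2 - zeta) z in the Gaussian factor of
  p(x | z); the substitution Sigma -> (2 - zeta) Sigma shows that the x-integral is then a
  constant independent of z.

  If the marginal density m(y) were infinite, the Bochner integral defining it would be 0 and the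
  posterior the null measure, for which the claim is trivial.
*)
theory Submission
  imports Defs "HOL-Probability.Probability"
begin

section \<open>Square integrable functions\<close>

text \<open>The hypothesis balances two effects. A larger \<open>\<zeta>\<close> enlarges the
  denominator and weakens the integrability condition, but the bound on \<open>psi\<close> then
  grows like \<open>exp ((\<zeta> - 1) * s * u / 2)\<close>. The decay that absorbs this growth is
  the factor \<open>exp (- s * u / 2)\<close> of p(x | z), whence \<open>\<zeta> < 2\<close>. Two
  obstacles shape the proof. Operators act on functions and not on classes, and masses may be
  infinite at exceptional points. Hence the trace is tested on finite orthonormal families,
  linearity of \<open>K\<close> holds only almost everywhere, and masses are nonnegative integrals
  until their finiteness is known; division by 0 makes exceptional points contribute 0. The
  transition density is given by normalised conditional densities, which have to be matched with a
  single joint kernel. The inverse Wishart density divides by its own integral, so the constant that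
  has to be evaluated is that of the matrix normal density. This is the purpose of the matrix
  substitutions and the Gaussian integral.\<close>

definition L2_space :: "'a measure \<Rightarrow> ('a \<Rightarrow> real) set" where
  "L2_space M = {f \<in> borel_measurable M. integrable M (\<lambda>x. (f x)\<^sup>2)}"

lemma L2_space_integrable_mult:
  assumes "f \<in> L2_space M" "g \<in> L2_space M"
  shows "integrable M (\<lambda>x. f x * g x)"
proof (rule Bochner_Integration.integrable_bound)
  show "integrable M (\<lambda>x. (f x)\<^sup>2 + (g x)\<^sup>2)"
    using assms by (auto simp: L2_space_def)
  have "\<bar>u * v\<bar> \<le> u\<^sup>2 + v\<^sup>2" for u v :: real
  proof -
    have "2 * \<bar>u\<bar> * \<bar>v\<bar> \<le> \<bar>u\<bar>\<^sup>2 + \<bar>v\<bar>\<^sup>2"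
      by (rule sum_squares_bound)
    moreover have "0 \<le> \<bar>u\<bar> * \<bar>v\<bar>" by simp
    ultimately show ?thesis unfolding abs_mult power2_abs by linarith
  qed
  then show "AE x in M. norm (f x * g x) \<le> norm ((f x)\<^sup>2 + (g x)\<^sup>2)"
    by simp
qed (use assms in \<open>auto simp: L2_space_def\<close>)

lemma L2_space_mult:
  assumes "f \<in> L2_space M"
  shows "(\<lambda>x. c * f x) \<in> L2_space M"
  using assms by (auto simp: L2_space_def power_mult_distrib)

lemma L2_space_add:
  assumes f: "f \<in> L2_space M" and g: "g \<in> L2_space M"
  shows "(\<lambda>x. f x + g x) \<in> L2_space M"
proof -
  note L2_space_integrable_mult[OF f g]
  then have "integrable M (\<lambda>x. (f x)\<^sup>2 + (g x)\<^sup>2 + 2 * (f x * g x))"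
    using f g by (auto simp: L2_space_def)
  then show ?thesis
    using f g by (auto simp: L2_space_def power2_sum mult.assoc)
qed

lemma L2_inner_commute: "L2_inner M f g = L2_inner M g f"
  by (simp add: L2_inner_def mult.commute)

lemma L2_inner_self_nonneg: "0 \<le> L2_inner M f f"
  by (simp add: L2_inner_def)

lemma L2_inner_add_left:
  assumes "f \<in> L2_space M" "g \<in> L2_space M" "k \<in> L2_space M"
  shows "L2_inner M (\<lambda>x. f x + g x) k = L2_inner M f k + L2_inner M g k"
  using assms by (simp add: L2_inner_def distrib_right L2_space_integrable_mult)

lemma L2_inner_mult_left: "L2_inner M (\<lambda>x. c * f x) k = c * L2_inner M f k"
  by (simp add: L2_inner_def mult.assoc)

lemma L2_inner_add_right:
  assumes "f \<in> L2_space M" "g \<in> L2_space M" "k \<in> L2_space M"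
  shows "L2_inner M k (\<lambda>x. f x + g x) = L2_inner M k f + L2_inner M k g"
  using L2_inner_add_left[OF assms] by (simp add: L2_inner_commute)

lemma L2_inner_mult_right: "L2_inner M k (\<lambda>x. c * f x) = c * L2_inner M k f"
  by (simp add: L2_inner_def mult.left_commute)

lemma L2_inner_cong_AE:
  assumes "f \<in> borel_measurable M" "f' \<in> borel_measurable M" "g \<in> borel_measurable M"
    and "AE x in M. f x = f' x"
  shows "L2_inner M f g = L2_inner M f' g"
  unfolding L2_inner_def by (rule integral_cong_AE) (use assms in auto)

lemma L2_inner_self_eq_0_iff:
  assumes "f \<in> L2_space M"
  shows "L2_inner M f f = 0 \<longleftrightarrow> (AE x in M. f x = 0)"
  using integral_nonneg_eq_0_iff_AE[of M "\<lambda>x. (f x)\<^sup>2"] assms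
  by (auto simp: L2_inner_def L2_space_def power2_eq_square)

text \<open>The case \<open>c = 0\<close> is included, so that one inequality serves both the inner
  product, which vanishes on null functions, and the semidefinite form of a positive
  operator.\<close>

lemma nonneg_quadratic_imp_discriminant:
  fixes a b c :: real
  assumes "\<And>t. 0 \<le> a + 2 * t * b + t\<^sup>2 * c" and "0 \<le> c"
  shows "b\<^sup>2 \<le> a * c"
proof (cases "c = 0")
  case True
  have "b = 0"
  proof (rule ccontr)
    assume "b \<noteq> 0"
    \<comment> \<open>With \<open>c = 0\<close> this \<open>t\<close> makes the quadratic equal to
      -1.\<close>
    then show False
      using assms(1)[of "- (a + 1) / (2 * b)"] True by (simp add: field_simps)
  qed
  then show ?thesis using True by simp
next
  case False
  \<comment> \<open>\<open>- b / c\<close> minimises the quadratic.\<close>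
  have "0 \<le> a + 2 * (- b / c) * b + (- b / c)\<^sup>2 * c" by (rule assms)
  also have "\<dots> = a - b\<^sup>2 / c"
    using False by (simp add: field_simps power2_eq_square)
  finally show ?thesis using False assms(2) by (simp add: field_simps)
qed

lemma L2_Cauchy_Schwarz:
  assumes f: "f \<in> L2_space M" and g: "g \<in> L2_space M"
  shows "(L2_inner M f g)\<^sup>2 \<le> L2_inner M f f * L2_inner M g g"
proof (rule nonneg_quadratic_imp_discriminant)
  fix t :: real
  have tg: "(\<lambda>x. t * g x) \<in> L2_space M" by (rule L2_space_mult[OF g])
  have "0 \<le> L2_inner M (\<lambda>x. f x + t * g x) (\<lambda>x. f x + t * g x)"
    by (rule L2_inner_self_nonneg)
  also have "\<dots> = L2_inner M f f + 2 * t * L2_inner M f g + t\<^sup>2 * L2_inner M g g"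
    by (simp add: L2_inner_add_left[OF f tg L2_space_add[OF f tg]] L2_inner_add_right[OF f tg f]
        L2_inner_add_right[OF f tg g] L2_inner_mult_left L2_inner_mult_right
        L2_inner_commute[of M g f] power2_eq_square algebra_simps)
  finally show "0 \<le> L2_inner M f f + 2 * t * L2_inner M f g + t\<^sup>2 * L2_inner M g g" .
qed (rule L2_inner_self_nonneg)

abbreviation L2_sq :: "'a measure \<Rightarrow> ('a \<Rightarrow> real) \<Rightarrow> real" where
  "L2_sq M f \<equiv> L2_inner M f f"

lemma L2_zero_iff: "f \<in> L2_zero M \<longleftrightarrow> f \<in> L2_space M \<and> (\<integral>x. f x \<partial>M) = 0"
  by (auto simp: L2_zero_def L2_space_def)

section \<open>Finite orthonormal families, projections and Bessel's inequality\<close>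

definition orthonormal :: "'a measure \<Rightarrow> ('a \<Rightarrow> real) set \<Rightarrow> bool" where
  "orthonormal M E \<longleftrightarrow> finite E \<and>
     (\<forall>e\<in>E. \<forall>f\<in>E. L2_inner M e f = (if e = f then 1 else 0))"

definition proj :: "'a measure \<Rightarrow> ('a \<Rightarrow> real) set \<Rightarrow> ('a \<Rightarrow> real) \<Rightarrow> 'a \<Rightarrow> real" where
  "proj M E f = (\<lambda>x. \<Sum>e\<in>E. L2_inner M f e * e x)"

lemma L2_space_sum:
  assumes "finite I" "\<And>i. i \<in> I \<Longrightarrow> F i \<in> L2_space M"
  shows "(\<lambda>x. \<Sum>i\<in>I. c i * F i x) \<in> L2_space M"
  using assms
proof (induction I rule: finite_induct)
  case empty
  then show ?case by (simp add: L2_space_def)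
next
  case (insert i I)
  then show ?case
    using L2_space_add[OF L2_space_mult[of "F i" M "c i"], of "\<lambda>x. \<Sum>i\<in>I. c i * F i x"] by auto
qed

lemma L2_inner_sum_left:
  assumes "finite I" "\<And>i. i \<in> I \<Longrightarrow> F i \<in> L2_space M" "k \<in> L2_space M"
  shows "L2_inner M (\<lambda>x. \<Sum>i\<in>I. c i * F i x) k = (\<Sum>i\<in>I. c i * L2_inner M (F i) k)"
proof -
  have "integrable M (\<lambda>x. c i * (F i x * k x))" if "i \<in> I" for i
    using L2_space_integrable_mult[OF assms(2)[OF that] assms(3)] by simp
  then show ?thesis
    unfolding L2_inner_def by (simp add: sum_distrib_right mult.assoc)
qed

context
  fixes M :: "'a measure" and E :: "('a \<Rightarrow> real) set"
  assumes E: "orthonormal M E" "E \<subseteq> L2_space M"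
begin

lemma proj_in_L2: "proj M E f \<in> L2_space M"
  unfolding proj_def by (rule L2_space_sum) (use E in \<open>auto simp: orthonormal_def\<close>)

lemma inner_proj:
  assumes "f \<in> L2_space M" "e \<in> E"
  shows "L2_inner M (proj M E f) e = L2_inner M f e"
proof -
  have "L2_inner M (proj M E f) e = (\<Sum>e'\<in>E. L2_inner M f e' * L2_inner M e' e)"
    unfolding proj_def
    by (rule L2_inner_sum_left[where F="\<lambda>e. e"]) (use E assms in \<open>auto simp: orthonormal_def\<close>)
  also have "\<dots> = (\<Sum>e'\<in>E. if e = e' then L2_inner M f e' else 0)"
    using E assms by (intro sum.cong) (auto simp: orthonormal_def)
  also have "\<dots> = L2_inner M f e" using E assms by (simp add: orthonormal_def)
  finally show ?thesis .
qed

lemma proj_norm: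
  assumes "f \<in> L2_space M"
  shows "L2_inner M (proj M E f) (proj M E f) = (\<Sum>e\<in>E. (L2_inner M f e)\<^sup>2)"
    and "L2_inner M (proj M E f) f = (\<Sum>e\<in>E. (L2_inner M f e)\<^sup>2)"
proof -
  have *: "L2_inner M (proj M E f) k = (\<Sum>e\<in>E. L2_inner M f e * L2_inner M e k)"
    if "k \<in> L2_space M" for k
    unfolding proj_def
    by (rule L2_inner_sum_left[where F="\<lambda>e. e"]) (use E that in \<open>auto simp: orthonormal_def\<close>)
  show "L2_inner M (proj M E f) f = (\<Sum>e\<in>E. (L2_inner M f e)\<^sup>2)"
    by (subst *[OF assms]) (simp add: L2_inner_commute[of M _ f] power2_eq_square)
  have "L2_inner M e (proj M E f) = L2_inner M f e" if "e \<in> E" for e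
    using inner_proj[OF assms that] L2_inner_commute[of M e] by simp
  then show "L2_inner M (proj M E f) (proj M E f) = (\<Sum>e\<in>E. (L2_inner M f e)\<^sup>2)"
    by (subst *[OF proj_in_L2]) (simp add: power2_eq_square)
qed

text \<open>The residual is written as a sum with a multiple by -1, so that the rules for sums and
  multiples rewrite it literally.\<close>

lemma residual_in_L2:
  assumes "f \<in> L2_space M"
  shows "(\<lambda>x. f x + - 1 * proj M E f x) \<in> L2_space M"
  by (intro L2_space_add L2_space_mult assms proj_in_L2)

lemma residual_orthogonal:
  assumes "f \<in> L2_space M" "e \<in> E"
  shows "L2_inner M (\<lambda>x. f x + - 1 * proj M E f x) e = 0"
proof -
  have e: "e \<in> L2_space M" using assms E by auto
  show ?thesis
    by (simp only: L2_inner_add_left[OF assms(1) L2_space_mult[OF proj_in_L2] e] L2_inner_mult_left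
        inner_proj[OF assms])
qed

lemma residual_norm:
  assumes "f \<in> L2_space M"
  shows "L2_sq M (\<lambda>x. f x + - 1 * proj M E f x)
    = L2_inner M f f - (\<Sum>e\<in>E. (L2_inner M f e)\<^sup>2)"
proof -
  let ?p = "proj M E f"
  note p = L2_space_mult[OF proj_in_L2, of "-1" f] and r = residual_in_L2[OF assms]
  show ?thesis
    by (simp only: L2_inner_add_left[OF assms p r] L2_inner_add_right[OF assms p assms]
        L2_inner_add_right[OF assms p proj_in_L2] L2_inner_mult_left L2_inner_mult_right
        L2_inner_commute[of M f ?p] proj_norm[OF assms]) simp
qed

text \<open>The gap between the two sides is the squared norm of the residual.\<close>

lemma Bessel:
  assumes "f \<in> L2_space M"
  shows "(\<Sum>e\<in>E. (L2_inner M f e)\<^sup>2) \<le> L2_inner M f f"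
  using residual_norm[OF assms] L2_inner_self_nonneg[of M "\<lambda>x. f x + - 1 * proj M E f x"] by linarith

end

section \<open>Positive operators of bounded trace\<close>

context finite_measure
begin

lemma L2_space_const: "(\<lambda>_. c) \<in> L2_space M"
  by (simp add: L2_space_def)

lemma L2_space_integrable:
  assumes "f \<in> L2_space M"
  shows "integrable M f"
  using L2_space_integrable_mult[OF assms L2_space_const[of 1]] by simp

lemma L2_zero_lincomb:
  assumes "f \<in> L2_zero M" "g \<in> L2_zero M"
  shows "(\<lambda>x. s * f x + t * g x) \<in> L2_zero M"
  using assms L2_space_add[of "\<lambda>x. s * f x" M "\<lambda>x. t * g x"]
  by (auto simp: L2_zero_iff L2_space_mult L2_space_integrable)

lemma L2_zero_sum:
  assumes "finite I" "\<And>i. i \<in> I \<Longrightarrow> F i \<in> L2_zero M"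
  shows "(\<lambda>x. \<Sum>i\<in>I. c i * F i x) \<in> L2_zero M"
  using assms by (auto simp: L2_zero_iff L2_space_integrable intro!: L2_space_sum)

end

lemma L2_zero_subset_L2_space: "L2_zero M \<subseteq> L2_space M"
  by (auto simp: L2_zero_iff)

text \<open>The trace is controlled through finite orthonormal families of mean-zero functions. Both
  compactness and the bound on the eigenvalue sum are extracted from this one finite
  condition.\<close>

locale bounded_trace_operator = finite_measure M for M :: "'a measure" +
  fixes K :: "('a \<Rightarrow> real) \<Rightarrow> 'a \<Rightarrow> real" and T :: real
  assumes psa: "positive_selfadjoint M K"
    and trace_le: "\<And>E. orthonormal M E \<Longrightarrow> E \<subseteq> L2_zero M \<Longrightarrow> (\<Sum>e\<in>E. L2_inner M (K e) e) \<le> T"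
begin

abbreviation ip where "ip \<equiv> L2_inner M"
abbreviation H where "H \<equiv> L2_zero M"

lemma L2_zero_L2_space: "f \<in> H \<Longrightarrow> f \<in> L2_space M"
  by (simp add: L2_zero_iff)

lemma K_in: "f \<in> H \<Longrightarrow> K f \<in> H"
  using psa by (auto simp: positive_selfadjoint_def)

lemma K_sym: "f \<in> H \<Longrightarrow> g \<in> H \<Longrightarrow> ip (K f) g = ip f (K g)"
  using psa by (auto simp: positive_selfadjoint_def)

lemma K_nonneg: "f \<in> H \<Longrightarrow> 0 \<le> ip (K f) f"
  using psa by (auto simp: positive_selfadjoint_def)

lemma ip_lincomb_left:
  assumes "f \<in> H" "g \<in> H" "k \<in> H"
  shows "ip (\<lambda>x. s * f x + t * g x) k = s * ip f k + t * ip g k"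
  using assms[THEN L2_zero_L2_space]
  by (simp add: L2_inner_add_left L2_space_mult L2_inner_mult_left)

lemma ip_lincomb_right:
  assumes "f \<in> H" "g \<in> H" "k \<in> H"
  shows "ip k (\<lambda>x. s * f x + t * g x) = s * ip k f + t * ip k g"
  using ip_lincomb_left[OF assms] by (simp add: L2_inner_commute)

lemma K_ip_commute:
  assumes "f \<in> H" "g \<in> H"
  shows "ip (K f) g = ip (K g) f"
  using K_sym[OF assms] L2_inner_commute[of M f "K g"] by simp

lemma K_lincomb_ip:
  assumes "f \<in> H" "g \<in> H" "k \<in> H"
  shows "ip (K (\<lambda>x. s * f x + t * g x)) k = s * ip (K f) k + t * ip (K g) k"
  using assms by (simp add: K_sym L2_zero_lincomb K_in ip_lincomb_left)

lemma K_lincomb_quadratic: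
  assumes "f \<in> H" "g \<in> H"
  shows "ip (K (\<lambda>x. s * f x + t * g x)) (\<lambda>x. s * f x + t * g x)
    = s\<^sup>2 * ip (K f) f + 2 * s * t * ip (K f) g + t\<^sup>2 * ip (K g) g"
  using assms K_ip_commute[OF assms]
  by (simp add: K_lincomb_ip L2_zero_lincomb K_in ip_lincomb_right power2_eq_square algebra_simps)

text \<open>Symmetry forces linearity: in the inner product of the defect \<open>?D\<close> with any
  function of \<open>H\<close>, the operator can be moved to the other side, where everything
  cancels. The defect lies in \<open>H\<close> itself, so it is orthogonal to itself and hence
  null.\<close>

lemma K_lincomb_AE:
  assumes f: "f \<in> H" and g: "g \<in> H"
  shows "AE x in M. K (\<lambda>x. s * f x + t * g x) x = s * K f x + t * K g x"
proof -
  let ?h = "\<lambda>x. s * f x + t * g x"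
  let ?k = "\<lambda>x. s * K f x + t * K g x"
  let ?D = "\<lambda>x. 1 * K ?h x + (- 1) * ?k x"
  have h: "?h \<in> H" by (rule L2_zero_lincomb[OF f g])
  have k: "?k \<in> H" by (rule L2_zero_lincomb[OF K_in[OF f] K_in[OF g]])
  have D: "?D \<in> H" by (rule L2_zero_lincomb[OF K_in[OF h] k])
  have "ip ?D ?D = 1 * ip (K ?h) ?D + (- 1) * ip ?k ?D"
    by (rule ip_lincomb_left[OF K_in[OF h] k D])
  also have "\<dots> = 0"
    unfolding K_lincomb_ip[OF f g D] ip_lincomb_left[OF K_in[OF f] K_in[OF g] D] by simp
  finally have "AE x in M. ?D x = 0"
    using L2_inner_self_eq_0_iff[OF L2_zero_L2_space[OF D]] by simp
  then show ?thesis by eventually_elim simp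
qed

lemma K_Cauchy_Schwarz:
  assumes f: "f \<in> H" and g: "g \<in> H"
  shows "(ip (K f) g)\<^sup>2 \<le> ip (K f) f * ip (K g) g"
proof (rule nonneg_quadratic_imp_discriminant)
  fix t :: real
  show "0 \<le> ip (K f) f + 2 * t * ip (K f) g + t\<^sup>2 * ip (K g) g"
    using K_nonneg[OF L2_zero_lincomb[OF f g, of 1 t]] K_lincomb_quadratic[OF f g, of 1 t] by simp
qed (rule K_nonneg[OF g])

text \<open>Parallelogram identity for the form \<open>ip (K f) g\<close>; the term dropped is its
  value at the difference of \<open>f\<close> and \<open>g\<close>, which is nonnegative.\<close>

lemma K_add_le:
  assumes f: "f \<in> H" and g: "g \<in> H"
  shows "ip (K (\<lambda>x. f x + g x)) (\<lambda>x. f x + g x) \<le> 2 * ip (K f) f + 2 * ip (K g) g"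
  using K_nonneg[OF L2_zero_lincomb[OF f g, of 1 "- 1"]] K_lincomb_quadratic[OF f g, of 1 1]
    K_lincomb_quadratic[OF f g, of 1 "- 1"] by simp

lemma T_nonneg: "0 \<le> T"
  using trace_le[of "{}"] by (simp add: orthonormal_def)

lemma ip_normalize:
  assumes "f \<in> H" "ip f f > 0"
  defines "e \<equiv> (\<lambda>x. inverse (sqrt (ip f f)) * f x)"
  shows "e \<in> H" "ip e e = 1" "ip (K e) e = ip (K f) f / ip f f"
proof -
  have *: "e = (\<lambda>x. inverse (sqrt (ip f f)) * f x + 0 * f x)" by (simp add: e_def)
  show e: "e \<in> H" unfolding * by (rule L2_zero_lincomb) (use assms in auto)
  show "ip e e = 1" using assms(2) unfolding e_def L2_inner_mult_left L2_inner_mult_right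
    by (simp add: field_simps)
  have "ip (K e) e = (inverse (sqrt (ip f f)))\<^sup>2 * ip (K f) f"
    unfolding * by (subst K_lincomb_quadratic) (use assms in auto)
  then show "ip (K e) e = ip (K f) f / ip f f"
    using assms(2) by (simp add: field_simps)
qed

text \<open>A null function need not be the constant 0, so nothing is known about \<open>K f\<close>
  pointwise; Cauchy-Schwarz for \<open>ip\<close> settles the case that cannot be
  normalised.\<close>

lemma K_degenerate:
  assumes "f \<in> H" "ip f f = 0"
  shows "ip (K f) f = 0"
  using L2_Cauchy_Schwarz[OF L2_zero_L2_space[OF K_in[OF assms(1)]] L2_zero_L2_space[OF assms(1)]]
    assms by simp

definition nearly_maximal :: "real \<Rightarrow> ('a \<Rightarrow> real) set \<Rightarrow> bool" where
  "nearly_maximal \<epsilon> E \<longleftrightarrow> orthonormal M E \<and> E \<subseteq> H \<and>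
    (\<forall>E'. orthonormal M E' \<longrightarrow> E' \<subseteq> H \<longrightarrow>
      (\<Sum>e\<in>E'. ip (K e) e) \<le> (\<Sum>e\<in>E. ip (K e) e) + \<epsilon>)"

lemma nearly_maximalD:
  assumes "nearly_maximal \<epsilon> E"
  shows "orthonormal M E" "E \<subseteq> H"
    and "\<And>E'. orthonormal M E' \<Longrightarrow> E' \<subseteq> H \<Longrightarrow>
      (\<Sum>e\<in>E'. ip (K e) e) \<le> (\<Sum>e\<in>E. ip (K e) e) + \<epsilon>"
  using assms by (auto simp: nearly_maximal_def)

text \<open>Adjoining the normalised \<open>f\<close> to \<open>E\<close> gives another orthonormal
  family, and its trace is larger by the Rayleigh quotient of \<open>f\<close>. Near-maximality caps
  this increase at \<open>\<epsilon>\<close>.\<close>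

lemma K_le_on_complement:
  assumes E: "nearly_maximal \<epsilon> E"
    and f: "f \<in> H" and orth: "\<And>e. e \<in> E \<Longrightarrow> ip f e = 0"
  shows "ip (K f) f \<le> \<epsilon> * ip f f"
proof (cases "ip f f = 0")
  case True
  then show ?thesis using K_degenerate[OF f] by simp
next
  case False
  then have pos: "ip f f > 0" using L2_inner_self_nonneg[of M f] by simp
  define e where "e = (\<lambda>x. inverse (sqrt (ip f f)) * f x)"
  note n = ip_normalize[OF f pos, folded e_def]
  have oe: "ip e e' = 0" if "e' \<in> E" for e'
    using orth[OF that] by (simp add: e_def L2_inner_mult_left)
  then have "e \<notin> E" using n(2) by auto
  moreover have "ip e' e = 0" if "e' \<in> E" for e'
    using oe[OF that] by (simp add: L2_inner_commute)
  ultimately have "orthonormal M (insert e E)"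
    using nearly_maximalD(1)[OF E] n(2) oe unfolding orthonormal_def by auto
  then have "(\<Sum>e\<in>insert e E. ip (K e) e) \<le> (\<Sum>e\<in>E. ip (K e) e) + \<epsilon>"
    using nearly_maximalD(2)[OF E] n(1) by (intro nearly_maximalD(3)[OF E]) auto
  then have "ip (K e) e \<le> \<epsilon>"
    using \<open>e \<notin> E\<close> nearly_maximalD(1)[OF E] by (simp add: orthonormal_def)
  then show ?thesis using n(3) pos by (simp add: field_simps)
qed

text \<open>The empty family has trace 0 and is therefore nearly maximal with error
  \<open>T\<close>; every \<open>f\<close> is orthogonal to it.\<close>

lemma K_le_T:
  assumes "f \<in> H"
  shows "ip (K f) f \<le> T * ip f f"
  by (rule K_le_on_complement[of _ "{}"])
    (use assms trace_le in \<open>auto simp: nearly_maximal_def orthonormal_def\<close>)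

text \<open>Cauchy-Schwarz for the form, applied to \<open>f\<close> and \<open>K f\<close>, bounds
  the fourth power of the norm of \<open>K f\<close>; two of the powers cancel. This converts
  estimates of the form into estimates of the norm.\<close>

lemma K_norm_le:
  assumes f: "f \<in> H"
  shows "ip (K f) (K f) \<le> T * ip (K f) f"
proof (cases "ip (K f) (K f) = 0")
  case True
  then show ?thesis using K_nonneg[OF f] T_nonneg by simp
next
  case False
  then have pos: "ip (K f) (K f) > 0" using L2_inner_self_nonneg[of M "K f"] by simp
  have "(ip (K f) (K f))\<^sup>2 \<le> ip (K f) f * ip (K (K f)) (K f)"
    by (rule K_Cauchy_Schwarz[OF f K_in[OF f]])
  also have "\<dots> \<le> ip (K f) f * (T * ip (K f) (K f))"
    by (intro mult_left_mono K_le_T K_in K_nonneg f)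
  finally show ?thesis using pos by (simp add: power2_eq_square mult.assoc mult.commute mult.left_commute)
qed

lemma ex_nearly_maximal:
  assumes "\<epsilon> > 0"
  shows "\<exists>E. nearly_maximal \<epsilon> E"
proof -
  define A where "A = (\<lambda>E. \<Sum>e\<in>E. ip (K e) e) ` {E. orthonormal M E \<and> E \<subseteq> H}"
  have bdd: "bdd_above A" unfolding A_def using trace_le by (auto intro!: bdd_aboveI[of _ T])
  have ne: "A \<noteq> {}" unfolding A_def by (auto simp: orthonormal_def intro!: exI[of _ "{}"])
  have "Sup A - \<epsilon> < Sup A" using assms by simp
  then obtain a where "a \<in> A" "Sup A - \<epsilon> < a" using less_cSup_iff[OF ne bdd] by auto
  have "b \<le> Sup A" if "b \<in> A" for b by (rule cSup_upper[OF that bdd])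
  then have "b \<le> a + \<epsilon>" if "b \<in> A" for b using that \<open>Sup A - \<epsilon> < a\<close> by fastforce
  with \<open>a \<in> A\<close> show ?thesis unfolding A_def nearly_maximal_def by auto
qed

lemma proj_in_L2_zero:
  assumes "orthonormal M E" "E \<subseteq> H"
  shows "proj M E f \<in> H"
  unfolding proj_def by (rule L2_zero_sum) (use assms in \<open>auto simp: orthonormal_def\<close>)

text \<open>Up to the error \<open>\<epsilon>\<close> the form sees only the finitely many
  coordinates of \<open>f\<close> along \<open>E\<close>: on the projection it is at most
  \<open>T\<close> times the squared norm, on the residual at most \<open>\<epsilon>\<close>
  times.\<close>

lemma K_split_le:
  assumes E: "nearly_maximal \<epsilon> E" and "\<epsilon> > 0"
    and f: "f \<in> H"
  shows "ip (K f) f \<le> 2 * T * (\<Sum>e\<in>E. (ip f e)\<^sup>2) + 2 * \<epsilon> * ip f f"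
proof -
  note E12 = nearly_maximalD(1,2)[OF E]
  have E': "E \<subseteq> L2_space M" using E12(2) L2_zero_subset_L2_space by blast
  note f' = L2_zero_L2_space[OF f]
  let ?p = "proj M E f" and ?r = "\<lambda>x. f x + - 1 * proj M E f x"
  have p: "?p \<in> H" by (rule proj_in_L2_zero[OF E12])
  have r: "?r \<in> H" using L2_zero_lincomb[OF f p, of 1 "- 1"] by simp
  have "ip (K f) f = ip (K (\<lambda>x. ?p x + ?r x)) (\<lambda>x. ?p x + ?r x)" by simp
  also have "\<dots> \<le> 2 * ip (K ?p) ?p + 2 * ip (K ?r) ?r" by (rule K_add_le[OF p r])
  also have "ip (K ?p) ?p \<le> T * ip ?p ?p" by (rule K_le_T[OF p])
  also have "ip ?p ?p = (\<Sum>e\<in>E. (ip f e)\<^sup>2)" by (rule proj_norm(1)[OF E12(1) E' f'])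
  also have "ip (K ?r) ?r \<le> \<epsilon> * ip ?r ?r"
    by (rule K_le_on_complement[OF E r residual_orthogonal[OF E12(1) E' f']])
  also have "ip ?r ?r \<le> ip f f"
    unfolding residual_norm[OF E12(1) E' f'] by (simp add: sum_nonneg)
  finally show ?thesis using \<open>\<epsilon> > 0\<close> by (simp add: mult.assoc)
qed

end

section \<open>Completeness of the mean-zero space and extraction of subsequences\<close>

context finite_measure
begin

lemma L1_norm_le_L2_norm:
  assumes f: "f \<in> L2_space M"
  shows "(\<integral>x. \<bar>f x\<bar> \<partial>M)\<^sup>2 \<le> L2_inner M f f * measure M (space M)"
proof -
  have "(\<lambda>x. \<bar>f x\<bar>) \<in> L2_space M" using f by (auto simp: L2_space_def)
  from L2_Cauchy_Schwarz[OF this L2_space_const[of 1]] show ?thesis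
    by (simp add: L2_inner_def)
qed

lemma L2_space_diff:
  assumes "f \<in> L2_space M" "g \<in> L2_space M"
  shows "(\<lambda>x. f x - g x) \<in> L2_space M"
  using L2_space_add[OF assms(1) L2_space_mult[OF assms(2), of "- 1"]] by simp

text \<open>Over a finite measure an L2-Cauchy sequence is L1-Cauchy, which gives a subsequence
  converging almost everywhere. Fatou's lemma then turns the pointwise limit into an L2 limit. A
  subsequence is all that compactness asks for.\<close>

lemma L2_zero_complete:
  fixes G :: "nat \<Rightarrow> 'a \<Rightarrow> real"
  assumes G: "\<And>n. G n \<in> L2_zero M"
    and cau: "\<And>e. e > 0 \<Longrightarrow> \<exists>N. \<forall>i\<ge>N. \<forall>j\<ge>N. L2_sq M (\<lambda>x. G i x - G j x) < e"
  obtains g r where "g \<in> L2_zero M" "strict_mono (r :: nat \<Rightarrow> nat)"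
    "(\<lambda>k. L2_dist M (G (r k)) g) \<longlonglongrightarrow> 0"
proof -
  let ?c = "\<lambda>i j. L2_sq M (\<lambda>x. G i x - G j x)"
  \<comment> \<open>Adding 1 allows division by \<open>m\<close> even if the measure is
    null.\<close>
  define m where "m = measure M (space M) + 1"
  have m: "m > 0" by (simp add: m_def add_nonneg_pos)
  have G2: "G n \<in> L2_space M" for n using G by (simp add: L2_zero_iff)
  note diff = L2_space_diff[OF G2 G2]
  have [measurable]: "G n \<in> borel_measurable M" for n using G2 by (simp add: L2_space_def)
  have "\<exists>N. \<forall>i\<ge>N. \<forall>j\<ge>N. LINT x|M. norm (G i x - G j x) < e" if "e > 0" for e
  proof -
    have "e\<^sup>2 / m > 0" using that m by simp
    from cau[OF this] obtain N where N: "\<And>i j. i \<ge> N \<Longrightarrow> j \<ge> N \<Longrightarrow>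
      ?c i j < e\<^sup>2 / m" by blast
    have "LINT x|M. norm (G i x - G j x) < e" if "i \<ge> N" "j \<ge> N" for i j
    proof -
      have "(LINT x|M. \<bar>G i x - G j x\<bar>)\<^sup>2
        \<le> ?c i j * measure M (space M)"
        by (rule L1_norm_le_L2_norm[OF diff])
      also have "\<dots> \<le> ?c i j * m"
        by (intro mult_left_mono L2_inner_self_nonneg) (simp add: m_def)
      also have "\<dots> < e\<^sup>2" using N[OF that] m by (simp add: field_simps)
      finally show ?thesis using \<open>e > 0\<close> by (simp add: power2_less_imp_less)
    qed
    then show ?thesis by blast
  qed
  from cauchy_L1_AE_cauchy_subseq[OF L2_space_integrable[OF G2] this]
  obtain r :: "nat \<Rightarrow> nat" where r: "strict_mono r" and ae: "AE x in M. Cauchy (\<lambda>i. G (r i) x)"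
    by blast
  define g where "g = (\<lambda>x. lim (\<lambda>i. G (r i) x))"
  have [measurable]: "g \<in> borel_measurable M" unfolding g_def by measurable
  have lim: "AE x in M. (\<lambda>i. G (r i) x) \<longlonglongrightarrow> g x"
    using ae unfolding g_def
    by eventually_elim (simp add: convergent_LIMSEQ_iff[symmetric] Cauchy_convergent_iff)
  let ?N = "\<lambda>i. \<integral>\<^sup>+x. ennreal ((G (r i) x - g x)\<^sup>2) \<partial>M"
  let ?d = "\<lambda>i x. G (r i) x - g x"
  have near: "\<exists>N. \<forall>i\<ge>N. ?N i \<le> ennreal e" if "e > 0" for e
  proof -
    from cau[OF that] obtain N where N: "\<And>i j. i \<ge> N \<Longrightarrow> j \<ge> N \<Longrightarrow>
      ?c i j < e" by blast
    have "?N i \<le> ennreal e" if "i \<ge> N" for i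
    proof -
      \<comment> \<open>Fatou in \<open>j\<close>: the integrand is the limit of the squared
        differences to \<open>G (r j)\<close>, whose integrals are at most \<open>e\<close> for
        large \<open>j\<close>.\<close>
      have "?N i
        = (\<integral>\<^sup>+x. liminf (\<lambda>j. ennreal ((G (r i) x - G (r j) x)\<^sup>2)) \<partial>M)"
      proof (rule nn_integral_cong_AE)
        show "AE x in M. ennreal ((G (r i) x - g x)\<^sup>2)
          = liminf (\<lambda>j. ennreal ((G (r i) x - G (r j) x)\<^sup>2))"
          using lim
        proof eventually_elim
          case (elim x)
          then have "(\<lambda>j. ennreal ((G (r i) x - G (r j) x)\<^sup>2)) \<longlonglongrightarrow> ennreal ((G (r i) x - g x)\<^sup>2)"
            by (intro tendsto_intros)
          then show ?case by (intro lim_imp_Liminf[symmetric]) simp_all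
        qed
      qed
      also have "\<dots> \<le> liminf (\<lambda>j. \<integral>\<^sup>+x. ennreal ((G (r i) x - G (r j) x)\<^sup>2) \<partial>M)"
        by (rule nn_integral_liminf) measurable
      also have "\<dots> \<le> liminf (\<lambda>j. ennreal e)"
      proof (rule Liminf_mono)
        show "\<forall>\<^sub>F j in sequentially. (\<integral>\<^sup>+x. ennreal ((G (r i) x - G (r j) x)\<^sup>2) \<partial>M) \<le> ennreal e"
          using eventually_ge_at_top[of N]
        proof eventually_elim
          case (elim j)
          have "r i \<ge> N" "r j \<ge> N" using that elim seq_suble[OF r] by (meson order_trans)+
          have "(\<integral>\<^sup>+x. ennreal ((G (r i) x - G (r j) x)\<^sup>2) \<partial>M)
            = ennreal (L2_sq M (\<lambda>x. G (r i) x - G (r j) x))"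
            unfolding L2_inner_def power2_eq_square[symmetric]
            by (rule nn_integral_eq_integral) (use diff in \<open>auto simp: L2_space_def\<close>)
          also have "\<dots> \<le> ennreal e"
            using N[OF \<open>r i \<ge> N\<close> \<open>r j \<ge> N\<close>] by (intro ennreal_leI) simp
          finally show ?case .
        qed
      qed
      finally show ?thesis by (simp add: Liminf_const)
    qed
    then show ?thesis by blast
  qed
  have L2d: "?d i \<in> L2_space M"
    and ipd: "L2_sq M (?d i) \<le> e"
    if "?N i \<le> ennreal e" "e > 0" for i e
  proof -
    have int: "integrable M (\<lambda>x. (G (r i) x - g x)\<^sup>2)"
      using that(1) by (intro integrableI_nonneg) (auto intro: le_less_trans)
    then show "?d i \<in> L2_space M" by (simp add: L2_space_def)
    show "L2_sq M (?d i) \<le> e"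
      using that nn_integral_eq_integral[OF int]
      by (simp add: L2_inner_def power2_eq_square[symmetric] ennreal_le_iff)
  qed
  have dist: "(\<lambda>k. L2_dist M (G (r k)) g) \<longlonglongrightarrow> 0"
  proof (rule LIMSEQ_I)
    fix e :: real assume e: "e > 0"
    then have e2: "(e/2)\<^sup>2 > 0" by simp
    from near[OF e2] obtain N where
      N: "\<And>i. i \<ge> N \<Longrightarrow> ?N i \<le> ennreal ((e/2)\<^sup>2)" by blast
    have "norm (L2_dist M (G (r i)) g - 0) < e" if "i \<ge> N" for i
    proof -
      have "L2_dist M (G (r i)) g \<le> e / 2"
        using ipd[OF N[OF that] e2] e unfolding L2_dist_def
        by (intro real_le_lsqrt) (auto simp: L2_inner_self_nonneg)
      moreover have "0 \<le> L2_dist M (G (r i)) g" by (simp add: L2_dist_def L2_inner_self_nonneg)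
      ultimately show ?thesis using e by simp
    qed
    then show "\<exists>N. \<forall>i\<ge>N. norm (L2_dist M (G (r i)) g - 0) < e" by blast
  qed
  obtain i0 where i0: "?N i0 \<le> ennreal 1"
    using near[of 1] by auto
  have "(\<lambda>x. G (r i0) x - (G (r i0) x - g x)) \<in> L2_space M"
    by (intro L2_space_diff G2 L2d[OF i0]) simp
  then have g2: "g \<in> L2_space M" by simp
  \<comment> \<open>The mean of \<open>g\<close> differs from the mean 0 of \<open>G (r i)\<close>
    by at most their L1 distance, and a squared L2 distance of at most \<open>e\<^sup>2 / m\<close>
    keeps this at most \<open>e\<close>.\<close>
  have "\<bar>\<integral>x. g x \<partial>M\<bar> \<le> e" if "e > 0" for e
  proof -
    have e: "e\<^sup>2 / m > 0" using that m by simp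
    from near[OF e] obtain i where
      i: "?N i \<le> ennreal (e\<^sup>2 / m)" by blast
    have "(\<integral>x. G (r i) x - g x \<partial>M) = - (\<integral>x. g x \<partial>M)"
      using G[of "r i"] by (simp add: L2_space_integrable G2 g2 L2_zero_iff)
    then have "\<bar>\<integral>x. g x \<partial>M\<bar> = \<bar>\<integral>x. G (r i) x - g x \<partial>M\<bar>" by simp
    also have "\<dots> \<le> (\<integral>x. \<bar>G (r i) x - g x\<bar> \<partial>M)" by (rule integral_abs_bound)
    finally have "\<bar>\<integral>x. g x \<partial>M\<bar>\<^sup>2 \<le> (\<integral>x. \<bar>G (r i) x - g x\<bar> \<partial>M)\<^sup>2"
      by (intro power_mono) auto
    also have "\<dots> \<le> L2_sq M (?d i) * measure M (space M)"
      by (rule L1_norm_le_L2_norm[OF L2d[OF i e]])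
    also have "\<dots> \<le> (e\<^sup>2 / m) * m"
      by (intro mult_mono ipd[OF i e]) (use e m in \<open>auto simp: m_def\<close>)
    also have "\<dots> = e\<^sup>2" using m by simp
    finally show ?thesis by (rule power2_le_imp_le) (use that in simp)
  qed
  then have "\<bar>\<integral>x. g x \<partial>M\<bar> \<le> 0" by (rule field_le_epsilon[of _ 0, simplified])
  then have "g \<in> L2_zero M" using g2 by (simp add: L2_zero_iff)
  with r dist that show ?thesis by blast
qed

end

text \<open>The rows \<open>c k\<close> lie in a product of compact intervals. The product is
  compact by Tychonoff and metrizable as the index type is countable, hence sequentially compact;
  this replaces a diagonal argument.\<close>

lemma bounded_convergent_subsequence:
  fixes c :: "nat \<Rightarrow> 'i::countable \<Rightarrow> real"
  assumes "\<And>k i. \<bar>c k i\<bar> \<le> b i"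
  obtains r where "strict_mono (r :: nat \<Rightarrow> nat)" "\<And>i. convergent (\<lambda>k. c (r k) i)"
proof -
  let ?S = "Pi\<^sub>E UNIV (\<lambda>i. {- b i .. b i})"
  have "compactin (product_topology (\<lambda>_. euclidean) UNIV) ?S"
    by (simp add: compactin_PiE)
  then have "compact ?S" by (simp add: euclidean_product_topology)
  then have "seq_compact ?S" by (simp add: compact_eq_seq_compact_metric)
  moreover have "\<forall>k. c k \<in> ?S"
  proof
    fix k
    have "- b i \<le> c k i \<and> c k i \<le> b i" for i using assms[of k i] by linarith
    then show "c k \<in> ?S" by auto
  qed
  ultimately obtain l r where l: "l \<in> ?S" "strict_mono (r :: nat \<Rightarrow> nat)" "(c \<circ> r) \<longlonglongrightarrow> l"
    by (rule seq_compactE)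
  have "(\<lambda>k. (c \<circ> r) k i) \<longlonglongrightarrow> l i" for i
    using continuous_on_tendsto_compose[OF continuous_on_product_coordinates[of i] l(3)] by simp
  then have "convergent (\<lambda>k. c (r k) i)" for i
    by (auto simp: convergent_def o_def)
  with l(2) that show ?thesis by blast
qed

section \<open>Compactness\<close>

context bounded_trace_operator
begin

text \<open>One nearly maximal family is fixed for each error \<open>1 / (j + 1)\<close>. A bounded
  sequence has bounded coefficients along these countably many functions, so along a subsequence all
  of them converge. Then \<open>K_split_le\<close> makes the form small on differences, and
  \<open>K_norm_le\<close> does the same for the norm of their images.\<close>

theorem compact: "compact_operator M K"
  unfolding compact_operator_def
proof (intro allI impI)
  fix F :: "nat \<Rightarrow> 'a \<Rightarrow> real" and B
  assume "\<forall>k. F k \<in> H \<and> ip (F k) (F k) \<le> B"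
  then have F: "F k \<in> H" and FB: "ip (F k) (F k) \<le> B" for k by auto
  have B0: "0 \<le> B" using FB[of 0] L2_inner_self_nonneg[of M "F 0"] by linarith
  have "\<exists>E. nearly_maximal (inverse (real (Suc j))) E" for j
    by (rule ex_nearly_maximal) simp
  then obtain E where nm: "\<And>j. nearly_maximal (inverse (real (Suc j))) (E j)" by metis
  note E = nearly_maximalD(1,2)[OF nm]
  have finE: "finite (E j)" for j using E(1) by (simp add: orthonormal_def)
  \<comment> \<open>Padding with the zero function makes the enumeration total even if
    \<open>E j\<close> is empty; the coefficients of all families then form a single array over
    pairs of natural numbers.\<close>
  define en where "en j = from_nat_into (insert (\<lambda>_. 0) (E j))" for j
  have en: "en j i \<in> insert (\<lambda>_. 0) (E j)" for j i
    unfolding en_def by (rule from_nat_into) simp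
  have en_surj: "\<exists>i. en j i = e" if "e \<in> E j" for e j
    using from_nat_into_surj[of "insert (\<lambda>_. 0) (E j)" e] that finE
    by (auto simp: en_def countable_finite)
  define c where "c k ji = ip (F k) (en (fst ji) (snd ji))" for k and ji :: "nat \<times> nat"
  have cB: "\<bar>c k ji\<bar> \<le> sqrt B" for k ji
  proof -
    let ?e = "en (fst ji) (snd ji)"
    have e: "?e \<in> L2_space M" "ip ?e ?e \<le> 1"
      using en[of "fst ji" "snd ji"] E[of "fst ji"] L2_zero_subset_L2_space[of M]
      by (auto simp: orthonormal_def L2_inner_def L2_space_def)
    have "(c k ji)\<^sup>2 \<le> ip (F k) (F k) * ip ?e ?e"
      unfolding c_def by (rule L2_Cauchy_Schwarz[OF L2_zero_L2_space[OF F] e(1)])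
    also have "\<dots> \<le> B * 1"
      using FB e B0 by (intro mult_mono) (auto simp: L2_inner_self_nonneg)
    finally show ?thesis by (simp add: real_le_rsqrt)
  qed
  from bounded_convergent_subsequence[of c "\<lambda>_. sqrt B", OF cB]
  obtain r where r: "strict_mono (r :: nat \<Rightarrow> nat)" and cr: "\<And>ji. convergent (\<lambda>k. c (r k) ji)"
    by blast
  define D where "D k l = (\<lambda>x. 1 * F (r k) x + (- 1) * F (r l) x)" for k l
  have D: "D k l \<in> H" for k l unfolding D_def by (rule L2_zero_lincomb[OF F F])
  \<comment> \<open>The constant 4 comes from the parallelogram law, where the squared norm of the
    sum \<open>?s\<close> is dropped.\<close>
  have DB: "ip (D k l) (D k l) \<le> 4 * B" for k l
  proof -
    let ?s = "\<lambda>x. 1 * F (r k) x + 1 * F (r l) x"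
    note lc = ip_lincomb_left[OF F F] ip_lincomb_right[OF F F]
    have "0 \<le> ip ?s ?s" by (rule L2_inner_self_nonneg)
    then have "0 \<le> ip (F (r k)) (F (r k)) + 2 * ip (F (r k)) (F (r l)) + ip (F (r l)) (F (r l))"
      unfolding lc(1)[OF L2_zero_lincomb[OF F F]] lc(2)[OF F] L2_inner_commute[of M "F (r l)" "F (r k)"]
      by simp
    moreover have "ip (D k l) (D k l) =
      ip (F (r k)) (F (r k)) - 2 * ip (F (r k)) (F (r l)) + ip (F (r l)) (F (r l))"
      unfolding D_def lc(1)[OF L2_zero_lincomb[OF F F]] lc(2)[OF F] L2_inner_commute[of M "F (r l)" "F (r k)"]
      by simp
    ultimately show ?thesis using FB[of "r k"] FB[of "r l"] by linarith
  qed
  have coef: "\<exists>N. \<forall>k\<ge>N. \<forall>l\<ge>N. (\<Sum>e\<in>E j. (ip (D k l) e)\<^sup>2) < \<delta>" if "\<delta> > 0" for j \<delta>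
  proof -
    \<comment> \<open>Dividing by the cardinality plus 1 keeps the sum strictly below
      \<open>\<delta>\<close> and covers the empty family.\<close>
    let ?\<delta> = "sqrt (\<delta> / (real (card (E j)) + 1))"
    have d: "?\<delta> > 0" using that by (simp add: add_nonneg_pos)
    have "\<exists>N. \<forall>k\<ge>N. \<forall>l\<ge>N. \<bar>ip (D k l) e\<bar> < ?\<delta>" if e: "e \<in> E j" for e
    proof -
      obtain i where i: "en j i = e" using en_surj[OF e] by blast
      have e0: "e \<in> H" using e E(2) by blast
      have "Cauchy (\<lambda>k. c (r k) (j, i))" using cr[of "(j, i)"] by (simp add: Cauchy_convergent_iff)
      from CauchyD[OF this d] obtain N where
        N: "\<And>k l. k \<ge> N \<Longrightarrow> l \<ge> N \<Longrightarrow> norm (c (r k) (j, i) - c (r l) (j, i)) < ?\<delta>" by blast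
      have "ip (D k l) e = c (r k) (j, i) - c (r l) (j, i)" for k l
        unfolding D_def ip_lincomb_left[OF F F e0] c_def using i by simp
      then show ?thesis using N by (intro exI[of _ N]) simp
    qed
    then obtain N where N: "\<And>e k l. e \<in> E j \<Longrightarrow> k \<ge> N e \<Longrightarrow> l \<ge> N e \<Longrightarrow> \<bar>ip (D k l) e\<bar> < ?\<delta>"
      by metis
    \<comment> \<open>The sum of the thresholds \<open>N e\<close> serves as a common upper bound
      for them.\<close>
    have "(\<Sum>e\<in>E j. (ip (D k l) e)\<^sup>2) < \<delta>"
      if "k \<ge> (\<Sum>e\<in>E j. N e)" "l \<ge> (\<Sum>e\<in>E j. N e)" for k l
    proof -
      have "(\<Sum>e\<in>E j. (ip (D k l) e)\<^sup>2) \<le> (\<Sum>e\<in>E j. \<delta> / (real (card (E j)) + 1))"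
      proof (rule sum_mono)
        fix e assume e: "e \<in> E j"
        have "N e \<le> (\<Sum>e\<in>E j. N e)" by (rule member_le_sum[OF e]) (use finE in auto)
        then have "\<bar>ip (D k l) e\<bar> < ?\<delta>" using N[OF e, of k l] that by linarith
        then have "\<bar>ip (D k l) e\<bar>\<^sup>2 \<le> ?\<delta>\<^sup>2" by (intro power_mono) auto
        then show "(ip (D k l) e)\<^sup>2 \<le> \<delta> / (real (card (E j)) + 1)" using \<open>\<delta> > 0\<close> by simp
      qed
      also have "\<dots> = real (card (E j)) * \<delta> / (real (card (E j)) + 1)" by simp
      also have "\<dots> < \<delta>" using \<open>\<delta> > 0\<close> by (simp add: field_simps add_nonneg_pos)
      finally show ?thesis .
    qed
    then show ?thesis by blast
  qed
  have KD: "L2_sq M (\<lambda>x. K (F (r k)) x - K (F (r l)) x)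
      = ip (K (D k l)) (K (D k l))" for k l
  proof -
    have "AE x in M. K (D k l) x = 1 * K (F (r k)) x + (- 1) * K (F (r l)) x"
      unfolding D_def by (rule K_lincomb_AE[OF F F])
    then have ae: "AE x in M. K (D k l) x = K (F (r k)) x - K (F (r l)) x" by simp
    have [measurable]: "K (D k l) \<in> borel_measurable M" "K (F m) \<in> borel_measurable M" for m
      using K_in[OF D] K_in[OF F] by (auto simp: L2_zero_def)
    show ?thesis unfolding L2_inner_def
      by (rule integral_cong_AE) (use ae in auto)
  qed
  have cau: "\<exists>N. \<forall>k\<ge>N. \<forall>l\<ge>N.
    L2_sq M (\<lambda>x. K (F (r k)) x - K (F (r l)) x) < \<delta>"
    if "\<delta> > 0" for \<delta>
  proof -
    \<comment> \<open>The estimate to come is \<open>2 * T\<^sup>2 * ?s + ?i * (8 * T * B)\<close>.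
      The choices of \<open>j\<close> and \<open>N\<close> put each summand below
      \<open>\<delta> / 2\<close>; \<open>T + 1\<close> and \<open>B + 1\<close> keep the divisors
      positive.\<close>
    have "\<delta> / (16 * (T + 1) * (B + 1)) > 0" using that T_nonneg B0 by simp
    then obtain j where "inverse (real (Suc j)) < \<delta> / (16 * (T + 1) * (B + 1))"
      using reals_Archimedean by blast
    moreover have "16 * (T + 1) * (B + 1) > 0" using T_nonneg B0 by simp
    ultimately have j: "inverse (real (Suc j)) * (16 * (T + 1) * (B + 1)) < \<delta>"
      by (simp only: pos_less_divide_eq)
    have d: "\<delta> / (4 * (T + 1)\<^sup>2) > 0" using that T_nonneg by simp
    from coef[OF this] obtain N where N: "\<And>k l. k \<ge> N \<Longrightarrow> l \<ge> N \<Longrightarrow>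
      (\<Sum>e\<in>E j. (ip (D k l) e)\<^sup>2) < \<delta> / (4 * (T + 1)\<^sup>2)" by blast
    have "ip (K (D k l)) (K (D k l)) < \<delta>" if kl: "k \<ge> N" "l \<ge> N" for k l
    proof -
      let ?s = "\<Sum>e\<in>E j. (ip (D k l) e)\<^sup>2" and ?i = "inverse (real (Suc j))"
      have "ip (K (D k l)) (K (D k l)) \<le> T * ip (K (D k l)) (D k l)" by (rule K_norm_le[OF D])
      also have "\<dots> \<le> T * (2 * T * ?s + 2 * ?i * ip (D k l) (D k l))"
        by (intro mult_left_mono T_nonneg K_split_le nm D) simp_all
      also have "\<dots> \<le> T * (2 * T * ?s + 2 * ?i * (4 * B))"
        by (intro mult_left_mono add_left_mono T_nonneg DB) simp
      also have "\<dots> = 2 * T\<^sup>2 * ?s + ?i * (8 * T * B)" by (simp add: power2_eq_square algebra_simps)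
      also have "2 * T\<^sup>2 * ?s \<le> 2 * (T + 1)\<^sup>2 * ?s"
        using T_nonneg by (intro mult_right_mono mult_left_mono power_mono sum_nonneg) auto
      also have "2 * (T + 1)\<^sup>2 * ?s < \<delta> / 2"
        using N[OF kl] T_nonneg by (simp add: field_simps)
      also have "?i * (8 * T * B) \<le> ?i * (8 * (T + 1) * (B + 1))"
        using T_nonneg B0 by (intro mult_left_mono mult_mono) auto
      also have "\<dots> = ?i * (16 * (T + 1) * (B + 1)) / 2" by (simp add: algebra_simps)
      also have "\<dots> < \<delta> / 2"
        using j by (rule divide_strict_right_mono) simp
      finally show ?thesis by simp
    qed
    then show ?thesis unfolding KD by blast
  qed
  from L2_zero_complete[of "\<lambda>k. K (F (r k))", OF K_in[OF F] cau] obtain g s where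
    g: "g \<in> H" "strict_mono (s :: nat \<Rightarrow> nat)"
      "(\<lambda>k. L2_dist M (K (F (r (s k)))) g) \<longlonglongrightarrow> 0"
    by blast
  have "strict_mono (\<lambda>k. r (s k))" using r g(2) by (simp add: strict_mono_def)
  with g show "\<exists>g\<in>H. \<exists>r :: nat \<Rightarrow> nat. strict_mono r \<and>
      (\<lambda>k. L2_dist M (K (F (r k))) g) \<longlonglongrightarrow> 0" by blast
qed

end

section \<open>Eigenspaces and the sum of the eigenvalues\<close>

context bounded_trace_operator
begin

lemma eigenspace_lincomb:
  assumes f: "f \<in> eigenspace M K l" and g: "g \<in> eigenspace M K l"
  shows "(\<lambda>x. s * f x + t * g x) \<in> eigenspace M K l"
proof -
  have f': "f \<in> H" "AE x in M. K f x = l * f x"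
    and g': "g \<in> H" "AE x in M. K g x = l * g x"
    using f g by (auto simp: eigenspace_def)
  have "AE x in M. K (\<lambda>x. s * f x + t * g x) x = l * (s * f x + t * g x)"
    using K_lincomb_AE[OF f'(1) g'(1), of s t] f'(2) g'(2)
    by eventually_elim (simp add: algebra_simps)
  then show ?thesis using L2_zero_lincomb[OF f'(1) g'(1)] by (simp add: eigenspace_def)
qed

lemma zero_in_eigenspace: "(\<lambda>_. 0) \<in> eigenspace M K l"
proof -
  have z: "(\<lambda>_. 0) \<in> H" by (simp add: L2_zero_def)
  then show ?thesis using K_lincomb_AE[OF z z, of 0 0] by (simp add: eigenspace_def)
qed

lemma eigenspace_sum:
  assumes "finite I" "\<And>i. i \<in> I \<Longrightarrow> F i \<in> eigenspace M K l"
  shows "(\<lambda>x. \<Sum>i\<in>I. c i * F i x) \<in> eigenspace M K l"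
  using assms
proof (induction I rule: finite_induct)
  case empty
  then show ?case by (simp add: zero_in_eigenspace)
next
  case (insert i I)
  then show ?case
    using eigenspace_lincomb[of "F i" l "\<lambda>x. \<Sum>i\<in>I. c i * F i x" "c i" 1] by simp
qed

lemma eigenspace_ip:
  assumes "f \<in> eigenspace M K l" "g \<in> H"
  shows "ip (K f) g = l * ip f g"
proof -
  have f: "f \<in> H" "AE x in M. K f x = l * f x" using assms by (auto simp: eigenspace_def)
  have "ip (K f) g = ip (\<lambda>x. l * f x) g"
    by (rule L2_inner_cong_AE) (use f assms K_in[OF f(1)] in \<open>auto simp: L2_zero_def\<close>)
  then show ?thesis by (simp add: L2_inner_mult_left)
qed

lemma eigenspaces_orthogonal:
  assumes f: "f \<in> eigenspace M K l" and g: "g \<in> eigenspace M K l'" and "l \<noteq> l'"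
  shows "ip f g = 0"
proof -
  have z: "f \<in> H" "g \<in> H" using f g by (auto simp: eigenspace_def)
  have "l * ip f g = ip (K f) g" using eigenspace_ip[OF f z(2)] by simp
  also have "\<dots> = ip (K g) f" by (rule K_ip_commute[OF z])
  also have "\<dots> = l' * ip f g" using eigenspace_ip[OF g z(1)] by (simp add: L2_inner_commute)
  finally show ?thesis using \<open>l \<noteq> l'\<close> by simp
qed

lemma eigenvalue_nonneg:
  assumes "l \<in> eigenvalues M K"
  shows "0 \<le> l"
proof -
  obtain f where f: "f \<in> eigenspace M K l" "\<not> (AE x in M. f x = 0)"
    using assms by (auto simp: eigenvalues_def)
  then have z: "f \<in> H" by (auto simp: eigenspace_def)
  have "ip f f \<noteq> 0" using f(2) L2_inner_self_eq_0_iff[OF L2_zero_L2_space[OF z]] by simp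
  then have "ip f f > 0" using L2_inner_self_nonneg[of M f] by simp
  then show ?thesis using K_nonneg[OF z] eigenspace_ip[OF f(1) z] by (simp add: zero_le_mult_iff)
qed

text \<open>\<open>AE_dim\<close> counts independent families, whereas the trace bound concerns
  orthonormal ones. The induction carries along that every constructed function is a combination of
  the first \<open>F i\<close>, since independence is stated in terms of such combinations.\<close>

lemma Gram_Schmidt_eigenspace:
  fixes F :: "nat \<Rightarrow> 'a \<Rightarrow> real"
  assumes F: "\<And>i. i < m \<Longrightarrow> F i \<in> eigenspace M K l"
    and indep: "\<And>c :: nat \<Rightarrow> real. AE x in M. (\<Sum>i<m. c i * F i x) = 0 \<Longrightarrow> \<forall>i<m. c i = 0"
  obtains E where "orthonormal M E" "E \<subseteq> eigenspace M K l" "card E = m"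
proof -
  have "\<exists>E. orthonormal M E \<and> card E = k \<and> (\<forall>e\<in>E. \<exists>c. e = (\<lambda>x. \<Sum>i<k. c i * F i x))"
    if "k \<le> m" for k
    using that
  proof (induction k)
    case 0
    then show ?case by (intro exI[of _ "{}"]) (simp add: orthonormal_def)
  next
    case (Suc k)
    then obtain E where E: "orthonormal M E" "card E = k"
      and span: "\<forall>e\<in>E. \<exists>c. e = (\<lambda>x. \<Sum>i<k. c i * F i x)" by auto
    then obtain c where c: "\<And>e. e \<in> E \<Longrightarrow> e = (\<lambda>x. \<Sum>i<k. c e i * F i x)" by metis
    have fin: "finite E" using E(1) by (simp add: orthonormal_def)
    have EE: "E \<subseteq> eigenspace M K l"
    proof
      fix e assume "e \<in> E"
      have "(\<lambda>x. \<Sum>i<k. c e i * F i x) \<in> eigenspace M K l"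
        by (rule eigenspace_sum) (use F Suc.prems in auto)
      then show "e \<in> eigenspace M K l" using c[OF \<open>e \<in> E\<close>] by simp
    qed
    then have E2: "E \<subseteq> L2_space M" by (auto simp: eigenspace_def L2_zero_iff)
    have Fk: "F k \<in> eigenspace M K l" using F Suc.prems by simp
    then have Fk2: "F k \<in> L2_space M" by (auto simp: eigenspace_def L2_zero_iff)
    let ?r = "\<lambda>x. F k x + - 1 * proj M E (F k) x"
    \<comment> \<open>The coefficients of the residual \<open>?r\<close>. The one at
      \<open>k\<close> is 1, so a null residual would be a nontrivial relation among the
      \<open>F i\<close>.\<close>
    define d where "d i = (if i = k then 1 else - (\<Sum>e\<in>E. ip (F k) e * c e i))" for i
    have pr: "proj M E (F k) x = (\<Sum>i<k. (\<Sum>e\<in>E. ip (F k) e * c e i) * F i x)" for x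
    proof -
      have "proj M E (F k) x = (\<Sum>e\<in>E. ip (F k) e * (\<Sum>i<k. c e i * F i x))"
        unfolding proj_def by (rule sum.cong[OF refl]) (metis c)
      also have "\<dots> = (\<Sum>e\<in>E. \<Sum>i<k. ip (F k) e * c e i * F i x)"
        by (simp add: sum_distrib_left mult.assoc)
      also have "\<dots> = (\<Sum>i<k. \<Sum>e\<in>E. ip (F k) e * c e i * F i x)" by (rule sum.swap)
      finally show ?thesis by (simp add: sum_distrib_right)
    qed
    have rd: "?r = (\<lambda>x. \<Sum>i<Suc k. d i * F i x)"
      by (rule ext) (simp add: pr d_def sum_negf)
    have rE: "?r \<in> eigenspace M K l"
      unfolding rd by (rule eigenspace_sum) (use F Suc.prems in auto)
    then have r0: "?r \<in> H" by (simp add: eigenspace_def)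
    have "\<not> (AE x in M. ?r x = 0)"
    proof
      assume a: "AE x in M. ?r x = 0"
      \<comment> \<open>Independence speaks of all \<open>i < m\<close>, so the coefficients are
        extended by 0.\<close>
      define d' where "d' i = (if i < Suc k then d i else 0)" for i
      have "(\<Sum>i<m. d' i * F i x) = (\<Sum>i<Suc k. d i * F i x)" for x
        using Suc.prems by (intro sum.mono_neutral_cong_right) (auto simp: d'_def)
      then have "AE x in M. (\<Sum>i<m. d' i * F i x) = 0"
        using a unfolding fun_cong[OF rd] by simp
      from indep[OF this] have "d' k = 0" using Suc.prems by simp
      then show False by (simp add: d'_def d_def)
    qed
    then have "ip ?r ?r \<noteq> 0" using L2_inner_self_eq_0_iff[OF L2_zero_L2_space[OF r0]] by simp
    then have pos: "ip ?r ?r > 0" using L2_inner_self_nonneg[of M ?r] by linarith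
    define e where "e = (\<lambda>x. inverse (sqrt (ip ?r ?r)) * ?r x)"
    have e1: "ip e e = 1" using ip_normalize(2)[OF r0 pos] unfolding e_def .
    have oe: "ip e e' = 0" if "e' \<in> E" for e'
      using residual_orthogonal[OF E(1) E2 Fk2 that] by (simp only: e_def L2_inner_mult_left)
    then have oe': "ip e' e = 0" if "e' \<in> E" for e'
      using that by (simp add: L2_inner_commute)
    have "e \<notin> E" using oe e1 by auto
    have 1: "orthonormal M (insert e E)" using E(1) oe oe' e1 unfolding orthonormal_def by auto
    have 2: "card (insert e E) = Suc k" using \<open>e \<notin> E\<close> fin E(2) by simp
    define t where "t = inverse (sqrt (ip ?r ?r))"
    have e_span: "e = (\<lambda>x. \<Sum>i<Suc k. (t * d i) * F i x)"
    proof
      fix x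
      have "e x = t * ?r x" by (simp only: e_def t_def)
      also have "?r x = (\<Sum>i<Suc k. d i * F i x)" by (rule fun_cong[OF rd])
      finally show "e x = (\<Sum>i<Suc k. (t * d i) * F i x)" by (simp only: sum_distrib_left mult.assoc)
    qed
    have E_span: "e' = (\<lambda>x. \<Sum>i<Suc k. (if i = k then 0 else c e' i) * F i x)" if "e' \<in> E" for e'
      by (subst c[OF that]) (rule ext, simp)
    have "\<exists>c. e' = (\<lambda>x. \<Sum>i<Suc k. c i * F i x)" if "e' \<in> insert e E" for e'
    proof (cases "e' = e")
      case True
      then show ?thesis using e_span by (intro exI[of _ "\<lambda>i. t * d i"]) simp
    next
      case False
      then have "e' \<in> E" using that by simp
      from E_span[OF this] show ?thesis by (rule exI[of _ "\<lambda>i. if i = k then 0 else c e' i"])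
    qed
    then have "\<forall>e'\<in>insert e E. \<exists>c. e' = (\<lambda>x. \<Sum>i<Suc k. c i * F i x)" by simp
    with 1 2 show ?case by blast
  qed
  from this[of m] obtain E where E: "orthonormal M E" "card E = m"
    and span: "\<forall>e\<in>E. \<exists>c. e = (\<lambda>x. \<Sum>i<m. c i * F i x)" by auto
  have "E \<subseteq> eigenspace M K l"
  proof
    fix e assume "e \<in> E"
    with span obtain c where "e = (\<lambda>x. \<Sum>i<m. c i * F i x)" by blast
    moreover have "(\<lambda>x. \<Sum>i<m. c i * F i x) \<in> eigenspace M K l"
      by (rule eigenspace_sum) (use F in auto)
    ultimately show "e \<in> eigenspace M K l" by simp
  qed
  with E that show ?thesis by blast
qed

text \<open>The index set of the supremum in \<open>AE_dim\<close> for an eigenspace, named so that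
  finite sizes can be treated before suprema are taken.\<close>

definition indep_sizes :: "real \<Rightarrow> nat set" where
  "indep_sizes l = {m. \<exists>F :: nat \<Rightarrow> 'a \<Rightarrow> real. (\<forall>i<m. F i \<in> eigenspace M K l) \<and>
        (\<forall>c :: nat \<Rightarrow> real. (AE x in M. (\<Sum>i<m. c i * F i x) = 0) \<longrightarrow> (\<forall>i<m. c i = 0))}"

text \<open>Size 0 is always admissible. A nonempty index set is what allows a summand to be moved
  inside the supremum.\<close>

lemma indep_sizes_nonempty: "indep_sizes l \<noteq> {}"
  unfolding indep_sizes_def by (auto intro!: exI[of _ 0])

text \<open>Eigenspaces of different eigenvalues are orthogonal, so orthonormal families chosen in
  each of them unite to one orthonormal family. Its trace is the left-hand side.\<close>

lemma sum_eigenvalues_le: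
  assumes "finite A" "A \<subseteq> eigenvalues M K" "\<And>l. l \<in> A \<Longrightarrow> n l \<in> indep_sizes l"
  shows "(\<Sum>l\<in>A. l * real (n l)) \<le> T"
proof -
  have "\<exists>E. orthonormal M E \<and> (\<forall>e\<in>E. \<exists>l\<in>A. e \<in> eigenspace M K l) \<and>
    (\<Sum>e\<in>E. ip (K e) e) = (\<Sum>l\<in>A. l * real (n l))"
    using assms
  proof (induction A rule: finite_induct)
    case empty
    show ?case by (intro exI[of _ "{}"]) (simp add: orthonormal_def)
  next
    case (insert a A)
    then obtain E where E: "orthonormal M E" "\<forall>e\<in>E. \<exists>l\<in>A. e \<in> eigenspace M K l"
      "(\<Sum>e\<in>E. ip (K e) e) = (\<Sum>l\<in>A. l * real (n l))" by auto
    have "n a \<in> indep_sizes a" using insert.prems by simp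
    then obtain F :: "nat \<Rightarrow> 'a \<Rightarrow> real" where F: "\<And>i. i < n a \<Longrightarrow> F i \<in> eigenspace M K a"
      and "\<And>c. AE x in M. (\<Sum>i<n a. c i * F i x) = 0 \<Longrightarrow> \<forall>i<n a. c i = 0"
      unfolding indep_sizes_def by auto
    then obtain E' where E': "orthonormal M E'" "E' \<subseteq> eigenspace M K a" "card E' = n a"
      by (rule Gram_Schmidt_eigenspace)
    have orth: "ip e e' = 0 \<and> ip e' e = 0" if eE: "e \<in> E" and "e' \<in> E'" for e e'
    proof -
      obtain l where l: "l \<in> A" "e \<in> eigenspace M K l" using bspec[OF E(2) eE] by auto
      have "l \<noteq> a" using l(1) insert.hyps(2) by metis
      have "e' \<in> eigenspace M K a" using E'(2) that by blast
      from eigenspaces_orthogonal[OF l(2) this \<open>l \<noteq> a\<close>] have "ip e e' = 0" .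
      then show ?thesis using L2_inner_commute[of M e e'] by simp
    qed
    have disj: "E \<inter> E' = {}"
    proof (rule ccontr)
      assume "E \<inter> E' \<noteq> {}"
      then obtain e where "e \<in> E" "e \<in> E'" by auto
      then show False using orth[of e e] E(1) by (simp add: orthonormal_def)
    qed
    have fin: "finite E" "finite E'" using E(1) E'(1) by (auto simp: orthonormal_def)
    have 1: "orthonormal M (E \<union> E')"
      unfolding orthonormal_def
    proof (intro conjI ballI)
      show "finite (E \<union> E')" using fin by simp
      fix e f assume "e \<in> E \<union> E'" "f \<in> E \<union> E'"
      then consider "e \<in> E" "f \<in> E" | "e \<in> E'" "f \<in> E'" | "e \<in> E" "f \<in> E'" | "e \<in> E'" "f \<in> E"
        by blast
      then show "ip e f = (if e = f then 1 else 0)"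
        by cases (use E(1) E'(1) orth disj in \<open>auto simp: orthonormal_def\<close>)
    qed
    have "ip (K e) e = a" if "e \<in> E'" for e
    proof -
      have e: "e \<in> eigenspace M K a" using that E'(2) by blast
      then have "e \<in> H" by (simp add: eigenspace_def)
      from eigenspace_ip[OF e this] show ?thesis
        using E'(1) that by (simp add: orthonormal_def)
    qed
    then have "(\<Sum>e\<in>E'. ip (K e) e) = a * real (n a)" using E'(3) by simp
    then have 2: "(\<Sum>e\<in>E \<union> E'. ip (K e) e) = (\<Sum>l\<in>insert a A. l * real (n l))"
      using fin disj E(3) insert.hyps by (simp add: sum.union_disjoint)
    have 3: "\<forall>e\<in>E \<union> E'. \<exists>l\<in>insert a A. e \<in> eigenspace M K l" using E(2) E'(2) by auto
    from 1 2 3 show ?case by blast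
  qed
  then obtain E where E: "orthonormal M E" "\<forall>e\<in>E. \<exists>l\<in>A. e \<in> eigenspace M K l"
    "(\<Sum>e\<in>E. ip (K e) e) = (\<Sum>l\<in>A. l * real (n l))" by blast
  have "E \<subseteq> H" using E(2) by (auto simp: eigenspace_def)
  from trace_le[OF E(1) this] E(3) show ?thesis by simp
qed

text \<open>The dimensions are suprema and possibly infinite. The claim is generalised to mixed
  sums, in which eigenvalues in \<open>B\<close> carry an admissible finite size and the others
  their dimension; induction on \<open>A - B\<close> takes one supremum at a time, starting from
  purely finite sizes.\<close>

lemma sum_eigenvalues_dim_le:
  assumes "finite A" "A \<subseteq> eigenvalues M K"
  shows "(\<Sum>l\<in>A. ennreal l * AE_dim M (eigenspace M K l)) \<le> ennreal T"
proof -
  have "(\<Sum>l\<in>B. ennreal l * of_nat (n l)) + (\<Sum>l\<in>A - B. ennreal l * AE_dim M (eigenspace M K l)) \<le> ennreal T"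
    if "B \<subseteq> A" "\<And>l. l \<in> B \<Longrightarrow> n l \<in> indep_sizes l" for B n
    using finite_subset[OF that(1) assms(1)] that
  proof (induction "A - B" arbitrary: B n rule: infinite_finite_induct)
    case infinite
    then show ?case using assms by simp
  next
    case empty
    then have "B = A" by blast
    have nn: "0 \<le> l" if "l \<in> A" for l using that assms(2) eigenvalue_nonneg by blast
    have "(\<Sum>l\<in>A. ennreal l * of_nat (n l)) = (\<Sum>l\<in>A. ennreal (l * real (n l)))"
      using nn by (intro sum.cong) (auto simp: ennreal_mult ennreal_of_nat_eq_real_of_nat)
    also have "\<dots> = ennreal (\<Sum>l\<in>A. l * real (n l))" using nn by (intro sum_ennreal) auto
    also have "\<dots> \<le> ennreal T"
      using empty.prems \<open>B = A\<close> assms by (intro ennreal_leI sum_eigenvalues_le) auto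
    finally show ?case using \<open>B = A\<close> by simp
  next
    case (insert a C)
    have aA: "a \<in> A" "a \<notin> B" and C: "C = A - insert a B" "A - B = insert a C" "finite C"
      using insert.hyps by auto
    let ?D = "\<lambda>l. AE_dim M (eigenspace M K l)"
    let ?X = "(\<Sum>l\<in>B. ennreal l * of_nat (n l)) + (\<Sum>l\<in>C. ennreal l * ?D l)"
    have *: "ennreal a * of_nat k + ?X \<le> ennreal T" if k: "k \<in> indep_sizes a" for k
    proof -
      define n' where "n' = n(a := k)"
      have "(\<Sum>l\<in>insert a B. ennreal l * of_nat (n' l)) + (\<Sum>l\<in>A - insert a B. ennreal l * ?D l) \<le> ennreal T"
        by (rule insert.hyps(3)[OF C(1)]) (use insert.prems aA k in \<open>auto simp: n'_def\<close>)
      moreover have "(\<Sum>l\<in>B. ennreal l * of_nat (n' l)) = (\<Sum>l\<in>B. ennreal l * of_nat (n l))"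
        using aA by (intro sum.cong) (auto simp: n'_def)
      ultimately show ?thesis
        using aA insert.prems(1) C(1) by (simp add: n'_def add.assoc)
    qed
    have "?D a = (SUP k\<in>indep_sizes a. of_nat k)"
      by (simp add: AE_dim_def indep_sizes_def)
    then have "ennreal a * ?D a + ?X = (SUP k\<in>indep_sizes a. ennreal a * of_nat k + ?X)"
      by (simp add: SUP_mult_left_ennreal ennreal_SUP_add_left indep_sizes_nonempty)
    also have "\<dots> \<le> ennreal T" by (rule SUP_least) (rule *)
    finally show ?case
      unfolding C(2) using insert.hyps(1,2) by (simp add: add.left_commute)
  qed
  from this[of "{}"] show ?thesis by simp
qed

theorem trace_class: "trace_class M K"
proof -
  have "(\<Sum>\<^sub>\<infinity>l\<in>eigenvalues M K. ennreal l * AE_dim M (eigenspace M K l)) \<le> ennreal T"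
    by (subst nonneg_infsum_complete) (auto intro!: SUP_least sum_eigenvalues_dim_le)
  then have "(\<Sum>\<^sub>\<infinity>l\<in>eigenvalues M K. ennreal l * AE_dim M (eigenspace M K l)) < \<infinity>"
    using le_less_trans by fastforce
  then show ?thesis using psa compact by (simp add: trace_class_def)
qed

end

section \<open>Operators averaging over a latent variable\<close>

text \<open>\<open>W_left\<close> and \<open>W_right\<close> express that both conditional laws have
  mass 1; they yield that \<open>K\<close> preserves means. \<open>K_def\<close> is pointwise on the
  space and not just almost everywhere, which makes \<open>K f\<close> measurable.\<close>

locale latent_operator = M: finite_measure M + N: finite_measure N
  for M :: "'a measure" and N :: "'b measure" +
  fixes W :: "'a \<Rightarrow> 'b \<Rightarrow> real" and K :: "('a \<Rightarrow> real) \<Rightarrow> 'a \<Rightarrow> real"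
  assumes W_measurable: "case_prod W \<in> borel_measurable (M \<Otimes>\<^sub>M N)"
    and W_square: "integrable (M \<Otimes>\<^sub>M N) (\<lambda>(x, z). (W x z)\<^sup>2)"
    and W_left: "AE z in N. (\<integral>x. W x z \<partial>M) = 1"
    and W_right: "AE x in M. (\<integral>z. W x z \<partial>N) = 1"
    and K_def: "\<And>f x. f \<in> borel_measurable M \<Longrightarrow> x \<in> space M \<Longrightarrow>
      K f x = (\<integral>x'. f x' * (\<integral>z. W x' z * W x z \<partial>N) \<partial>M)"
begin

sublocale pair_sigma_finite M N ..

lemmas [measurable] = W_measurable

definition A :: "('a \<Rightarrow> real) \<Rightarrow> 'b \<Rightarrow> real" where
  "A f z = (\<integral>x. f x * W x z \<partial>M)"

text \<open>The squared norm of the section of \<open>W\<close> at \<open>z\<close>; its integral is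
  the squared Hilbert-Schmidt norm.\<close>

definition mass :: "'b \<Rightarrow> real" where
  "mass z = (\<integral>x. (W x z)\<^sup>2 \<partial>M)"

lemma W_L2: "case_prod W \<in> L2_space (M \<Otimes>\<^sub>M N)"
  using W_square by (simp add: L2_space_def case_prod_beta')

lemma W_section_left: "AE z in N. (\<lambda>x. W x z) \<in> L2_space M"
  using AE_integrable_snd[OF W_square] AE_space by eventually_elim (simp add: L2_space_def)

lemma W_section_right: "AE x in M. W x \<in> L2_space N"
  using AE_integrable_fst[OF W_square] AE_space by eventually_elim (simp add: L2_space_def)

lemma integrable_mass: "integrable N mass"
  using integrable_snd[OF W_square] by (simp add: mass_def[abs_def])

lemma A_measurable [measurable]:
  assumes [measurable]: "f \<in> borel_measurable M"
  shows "A f \<in> borel_measurable N"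
  unfolding A_def[abs_def] by measurable

lemma A_in_L2:
  assumes f: "f \<in> L2_space M"
  shows "A f \<in> L2_space N"
proof -
  have [measurable]: "f \<in> borel_measurable M" using f by (simp add: L2_space_def)
  have "integrable N (\<lambda>z. (A f z)\<^sup>2)"
  proof (rule Bochner_Integration.integrable_bound)
    show "integrable N (\<lambda>z. L2_inner M f f * mass z)" using integrable_mass by simp
    show "AE z in N. norm ((A f z)\<^sup>2) \<le> norm (L2_inner M f f * mass z)"
      using W_section_left
    proof eventually_elim
      case (elim z)
      have "(A f z)\<^sup>2 \<le> L2_inner M f f * mass z"
        using L2_Cauchy_Schwarz[OF f elim] by (simp add: A_def mass_def L2_inner_def power2_eq_square)
      then show ?case by simp
    qed
  qed measurable
  then show ?thesis by (simp add: L2_space_def)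
qed

lemma tensor_in_L2:
  assumes f: "f \<in> L2_space M" and u: "u \<in> L2_space N"
  shows "(\<lambda>(x, z). f x * u z) \<in> L2_space (M \<Otimes>\<^sub>M N)"
proof -
  have [measurable]: "f \<in> borel_measurable M" "u \<in> borel_measurable N"
    using f u by (simp_all add: L2_space_def)
  have "integrable (M \<Otimes>\<^sub>M N) (\<lambda>(x, z). (f x)\<^sup>2 * (u z)\<^sup>2)"
    using f u by (intro Fubini_integrable) (auto simp: L2_space_def abs_mult)
  then show ?thesis by (simp add: L2_space_def case_prod_beta' power_mult_distrib)
qed

text \<open>Fubini applies because the integrand is a product of two square integrable functions on
  the product space, the tensor of \<open>f\<close> with \<open>u\<close> and
  \<open>W\<close>.\<close>

lemma A_adjoint:
  assumes f: "f \<in> L2_space M" and u: "u \<in> L2_space N"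
  shows "(\<integral>x. f x * (\<integral>z. u z * W x z \<partial>N) \<partial>M) = (\<integral>z. u z * A f z \<partial>N)"
proof -
  have "integrable (M \<Otimes>\<^sub>M N) (\<lambda>p. (case p of (x, z) \<Rightarrow> f x * u z) * case_prod W p)"
    by (rule L2_space_integrable_mult[OF tensor_in_L2[OF f u] W_L2])
  then have int: "integrable (M \<Otimes>\<^sub>M N) (\<lambda>(x, z). f x * u z * W x z)"
    by (simp add: case_prod_beta')
  have "(\<integral>x. f x * (\<integral>z. u z * W x z \<partial>N) \<partial>M) = (\<integral>x. (\<integral>z. f x * u z * W x z \<partial>N) \<partial>M)"
    by (simp add: mult.assoc)
  also have "\<dots> = (\<integral>z. (\<integral>x. f x * u z * W x z \<partial>M) \<partial>N)"
    using integral_fst[OF int] integral_snd[OF int] by simp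
  also have "\<dots> = (\<integral>z. u z * A f z \<partial>N)"
    unfolding A_def integral_mult_right_zero[symmetric] by (simp only: ac_simps)
  finally show ?thesis .
qed

lemma K_eq_AE:
  assumes f: "f \<in> L2_space M"
  shows "AE x in M. K f x = (\<integral>z. A f z * W x z \<partial>N)"
  using W_section_right AE_space
proof eventually_elim
  case (elim x)
  have "K f x = (\<integral>x'. f x' * (\<integral>z. W x z * W x' z \<partial>N) \<partial>M)"
    using K_def[of f x] f elim by (simp add: L2_space_def mult.commute)
  \<comment> \<open>Here \<open>u\<close> is the section \<open>W x\<close>, which is square
    integrable for almost every \<open>x\<close> only; this is why the formula is stated almost
    everywhere.\<close>
  also have "\<dots> = (\<integral>z. W x z * A f z \<partial>N)" by (rule A_adjoint[OF f elim(1)])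
  finally show ?case by (simp add: mult.commute)
qed

lemma K_measurable:
  assumes [measurable]: "f \<in> borel_measurable M"
  shows "K f \<in> borel_measurable M"
proof -
  have "(\<lambda>x. \<integral>x'. f x' * (\<integral>z. W x' z * W x z \<partial>N) \<partial>M) \<in> borel_measurable M"
    by measurable
  then show ?thesis
    by (rule measurable_cong[THEN iffD1, rotated]) (simp add: K_def)
qed

lemma K_in_L2:
  assumes f: "f \<in> L2_space M"
  shows "K f \<in> L2_space M"
proof -
  have [measurable]: "K f \<in> borel_measurable M" using f by (simp add: L2_space_def K_measurable)
  have "integrable M (\<lambda>x. (K f x)\<^sup>2)"
  proof (rule Bochner_Integration.integrable_bound)
    show "integrable M (\<lambda>x. L2_inner N (A f) (A f) * (\<integral>z. (W x z)\<^sup>2 \<partial>N))"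
      using integrable_fst[OF W_square] by simp
    show "AE x in M. norm ((K f x)\<^sup>2) \<le> norm (L2_inner N (A f) (A f) * (\<integral>z. (W x z)\<^sup>2 \<partial>N))"
      using K_eq_AE[OF f] W_section_right
    proof eventually_elim
      case (elim x)
      have "(K f x)\<^sup>2 \<le> L2_inner N (A f) (A f) * (\<integral>z. (W x z)\<^sup>2 \<partial>N)"
        using L2_Cauchy_Schwarz[OF A_in_L2[OF f] elim(2)] elim(1)
        by (simp add: L2_inner_def power2_eq_square)
      then show ?case by simp
    qed
  qed measurable
  then show ?thesis by (simp add: L2_space_def)
qed

lemma K_inner:
  assumes f: "f \<in> L2_space M" and g: "g \<in> L2_space M"
  shows "L2_inner M (K f) g = L2_inner N (A f) (A g)"
proof -
  have [measurable]: "g \<in> borel_measurable M" "f \<in> borel_measurable M"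
    using f g by (simp_all add: L2_space_def)
  note [measurable] = K_measurable
  have "L2_inner M (K f) g = (\<integral>x. g x * (\<integral>z. A f z * W x z \<partial>N) \<partial>M)"
    unfolding L2_inner_def
  proof (rule integral_cong_AE)
    show "AE x in M. K f x * g x = g x * (\<integral>z. A f z * W x z \<partial>N)"
      using K_eq_AE[OF f] by eventually_elim simp
  qed measurable
  also have "\<dots> = (\<integral>z. A f z * A g z \<partial>N)" by (rule A_adjoint[OF g A_in_L2[OF f]])
  finally show ?thesis by (simp add: L2_inner_def)
qed

text \<open>The mean is the inner product with 1. It becomes the inner product of \<open>A f\<close>
  with \<open>A 1\<close>, which is 1 almost everywhere by \<open>W_left\<close>; moving
  \<open>A\<close> back leaves the integral of \<open>W\<close> over \<open>z\<close>, which is 1 by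
  \<open>W_right\<close>.\<close>

lemma K_mean:
  assumes f: "f \<in> L2_space M"
  shows "(\<integral>x. K f x \<partial>M) = (\<integral>x. f x \<partial>M)"
proof -
  have [measurable]: "f \<in> borel_measurable M" using f by (simp add: L2_space_def)
  have 1: "(\<lambda>_. 1) \<in> L2_space M" "(\<lambda>_. 1) \<in> L2_space N"
    by (rule M.L2_space_const N.L2_space_const)+
  have "(\<integral>x. K f x \<partial>M) = (\<integral>z. A f z * A (\<lambda>_. 1) z \<partial>N)"
    using K_inner[OF f 1(1)] by (simp add: L2_inner_def)
  also have "\<dots> = (\<integral>z. 1 * A f z \<partial>N)"
  proof (rule integral_cong_AE)
    show "AE z in N. A f z * A (\<lambda>_. 1) z = 1 * A f z"
      using W_left by eventually_elim (simp add: A_def[of "\<lambda>_. 1"])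
  qed measurable
  also have "\<dots> = (\<integral>x. f x * (\<integral>z. 1 * W x z \<partial>N) \<partial>M)" by (rule A_adjoint[OF f 1(2), symmetric])
  also have "\<dots> = (\<integral>x. f x \<partial>M)"
  proof (rule integral_cong_AE)
    show "AE x in M. f x * (\<integral>z. 1 * W x z \<partial>N) = f x"
      using W_right by eventually_elim simp
  qed measurable
  finally show ?thesis .
qed

lemma positive_selfadjoint: "positive_selfadjoint M K"
  unfolding positive_selfadjoint_def
proof (intro conjI ballI)
  fix f assume "f \<in> L2_zero M"
  then have f: "f \<in> L2_space M" "(\<integral>x. f x \<partial>M) = 0" by (simp_all add: L2_zero_iff)
  then show "K f \<in> L2_zero M" by (simp add: L2_zero_iff K_in_L2 K_mean)
  show "0 \<le> L2_inner M (K f) f" by (simp add: K_inner f L2_inner_self_nonneg)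
next
  fix f g assume "f \<in> L2_zero M" "g \<in> L2_zero M"
  then have fg: "f \<in> L2_space M" "g \<in> L2_space M" by (simp_all add: L2_zero_iff)
  have "L2_inner M f (K g) = L2_inner N (A g) (A f)"
    using K_inner[OF fg(2,1)] L2_inner_commute[of M f "K g"] by simp
  then show "L2_inner M (K f) g = L2_inner M f (K g)"
    using K_inner[OF fg] L2_inner_commute[of N "A f" "A g"] by simp
qed

text \<open>For fixed \<open>z\<close> the number \<open>A e z\<close> is the coefficient along
  \<open>e\<close> of the section of \<open>W\<close> at \<open>z\<close>. Bessel's inequality is
  applied to this section and then integrated over \<open>z\<close>.\<close>

lemma trace_le_mass:
  assumes E: "orthonormal M E" "E \<subseteq> L2_zero M"
  shows "(\<Sum>e\<in>E. L2_inner M (K e) e) \<le> (\<integral>z. mass z \<partial>N)"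
proof -
  have E2: "E \<subseteq> L2_space M" using E(2) L2_zero_subset_L2_space[of M] by (rule subset_trans)
  have e: "e \<in> L2_space M" if "e \<in> E" for e using that E2 by (rule subsetD[rotated])
  have int: "integrable N (\<lambda>z. (A e z)\<^sup>2)" if "e \<in> E" for e
    using A_in_L2[OF e[OF that]] by (simp add: L2_space_def)
  have "(\<Sum>e\<in>E. L2_inner M (K e) e) = (\<Sum>e\<in>E. \<integral>z. (A e z)\<^sup>2 \<partial>N)"
    by (rule sum.cong[OF refl], subst K_inner[OF e e]) (simp_all add: L2_inner_def power2_eq_square)
  also have "\<dots> = (\<integral>z. (\<Sum>e\<in>E. (A e z)\<^sup>2) \<partial>N)"
    by (rule Bochner_Integration.integral_sum[symmetric]) (rule int)
  also have "\<dots> \<le> (\<integral>z. mass z \<partial>N)"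
  proof (rule integral_mono_AE)
    show "integrable N (\<lambda>z. \<Sum>e\<in>E. (A e z)\<^sup>2)"
      by (rule Bochner_Integration.integrable_sum) (rule int)
    show "AE z in N. (\<Sum>e\<in>E. (A e z)\<^sup>2) \<le> mass z"
      using W_section_left
    proof eventually_elim
      case (elim z)
      from Bessel[OF E(1) E2 elim] show ?case
        by (simp add: A_def mass_def L2_inner_def power2_eq_square mult.commute)
    qed
  qed (rule integrable_mass)
  finally show ?thesis .
qed

theorem trace_class: "trace_class M K"
proof -
  interpret bounded_trace_operator M K "\<integral>z. mass z \<partial>N"
    by unfold_locales (rule positive_selfadjoint, rule trace_le_mass)
  show ?thesis by (rule trace_class)
qed

end

section \<open>Linear substitutions in matrix integrals\<close>

lemma prod_Basis_vec:
  "(\<Prod>b\<in>(Basis :: ('a::euclidean_space ^ 'n) set). f b) = (\<Prod>i\<in>UNIV. \<Prod>c\<in>Basis. f (axis i c))"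
proof -
  have B: "(Basis :: ('a ^ 'n) set) = (\<lambda>(i, c). axis i c) ` (UNIV \<times> Basis)"
    by (auto simp: Basis_vec_def)
  have inj: "inj_on (\<lambda>(i, c). axis i c) ((UNIV :: 'n set) \<times> (Basis :: 'a set))"
    by (auto simp: inj_on_def axis_eq_axis)
  have "(\<Prod>b\<in>(Basis :: ('a ^ 'n) set). f b)
    = (\<Prod>p\<in>UNIV \<times> Basis. (f \<circ> (\<lambda>(i, c). axis i c)) p)"
    by (subst B) (rule prod.reindex[OF inj])
  then show ?thesis
    by (simp add: prod.cartesian_product case_prod_beta')
qed

lemma measurable_vec_nth [measurable (raw)]:
  fixes f :: "'x \<Rightarrow> 'a::euclidean_space ^ 'n"
  assumes "f \<in> borel_measurable M"
  shows "(\<lambda>x. f x $ i) \<in> borel_measurable M"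
  by (rule borel_measurable_continuous_on[OF _ assms, of "\<lambda>v. v $ i"]) (intro continuous_intros)

lemma measurable_vec_lambda [measurable (raw)]:
  fixes f :: "'x \<Rightarrow> 'n::finite \<Rightarrow> 'a::euclidean_space"
  assumes "\<And>i. (\<lambda>x. f x i) \<in> borel_measurable M"
  shows "(\<lambda>x. \<chi> i. f x i) \<in> borel_measurable M"
proof (subst borel_measurable_euclidean_space, rule ballI)
  fix b :: "'a ^ 'n" assume "b \<in> Basis"
  then obtain i c where "b = axis i c" "c \<in> Basis" by (auto simp: Basis_vec_def)
  then show "(\<lambda>x. (\<chi> i. f x i) \<bullet> b) \<in> borel_measurable M"
    using assms[of i] by (simp add: inner_axis)
qed

text \<open>A box is the product of the boxes of its components, so both measures give it the same
  volume. This opens vector integrals to componentwise Fubini.\<close>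

lemma lborel_vec_eq_PiM:
  "(lborel :: ('a::euclidean_space ^ 'n) measure)
    = distr (Pi\<^sub>M UNIV (\<lambda>_. lborel)) borel (\<lambda>f. \<chi> i. f i)"
proof (rule lborel_eqI)
  interpret product_sigma_finite "\<lambda>_::'n. lborel :: 'a measure" ..
  fix l u :: "'a ^ 'n" assume le: "\<And>b. b \<in> Basis \<Longrightarrow> l \<bullet> b \<le> u \<bullet> b"
  then have le': "l $ i \<bullet> c \<le> u $ i \<bullet> c" if "c \<in> Basis" for i c
    using le[of "axis i c"] that by (simp add: inner_axis)
  have mem: "(\<chi> i. f i) \<in> box l u \<longleftrightarrow> (\<forall>i. f i \<in> box (l $ i) (u $ i))" for f :: "'n \<Rightarrow> 'a"
    by (auto simp: mem_box Basis_vec_def inner_axis)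
  have "emeasure (distr (Pi\<^sub>M UNIV (\<lambda>_. lborel)) borel (\<lambda>f. \<chi> i. f i)) (box l u)
    = emeasure (Pi\<^sub>M UNIV (\<lambda>_. lborel)) (Pi\<^sub>E UNIV (\<lambda>i. box (l $ i) (u $ i)))"
    by (subst emeasure_distr) (auto simp: space_PiM mem PiE_iff intro!: arg_cong2[where f=emeasure])
  also have "\<dots> = (\<Prod>i\<in>UNIV. emeasure lborel (box (l $ i) (u $ i)))"
    by (rule emeasure_PiM) auto
  also have "\<dots> = (\<Prod>i\<in>UNIV. ennreal (\<Prod>c\<in>Basis. (u $ i - l $ i) \<bullet> c))"
    using le' by simp
  also have "\<dots> = ennreal (\<Prod>i\<in>UNIV. \<Prod>c\<in>Basis. (u $ i - l $ i) \<bullet> c)"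
    using le' by (intro prod_ennreal prod_nonneg) (auto simp: inner_diff_left)
  also have "(\<Prod>i\<in>UNIV. \<Prod>c\<in>Basis. (u $ i - l $ i) \<bullet> c) = (\<Prod>b\<in>Basis. (u - l) \<bullet> b)"
    by (simp add: prod_Basis_vec inner_axis)
  finally show "emeasure (distr (Pi\<^sub>M UNIV (\<lambda>_. lborel)) borel (\<lambda>f. \<chi> i. f i)) (box l u)
    = (\<Prod>b\<in>Basis. (u - l) \<bullet> b)" .
qed simp

text \<open>Such a map only relabels coordinates: the preimage of a box is a box with the same side
  lengths. It covers row exchanges as well as transposition.\<close>

lemma lborel_distr_permute_Basis:
  fixes T :: "'a::euclidean_space \<Rightarrow> 'b::euclidean_space"
  assumes T: "linear T" "bij_betw T Basis Basis"
  shows "distr lborel borel T = lborel"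
proof (rule sym, rule lborel_eqI)
  have [measurable]: "T \<in> borel_measurable borel"
    using linear_continuous_on[OF linear_conv_bounded_linear[THEN iffD1, OF T(1)]]
    by (rule borel_measurable_continuous_onI)
  have inner: "T x \<bullet> T b = x \<bullet> b" if b: "b \<in> Basis" for x b
  proof -
    have "T x \<bullet> T b = (\<Sum>i\<in>Basis. (x \<bullet> i) * (T i \<bullet> T b))"
      by (subst euclidean_representation[of x, symmetric])
        (simp add: linear_sum[OF T(1)] linear_cmul[OF T(1)] inner_sum_left)
    also have "\<dots> = (\<Sum>i\<in>Basis. if b = i then x \<bullet> i else 0)"
    proof (rule sum.cong[OF refl])
      fix i :: 'a assume i: "i \<in> Basis"
      have "T i \<in> Basis" "T b \<in> Basis" using T(2) i b by (auto simp: bij_betw_def)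
      moreover have "T i = T b \<longleftrightarrow> i = b" using T(2) i b by (auto simp: bij_betw_def inj_on_def)
      ultimately show "(x \<bullet> i) * (T i \<bullet> T b) = (if b = i then x \<bullet> i else 0)"
        by (auto simp: inner_Basis)
    qed
    also have "\<dots> = x \<bullet> b" using b by simp
    finally show ?thesis .
  qed
  fix l u :: 'b assume le: "\<And>b. b \<in> Basis \<Longrightarrow> l \<bullet> b \<le> u \<bullet> b"
  define l' where "l' = (\<Sum>b\<in>Basis. (l \<bullet> T b) *\<^sub>R b)"
  define u' where "u' = (\<Sum>b\<in>Basis. (u \<bullet> T b) *\<^sub>R b)"
  have lu: "l' \<bullet> b = l \<bullet> T b" "u' \<bullet> b = u \<bullet> T b" if "b \<in> Basis" for b
    using that by (simp_all add: l'_def u'_def)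
  have "T -` box l u = box l' u'"
  proof -
    have "T x \<in> box l u \<longleftrightarrow> (\<forall>b\<in>T ` Basis. l \<bullet> b < T x \<bullet> b \<and> T x \<bullet> b < u \<bullet> b)" for x
      using T(2) by (simp add: mem_box bij_betw_def)
    then show ?thesis by (auto simp: mem_box inner lu)
  qed
  then have "emeasure (distr lborel borel T) (box l u) = emeasure lborel (box l' u')"
    by (simp add: emeasure_distr)
  also have "\<dots> = (\<Prod>b\<in>Basis. (u' - l') \<bullet> b)"
    using le T(2) by (intro emeasure_lborel_box) (auto simp: lu bij_betw_def)
  also have "(\<Prod>b\<in>Basis. (u' - l') \<bullet> b) = (\<Prod>b\<in>Basis. (u - l) \<bullet> T b)"
    by (simp add: inner_diff_left lu)
  also have "\<dots> = (\<Prod>b\<in>Basis. (u - l) \<bullet> b)"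
    by (rule prod.reindex_bij_betw[OF T(2)])
  finally show "emeasure (distr lborel borel T) (box l u) = (\<Prod>b\<in>Basis. (u - l) \<bullet> b)" .
qed simp

text \<open>Left multiplication by \<open>A\<close> if the rows are real vectors. Rows in a general
  Euclidean space let each row be treated as one variable, at the price of \<open>DIM('a)\<close> as
  exponent of the determinant.\<close>

definition row_action :: "real^'n^'n \<Rightarrow> 'a::euclidean_space ^ 'n \<Rightarrow> 'a ^ 'n" where
  "row_action A x = (\<chi> i. \<Sum>j\<in>UNIV. (A $ i $ j) *\<^sub>R x $ j)"

lemma measurable_row_action [measurable]: "row_action A \<in> borel_measurable borel"
  unfolding row_action_def[abs_def] by measurable

lemma row_action_mult: "row_action (A ** B) x = row_action A (row_action B x)"
proof (rule vec_eq_iff[THEN iffD2], rule allI)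
  fix i
  have "row_action (A ** B) x $ i = (\<Sum>j\<in>UNIV. \<Sum>k\<in>UNIV. (A $ i $ k * B $ k $ j) *\<^sub>R x $ j)"
    by (simp add: row_action_def matrix_matrix_mult_def scaleR_sum_left)
  also have "\<dots> = (\<Sum>k\<in>UNIV. \<Sum>j\<in>UNIV. (A $ i $ k * B $ k $ j) *\<^sub>R x $ j)"
    by (rule sum.swap)
  also have "\<dots> = row_action A (row_action B x) $ i"
    by (simp add: row_action_def scaleR_sum_right)
  finally show "row_action (A ** B) x $ i = row_action A (row_action B x) $ i" .
qed

text \<open>With row \<open>m\<close> integrated innermost and all other rows fixed, the shear is a
  translation by row \<open>n\<close>.\<close>

lemma nn_integral_shear:
  fixes f :: "'a::euclidean_space ^ 'n \<Rightarrow> ennreal"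
  assumes f [measurable]: "f \<in> borel_measurable borel" and mn: "m \<noteq> n"
  shows "(\<integral>\<^sup>+x. f (\<chi> i. if i = m then x $ m + x $ n else x $ i) \<partial>lborel) = (\<integral>\<^sup>+x. f x \<partial>lborel)"
proof -
  interpret product_sigma_finite "\<lambda>_::'n. lborel :: 'a measure" ..
  let ?I = "UNIV - {m}"
  have I: "insert m ?I = UNIV" "finite ?I" "m \<notin> ?I" by auto
  have split: "(\<integral>\<^sup>+x. g x \<partial>lborel)
    = (\<integral>\<^sup>+v. (\<integral>\<^sup>+y. g (\<chi> i. (v(m := y)) i) \<partial>lborel) \<partial>Pi\<^sub>M ?I (\<lambda>_. lborel))"
    if [measurable]: "g \<in> borel_measurable borel" for g :: "'a ^ 'n \<Rightarrow> ennreal"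
  proof -
    have "(\<integral>\<^sup>+x. g x \<partial>lborel) = (\<integral>\<^sup>+v. g (\<chi> i. v i) \<partial>Pi\<^sub>M UNIV (\<lambda>_. lborel))"
      by (subst lborel_vec_eq_PiM) (simp add: nn_integral_distr)
    also have "\<dots> = (\<integral>\<^sup>+v. g (\<chi> i. v i) \<partial>Pi\<^sub>M (insert m ?I) (\<lambda>_. lborel))" by (simp add: I(1))
    also have "\<dots> = (\<integral>\<^sup>+v. (\<integral>\<^sup>+y. g (\<chi> i. (v(m := y)) i) \<partial>lborel) \<partial>Pi\<^sub>M ?I (\<lambda>_. lborel))"
      by (rule product_nn_integral_insert) (use I in auto)
    finally show ?thesis .
  qed
  have "(\<integral>\<^sup>+y. f (\<chi> i. if i = m then y + v n else v i) \<partial>lborel)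
    = (\<integral>\<^sup>+y. f (\<chi> i. (v(m := y)) i) \<partial>lborel)" for v :: "'n \<Rightarrow> 'a"
  proof -
    have "(\<integral>\<^sup>+y. f (\<chi> i. (v(m := y)) i) \<partial>lborel)
      = (\<integral>\<^sup>+y. f (\<chi> i. (v(m := y)) i) \<partial>distr lborel borel ((+) (v n)))"
      by (simp add: lborel_distr_plus)
    also have "\<dots> = (\<integral>\<^sup>+y. f (\<chi> i. (v(m := v n + y)) i) \<partial>lborel)"
      by (rule nn_integral_distr) auto
    finally show ?thesis
      by (simp add: fun_upd_def add.commute)
  qed
  moreover have "(\<lambda>x :: 'a ^ 'n. f (\<chi> i. if i = m then x $ m + x $ n else x $ i)) \<in> borel_measurable borel"
    by (rule measurable_compose[OF measurable_vec_lambda f]) (auto intro: measurable_vec_nth)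
  note split[OF this]
  ultimately show ?thesis
    using mn by (simp add: split[OF f] if_distrib[of "(+) _"] cong: if_cong)
qed

text \<open>The formula is compatible with products, because the determinant is multiplicative, so
  it suffices to check diagonal matrices, exchanges and shears.\<close>

lemma nn_integral_row_action:
  fixes f :: "'a::euclidean_space ^ 'n \<Rightarrow> ennreal"
  assumes "det A \<noteq> 0" and "f \<in> borel_measurable borel"
  shows "(\<integral>\<^sup>+x. f x \<partial>lborel) = ennreal (\<bar>det A\<bar> ^ DIM('a)) * (\<integral>\<^sup>+x. f (row_action A x) \<partial>lborel)"
proof -
  let ?S = "\<lambda>(A :: real^'n^'n) (f :: 'a ^ 'n \<Rightarrow> ennreal).
    ennreal (\<bar>det A\<bar> ^ DIM('a)) * (\<integral>\<^sup>+x. f (row_action A x) \<partial>lborel)"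
  \<comment> \<open>The premise \<open>det A \<noteq> 0\<close> is part of the induction predicate:
    it makes the zero-row case vacuous, and for a product it passes to both factors.\<close>
  define P where "P A \<longleftrightarrow> (det A \<noteq> 0 \<longrightarrow> (\<forall>f :: 'a ^ 'n \<Rightarrow> ennreal. f \<in> borel_measurable borel \<longrightarrow>
    (\<integral>\<^sup>+x. f x \<partial>lborel) = ?S A f))"
    for A :: "real^'n^'n"
  have "P A"
  proof (induction A rule: induct_matrix_elementary_alt)
    case (1 A B)
    show ?case unfolding P_def
    proof (intro impI allI)
      fix f :: "'a ^ 'n \<Rightarrow> ennreal" assume d: "det (A ** B) \<noteq> 0" and f: "f \<in> borel_measurable borel"
      then have fA: "(\<lambda>x. f (row_action A x)) \<in> borel_measurable borel" by measurable
      have "det A \<noteq> 0" "det B \<noteq> 0" using d by (auto simp: det_mul)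
      have "(\<integral>\<^sup>+x. f x \<partial>lborel) = ?S A f"
        using 1(1) \<open>det A \<noteq> 0\<close> f unfolding P_def by blast
      also have "(\<integral>\<^sup>+x. f (row_action A x) \<partial>lborel)
        = ennreal (\<bar>det B\<bar> ^ DIM('a)) * (\<integral>\<^sup>+x. f (row_action A (row_action B x)) \<partial>lborel)"
        using 1(2) \<open>det B \<noteq> 0\<close> fA unfolding P_def by blast
      finally show "(\<integral>\<^sup>+x. f x \<partial>lborel) = ?S (A ** B) f"
        unfolding row_action_mult det_mul abs_mult power_mult_distrib
        by (simp add: ennreal_mult mult.assoc)
    qed
  next
    case (2 A i)
    then show ?case by (simp add: P_def det_zero_row)
  next
    case (3 A)
    show ?case unfolding P_def
    proof (intro impI allI)
      fix f :: "'a ^ 'n \<Rightarrow> ennreal"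
      assume d: "det A \<noteq> 0" and [measurable]: "f \<in> borel_measurable borel"
      \<comment> \<open>The coordinatewise scaling of \<open>lborel\<close> takes its factors as a
        function on \<open>Basis\<close>. A basis vector has exactly one nonzero row, so the sum
        picks out the diagonal entry of that row.\<close>
      define c where "c b = (\<Sum>i\<in>UNIV. A $ i $ i * (if b $ i = 0 then 0 else 1))" for b :: "'a ^ 'n"
      have c: "c (axis i b) = A $ i $ i" if "b \<in> Basis" for i b
      proof -
        have "c (axis i b) = (\<Sum>j\<in>UNIV. if i = j then A $ j $ j else 0)"
          unfolding c_def using that by (intro sum.cong) (auto simp: axis_def nonzero_Basis)
        then show ?thesis by simp
      qed
      have det: "det A = (\<Prod>i\<in>UNIV. A $ i $ i)" using 3 by (rule det_diagonal)
      have c0: "c b \<noteq> 0" if "b \<in> Basis" for b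
        using that d c by (auto simp: det Basis_vec_def)
      have T: "0 + (\<Sum>b\<in>Basis. (c b * (x \<bullet> b)) *\<^sub>R b) = row_action A x" for x
      proof (rule euclidean_eqI)
        fix b :: "'a ^ 'n" assume b: "b \<in> Basis"
        then obtain i e where ie: "b = axis i e" "e \<in> Basis" by (auto simp: Basis_vec_def)
        have "A $ i $ j *\<^sub>R x $ j = (if i = j then A $ i $ j *\<^sub>R x $ j else 0)" for j
          using 3 by simp
        then have "row_action A x $ i = (\<Sum>j\<in>UNIV. if i = j then A $ i $ j *\<^sub>R x $ j else 0)"
          unfolding row_action_def vec_lambda_beta by (rule sum.cong[OF refl])
        then have "row_action A x $ i = A $ i $ i *\<^sub>R x $ i" by simp
        then have "row_action A x \<bullet> b = c b * (x \<bullet> b)"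
          using ie c by (simp add: inner_axis)
        then show "(0 + (\<Sum>b\<in>Basis. (c b * (x \<bullet> b)) *\<^sub>R b)) \<bullet> b = row_action A x \<bullet> b"
          using b by simp
      qed
      have "(\<Prod>b\<in>Basis. \<bar>c b\<bar>) = \<bar>det A\<bar> ^ DIM('a)"
        using c by (simp add: prod_Basis_vec det abs_prod prod_power_distrib)
      then have "(\<integral>\<^sup>+x. f x \<partial>lborel)
        = (\<integral>\<^sup>+x. f x \<partial>density (distr lborel borel (row_action A)) (\<lambda>_. \<bar>det A\<bar> ^ DIM('a)))"
        using lborel_affine_euclidean[of c 0, OF c0] unfolding T by simp
      also have "\<dots> = ?S A f"
        by (simp add: nn_integral_density nn_integral_cmult nn_integral_distr)
      finally show "(\<integral>\<^sup>+x. f x \<partial>lborel) = ?S A f" .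
    qed
  next
    case (4 m n)
    let ?s = "Transposition.transpose m n"
    let ?A = "(\<chi> i j. mat 1 $ i $ ?s j) :: real^'n^'n"
    have act: "row_action ?A x = (\<chi> i. x $ ?s i)" for x :: "'a ^ 'n"
    proof -
      have "(\<Sum>j\<in>UNIV. (?A $ i $ j) *\<^sub>R x $ j) = (\<Sum>j\<in>UNIV. if ?s i = j then x $ j else 0)" for i
        by (intro sum.cong) (auto simp: mat_def)
      then show ?thesis by (simp add: row_action_def vec_eq_iff)
    qed
    have "linear (row_action ?A :: 'a ^ 'n \<Rightarrow> 'a ^ 'n)"
      unfolding act[abs_def] by (rule linearI) (auto simp: vec_eq_iff)
    moreover have "row_action ?A (axis i b) = axis (?s i) b" for i and b :: 'a
      unfolding act by (auto simp: vec_eq_iff axis_def)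
    then have "bij_betw (row_action ?A :: 'a ^ 'n \<Rightarrow> 'a ^ 'n) Basis Basis"
      by (intro bij_betwI[where g="row_action ?A"]) (auto simp: Basis_vec_def)
    ultimately have inv: "distr lborel borel (row_action ?A :: 'a ^ 'n \<Rightarrow> 'a ^ 'n) = lborel"
      by (rule lborel_distr_permute_Basis)
    have det: "\<bar>det ?A\<bar> = 1"
      using det_permute_columns[OF permutes_swap_id[of m UNIV n], of "mat 1 :: real^'n^'n"]
      by (simp add: sign_swap_id abs_mult)
    show ?case unfolding P_def
    proof (intro impI allI)
      fix f :: "'a ^ 'n \<Rightarrow> ennreal" assume [measurable]: "f \<in> borel_measurable borel"
      have "(\<integral>\<^sup>+x. f x \<partial>lborel) = (\<integral>\<^sup>+x. f (row_action ?A x) \<partial>lborel)"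
        by (subst inv[symmetric]) (simp add: nn_integral_distr)
      then show "(\<integral>\<^sup>+x. f x \<partial>lborel) = ?S ?A f"
        using det by simp
    qed
  next
    case (5 m n)
    let ?A = "(\<chi> i j. of_bool (i = m \<and> j = n \<or> i = j)) :: real^'n^'n"
    have act: "row_action ?A x = (\<chi> i. if i = m then x $ m + x $ n else x $ i)" for x :: "'a ^ 'n"
    proof -
      have "(\<Sum>j\<in>UNIV. (?A $ i $ j) *\<^sub>R x $ j)
        = (\<Sum>j\<in>UNIV. (if i = j then x $ j else 0) + (if i = m then if n = j then x $ j else 0 else 0))" for i
        using 5 by (intro sum.cong) auto
      then show ?thesis by (simp add: row_action_def vec_eq_iff sum.distrib)
    qed
    have det: "det ?A = 1"
    proof -
      have "det ((\<chi> i. if i = m then row m (mat 1) + 1 *s row n (mat 1) else row i (mat 1)) :: real^'n^'n)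
        = det (mat 1 :: real^'n^'n)"
        by (rule det_row_operation) (use 5 in auto)
      moreover have "((\<chi> i. if i = m then row m (mat 1) + 1 *s row n (mat 1) else row i (mat 1)) :: real^'n^'n) = ?A"
        using 5 by (auto simp: vec_eq_iff row_def mat_def)
      ultimately show ?thesis by simp
    qed
    show ?case unfolding P_def det act
    proof (intro impI allI)
      fix f :: "'a ^ 'n \<Rightarrow> ennreal" assume "f \<in> borel_measurable borel"
      from nn_integral_shear[OF this 5] show "(\<integral>\<^sup>+x. f x \<partial>lborel) = ennreal (\<bar>1\<bar> ^ DIM('a))
        * (\<integral>\<^sup>+x. f (\<chi> i. if i = m then x $ m + x $ n else x $ i) \<partial>lborel)"
        unfolding abs_one power_one ennreal_1 mult_1_left by (rule sym)
    qed
  qed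
  with assms show ?thesis unfolding P_def by blast
qed

lemma nn_integral_matrix_mult_left:
  fixes f :: "real^'d^'p \<Rightarrow> ennreal" and A :: "real^'p^'p"
  assumes "det A \<noteq> 0" and "f \<in> borel_measurable borel"
  shows "(\<integral>\<^sup>+x. f x \<partial>lborel) = ennreal (\<bar>det A\<bar> ^ CARD('d)) * (\<integral>\<^sup>+x. f (A ** x) \<partial>lborel)"
proof -
  have "row_action A x = A ** x" for x :: "real^'d^'p"
    by (simp add: row_action_def matrix_matrix_mult_def vec_eq_iff)
  then show ?thesis using nn_integral_row_action[OF assms] by simp
qed

lemma transpose_axis_axis: "transpose (axis i (axis j c)) = axis j (axis i c)"
  by (auto simp: vec_eq_iff transpose_def axis_def)

lemma transpose_in_Basis:
  fixes b :: "real^'d^'p"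
  assumes "b \<in> Basis"
  shows "transpose b \<in> Basis"
proof -
  obtain i j where "b = axis i (axis j 1)" using assms by (auto simp: Basis_vec_def)
  then show ?thesis by (simp add: transpose_axis_axis)
qed

lemma lborel_distr_transpose:
  "distr lborel borel (transpose :: real^'d^'p \<Rightarrow> real^'p^'d) = lborel"
proof (rule lborel_distr_permute_Basis)
  show "linear (transpose :: real^'d^'p \<Rightarrow> real^'p^'d)"
    by (rule linearI) (auto simp: vec_eq_iff transpose_def)
  show "bij_betw (transpose :: real^'d^'p \<Rightarrow> real^'p^'d) Basis Basis"
    by (intro bij_betwI[where g=transpose]) (auto intro: transpose_in_Basis)
qed

lemma measurable_transpose [measurable]:
  "(transpose :: real^'d^'p \<Rightarrow> real^'p^'d) \<in> borel_measurable borel"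
  unfolding transpose_def[abs_def] by measurable

lemma nn_integral_transpose:
  fixes f :: "real^'p^'d \<Rightarrow> ennreal"
  assumes "f \<in> borel_measurable borel"
  shows "(\<integral>\<^sup>+x. f (transpose x) \<partial>lborel) = (\<integral>\<^sup>+x. f x \<partial>lborel)"
  by (subst lborel_distr_transpose[symmetric], subst nn_integral_distr) (use assms in auto)

text \<open>Transposition preserves Lebesgue measure and turns right multiplication by
  \<open>B\<close> into left multiplication by its transpose.\<close>

lemma nn_integral_matrix_mult_right:
  fixes f :: "real^'d^'p \<Rightarrow> ennreal" and B :: "real^'d^'d"
  assumes "det B \<noteq> 0" and [measurable]: "f \<in> borel_measurable borel"
  shows "(\<integral>\<^sup>+x. f x \<partial>lborel) = ennreal (\<bar>det B\<bar> ^ CARD('p)) * (\<integral>\<^sup>+x. f (x ** B) \<partial>lborel)"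
proof -
  have 1: "(\<lambda>x. f (transpose x)) \<in> borel_measurable borel" by measurable
  have "(\<lambda>x :: real^'d^'p. x ** B) \<in> borel_measurable borel"
    unfolding matrix_matrix_mult_def by measurable
  then have 2: "(\<lambda>x. f (x ** B)) \<in> borel_measurable borel" by measurable
  have "(\<integral>\<^sup>+x. f x \<partial>lborel) = (\<integral>\<^sup>+x. f (transpose x) \<partial>lborel)"
    by (simp add: nn_integral_transpose)
  also have "\<dots> = ennreal (\<bar>det (transpose B)\<bar> ^ CARD('p)) * (\<integral>\<^sup>+x. f (transpose (transpose B ** x)) \<partial>lborel)"
    by (rule nn_integral_matrix_mult_left[OF _ 1]) (simp add: det_transpose assms)
  also have "(\<integral>\<^sup>+x. f (transpose (transpose B ** x)) \<partial>lborel) = (\<integral>\<^sup>+x. f (x ** B) \<partial>lborel)"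
    using nn_integral_transpose[OF 2] by (simp add: matrix_transpose_mul del: transpose_iff)
  finally show ?thesis by (simp add: det_transpose)
qed

section \<open>Positive definite matrices and the matrix Gaussian integral\<close>

lemma matrix_inv_unique:
  fixes A :: "real^'n^'n"
  assumes "A ** B = mat 1"
  shows "matrix_inv A = B"
proof -
  have BA: "B ** A = mat 1" using assms matrix_left_right_inverse by blast
  have "\<exists>A'. A ** A' = mat 1 \<and> A' ** A = mat 1" using assms BA by blast
  then have "A ** matrix_inv A = mat 1" unfolding matrix_inv_def by (rule someI2_ex) simp
  then have "B ** (A ** matrix_inv A) = B" by simp
  then show ?thesis by (simp add: matrix_mul_assoc BA)
qed

lemma matrix_inv_inverse:
  fixes A :: "real^'n^'n"
  assumes "det A \<noteq> 0"
  shows "A ** matrix_inv A = mat 1" "matrix_inv A ** A = mat 1"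
proof -
  have "invertible A" using assms by (simp add: invertible_det_nz)
  then obtain B where "A ** B = mat 1" by (auto simp: invertible_def)
  then show "A ** matrix_inv A = mat 1" by (simp add: matrix_inv_unique)
  then show "matrix_inv A ** A = mat 1" using matrix_left_right_inverse by blast
qed

lemma pos_def_inner_commute:
  assumes "pos_def A"
  shows "u \<bullet> (A *v v) = v \<bullet> (A *v u)"
  using assms dot_lmul_matrix[of u A v] by (metis inner_commute pos_def_def transpose_matrix_vector)

text \<open>Orthogonality with respect to \<open>A\<close> is ordinary orthogonality to the vectors
  \<open>A *v v\<close>. As long as fewer than \<open>CARD('n)\<close> vectors are chosen, some
  nonzero \<open>w\<close> is orthogonal to all of these, and it only has to be normalised.\<close>

lemma pos_def_orthonormal_basis:
  fixes A :: "real^'n^'n"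
  assumes A: "pos_def A" and "k \<le> CARD('n)"
  shows "\<exists>S. finite S \<and> card S = k \<and> (\<forall>u\<in>S. \<forall>v\<in>S. u \<bullet> (A *v v) = (if u = v then 1 else 0))"
  using \<open>k \<le> CARD('n)\<close>
proof (induction k)
  case 0
  then show ?case by (intro exI[of _ "{}"]) simp
next
  case (Suc k)
  then obtain S where S: "finite S" "card S = k"
    and on: "\<And>u v. u \<in> S \<Longrightarrow> v \<in> S \<Longrightarrow> u \<bullet> (A *v v) = (if u = v then 1 else 0)" by auto
  have "dim ((*v) A ` S) \<le> card ((*v) A ` S)" using S by (intro dim_le_card') simp
  also have "\<dots> \<le> k" using card_image_le[OF S(1)] S(2) by blast
  also have "k < DIM(real^'n)" using Suc.prems by simp
  finally obtain w where w: "w \<noteq> 0" "\<And>y. y \<in> span ((*v) A ` S) \<Longrightarrow> orthogonal w y"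
    by (rule orthogonal_to_subspace_exists) blast
  have w0: "w \<bullet> (A *v v) = 0" if "v \<in> S" for v
    using w(2)[of "A *v v"] that by (simp add: span_base orthogonal_def)
  define q where "q = w \<bullet> (A *v w)"
  have q: "q > 0" using A w(1) by (simp add: pos_def_def q_def)
  define e where "e = inverse (sqrt q) *\<^sub>R w"
  have e1: "e \<bullet> (A *v e) = 1"
    using q by (simp add: e_def matrix_vector_mult_scaleR q_def[symmetric] field_simps)
  have e0: "e \<bullet> (A *v v) = 0" if "v \<in> S" for v
    using w0[OF that] by (simp add: e_def)
  then have e0': "v \<bullet> (A *v e) = 0" if "v \<in> S" for v
    using that pos_def_inner_commute[OF A] by metis
  have "e \<notin> S" using e0 e1 by fastforce
  then show ?case
    using S on e1 e0 e0' by (intro exI[of _ "insert e S"]) auto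
qed

text \<open>The columns of \<open>U\<close> are a basis orthonormal with respect to
  \<open>A\<close>; in integrals \<open>U\<close> plays the part of an inverse square root of
  \<open>A\<close>.\<close>

lemma pos_def_congruent_identity:
  fixes A :: "real^'n^'n"
  assumes "pos_def A"
  obtains U :: "real^'n^'n" where "transpose U ** A ** U = mat 1"
proof -
  obtain S where S: "finite S" "card S = CARD('n)"
    "\<And>u v. u \<in> S \<Longrightarrow> v \<in> S \<Longrightarrow> u \<bullet> (A *v v) = (if u = v then 1 else 0)"
    using pos_def_orthonormal_basis[OF assms order_refl] by blast
  then obtain g :: "'n \<Rightarrow> real^'n" where g: "bij_betw g UNIV S"
    using finite_same_card_bij[of "UNIV :: 'n set" S] by auto
  define U where "U = transpose (\<chi> j. g j)"
  have "(transpose U ** (A ** U)) $ i $ j = g i \<bullet> (A *v g j)" for i j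
    by (simp add: U_def matrix_matrix_mult_def transpose_def matrix_vector_mult_def inner_vec_def)
  moreover have "g i \<bullet> (A *v g j) = (if i = j then 1 else 0)" for i j
    using S(3)[of "g i" "g j"] g by (auto simp: bij_betw_def inj_on_def)
  ultimately have "transpose U ** (A ** U) = mat 1"
    by (simp add: vec_eq_iff mat_def)
  then show ?thesis using that by (simp add: matrix_mul_assoc)
qed

lemma congruent_identity_det:
  fixes A U :: "real^'n^'n"
  assumes "transpose U ** A ** U = mat 1"
  shows "(det U)\<^sup>2 * det A = 1"
proof -
  have "det (transpose U ** A ** U) = 1" using assms by simp
  then show ?thesis by (simp add: det_mul det_transpose power2_eq_square mult_ac)
qed

lemma pos_def_det_pos:
  fixes A :: "real^'n^'n"
  assumes "pos_def A"
  shows "det A > 0"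
proof -
  obtain U :: "real^'n^'n" where "transpose U ** A ** U = mat 1" using pos_def_congruent_identity[OF assms] .
  then have "(det U)\<^sup>2 * det A = 1" by (rule congruent_identity_det)
  then show ?thesis by (metis zero_less_mult_pos zero_less_one zero_less_power2 mult_zero_left power_zero_numeral)
qed

lemma pos_def_matrix_inv:
  fixes A :: "real^'n^'n"
  assumes A: "pos_def A"
  shows "pos_def (matrix_inv A)" "matrix_inv (matrix_inv A) = A"
    "A ** matrix_inv A = mat 1" "matrix_inv A ** A = mat 1" "det (matrix_inv A) = inverse (det A)"
proof -
  have d: "det A \<noteq> 0" using pos_def_det_pos[OF A] by simp
  note i = matrix_inv_inverse[OF d]
  show "A ** matrix_inv A = mat 1" "matrix_inv A ** A = mat 1" by (rule i)+
  show "matrix_inv (matrix_inv A) = A" by (rule matrix_inv_unique[OF i(2)])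
  have "det (A ** matrix_inv A) = 1" using i by simp
  then show "det (matrix_inv A) = inverse (det A)" using d by (simp add: det_mul field_simps)
  have "A ** transpose (matrix_inv A) = transpose (matrix_inv A ** A)"
    using A by (simp add: matrix_transpose_mul pos_def_def)
  then have sym: "transpose (matrix_inv A) = matrix_inv A"
    using matrix_inv_unique[of A "transpose (matrix_inv A)"] i(2) by simp
  show "pos_def (matrix_inv A)" unfolding pos_def_def
  proof (intro conjI allI impI)
    fix v :: "real^'n" assume "v \<noteq> 0"
    define w where "w = matrix_inv A *v v"
    have Aw: "A *v w = v" by (simp add: w_def matrix_vector_mul_assoc i)
    then have "w \<noteq> 0" using \<open>v \<noteq> 0\<close> by auto
    then have "w \<bullet> (A *v w) > 0" using A by (simp add: pos_def_def)
    then show "v \<bullet> (matrix_inv A *v v) > 0" unfolding w_def[symmetric] Aw by (simp add: inner_commute)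
  qed (rule sym)
qed

lemma nn_integral_gaussian_lborel:
  "(\<integral>\<^sup>+x. ennreal (exp (- (1/2) * (\<Sum>b\<in>Basis. (x \<bullet> b)\<^sup>2))) \<partial>(lborel :: 'a::euclidean_space measure))
    = ennreal ((2 * pi) powr (DIM('a) / 2))"
proof -
  have 1: "(\<integral>\<^sup>+x. ennreal (exp (- (1/2) * x\<^sup>2)) \<partial>lborel) = ennreal (sqrt (2 * pi))"
  proof -
    have "(\<integral>\<^sup>+x. ennreal (exp (- (1/2) * x\<^sup>2)) \<partial>lborel)
      = (\<integral>\<^sup>+x. ennreal (sqrt (2 * pi)) * ennreal (std_normal_density x) \<partial>lborel)"
      by (rule nn_integral_cong) (simp add: std_normal_density_def ennreal_mult[symmetric])
    also have "\<dots> = ennreal (sqrt (2 * pi)) * (\<integral>\<^sup>+x. ennreal (std_normal_density x) \<partial>lborel)"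
      by (rule nn_integral_cmult) simp
    also have "(\<integral>\<^sup>+x. ennreal (std_normal_density x) \<partial>lborel) = 1"
      by (subst nn_integral_eq_integral) auto
    finally show ?thesis by simp
  qed
  have "(\<integral>\<^sup>+x. ennreal (exp (- (1/2) * (\<Sum>b\<in>Basis. (x \<bullet> b)\<^sup>2))) \<partial>(lborel :: 'a measure))
    = (\<integral>\<^sup>+x. (\<Prod>b\<in>Basis. ennreal (exp (- (1/2) * (x \<bullet> b)\<^sup>2))) \<partial>(lborel :: 'a measure))"
    by (rule nn_integral_cong) (simp only: sum_distrib_left exp_sum[OF finite_Basis] prod_ennreal[symmetric] exp_ge_zero)
  also have "\<dots> = (\<Prod>b\<in>(Basis :: 'a set). ennreal (sqrt (2 * pi)))"
    using 1 by (subst nn_integral_lborel_prod) simp_all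
  also have "\<dots> = ennreal (sqrt (2 * pi) ^ DIM('a))" by (simp add: ennreal_power)
  also have "sqrt (2 * pi) ^ DIM('a) = (2 * pi) powr (DIM('a) / 2)"
    by (simp add: powr_half_sqrt[symmetric] powr_realpow[symmetric] powr_powr mult.commute)
  finally show ?thesis .
qed

text \<open>After a translation, the substitution of \<open>U ** x ** transpose V\<close> for
  \<open>x\<close> turns the exponent into the squared Euclidean norm. The Jacobian consists of
  powers of \<open>\<bar>det U\<bar>\<close> and \<open>\<bar>det V\<bar>\<close>, which are the
  inverse square roots of \<open>det A\<close> and \<open>det B\<close>.\<close>

lemma nn_integral_matrix_gaussian:
  fixes A :: "real^'p^'p" and B :: "real^'d^'d" and \<mu> :: "real^'d^'p"
  assumes A: "pos_def A" and B: "pos_def B"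
  shows "(\<integral>\<^sup>+x. ennreal (exp (- (1/2) * trace (A ** (x - \<mu>) ** B ** transpose (x - \<mu>)))) \<partial>lborel)
    = ennreal ((2 * pi) powr (real CARD('p) * real CARD('d) / 2) *
        det A powr (- real CARD('d) / 2) * det B powr (- real CARD('p) / 2))"
proof -
  obtain U :: "real^'p^'p" where U: "transpose U ** A ** U = mat 1" using pos_def_congruent_identity[OF A] .
  obtain V :: "real^'d^'d" where V: "transpose V ** B ** V = mat 1" using pos_def_congruent_identity[OF B] .
  have root: "\<bar>det U'\<bar> ^ n = det A' powr (- real n / 2)" "det U' \<noteq> 0"
    if "transpose U' ** A' ** U' = mat 1" "pos_def A'" for U' A' :: "real^'m^'m" and n
  proof -
    have d: "(det U')\<^sup>2 * det A' = 1" by (rule congruent_identity_det[OF that(1)])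
    then show nz: "det U' \<noteq> 0" by auto
    have pos: "det A' > 0" by (rule pos_def_det_pos[OF that(2)])
    have "\<bar>det U'\<bar> = sqrt (inverse (det A'))"
      using d pos by (intro real_sqrt_unique[symmetric]) (auto simp: field_simps)
    also have "\<dots> = det A' powr (- 1 / 2)"
      using pos by (simp add: powr_half_sqrt[symmetric] powr_minus real_sqrt_inverse)
    finally have "\<bar>det U'\<bar> ^ n = (det A' powr (- 1 / 2)) ^ n" by simp
    also have "\<dots> = det A' powr (- real n / 2)"
      using pos by (simp add: powr_realpow[symmetric] powr_powr)
    finally show "\<bar>det U'\<bar> ^ n = det A' powr (- real n / 2)" .
  qed
  define f where "f x = ennreal (exp (- (1/2) * trace (A ** x ** B ** transpose x)))" for x :: "real^'d^'p"
  have [measurable]: "f \<in> borel_measurable borel"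
    unfolding f_def trace_def matrix_matrix_mult_def transpose_def by measurable
  have [measurable]: "(\<lambda>x. U ** x) \<in> borel_measurable borel" for U :: "real^'p^'p"
    unfolding matrix_matrix_mult_def by measurable
  have "(\<integral>\<^sup>+x. f (x - \<mu>) \<partial>lborel) = (\<integral>\<^sup>+x. f x \<partial>lborel)"
  proof -
    have "(\<integral>\<^sup>+x. f x \<partial>lborel) = (\<integral>\<^sup>+x. f x \<partial>distr lborel borel ((+) (- \<mu>)))"
      by (simp add: lborel_distr_plus)
    also have "\<dots> = (\<integral>\<^sup>+x. f (- \<mu> + x) \<partial>lborel)" by (rule nn_integral_distr) auto
    finally show ?thesis by simp
  qed
  also have "\<dots> = ennreal (\<bar>det U\<bar> ^ CARD('d)) * (\<integral>\<^sup>+x. f (U ** x) \<partial>lborel)"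
    by (rule nn_integral_matrix_mult_left[OF root(2)[OF U A]]) measurable
  also have "(\<integral>\<^sup>+x. f (U ** x) \<partial>lborel)
    = ennreal (\<bar>det (transpose V)\<bar> ^ CARD('p)) * (\<integral>\<^sup>+x. f (U ** (x ** transpose V)) \<partial>lborel)"
    by (rule nn_integral_matrix_mult_right) (use root(2)[OF V B] in \<open>simp_all add: det_transpose\<close>)
  also have "(\<integral>\<^sup>+x. f (U ** (x ** transpose V)) \<partial>lborel) = ennreal ((2 * pi) powr (DIM(real^'d^'p) / 2))"
  proof -
    have "f (U ** (x ** transpose V)) = ennreal (exp (- (1/2) * (\<Sum>b\<in>Basis. (x \<bullet> b)\<^sup>2)))" for x
    proof -
      have "trace (A ** (U ** (x ** transpose V)) ** B ** transpose (U ** (x ** transpose V)))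
        = trace ((A ** U ** x ** (transpose V ** B ** V) ** transpose x) ** transpose U)"
        by (simp add: matrix_transpose_mul matrix_mul_assoc del: transpose_iff)
      \<comment> \<open>Cyclicity of the trace brings \<open>transpose U\<close> next to
        \<open>A ** U\<close>.\<close>
      also have "\<dots> = trace (transpose U ** (A ** U ** x ** (transpose V ** B ** V) ** transpose x))"
        by (rule trace_mul_sym)
      also have "\<dots> = trace ((transpose U ** A ** U) ** x ** (transpose V ** B ** V) ** transpose x)"
        by (simp only: matrix_mul_assoc)
      also have "\<dots> = trace (x ** transpose x)" by (simp only: U V matrix_mul_lid matrix_mul_rid)
      also have "\<dots> = x \<bullet> x"
        by (simp add: trace_def matrix_matrix_mult_def transpose_def inner_vec_def)
      also have "\<dots> = (\<Sum>b\<in>Basis. (x \<bullet> b)\<^sup>2)"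
        by (subst euclidean_inner) (simp add: power2_eq_square)
      finally show ?thesis by (simp add: f_def)
    qed
    then show ?thesis by (simp only: nn_integral_gaussian_lborel)
  qed
  finally show ?thesis
    unfolding f_def[symmetric] det_transpose root(1)[OF U A] root(1)[OF V B]
    by (simp add: ennreal_mult[symmetric] mult_ac)
qed

section \<open>Lebesgue measure on the positive definite matrices\<close>

lemma sets_sym_lborel [simp, measurable_cong]: "sets sym_lborel = sets borel"
  by (simp add: sym_lborel_def)

lemma space_sym_lborel [simp]: "space sym_lborel = UNIV"
  by (simp add: sym_lborel_def)

lemma measurable_sym_matrix [measurable]:
  "(\<lambda>v. \<chi> i j. v {i, j}) \<in> borel_measurable (Pi\<^sub>M (range (\<lambda>(i :: 'd::finite, j). {i, j})) (\<lambda>_. lborel :: real measure))"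
proof (intro measurable_vec_lambda)
  fix i j :: 'd
  have "{i, j} \<in> range (\<lambda>(i :: 'd, j). {i, j})" by (rule range_eqI[of _ _ "(i, j)"]) simp
  from measurable_component_singleton[OF this, of "\<lambda>_. lborel :: real measure"]
  show "(\<lambda>v. v {i, j}) \<in> borel_measurable (Pi\<^sub>M (range (\<lambda>(i :: 'd, j). {i, j})) (\<lambda>_. lborel :: real measure))"
    by simp
qed

text \<open>The preimage of \<open>A k\<close> in the free coordinates is a cube, which has finite
  volume, and the sets \<open>A k\<close> exhaust the space.\<close>

lemma sigma_finite_sym_lborel: "sigma_finite_measure (sym_lborel :: (real^'d^'d) measure)"
proof
  interpret product_sigma_finite "\<lambda>_ :: 'd set. lborel :: real measure" ..
  let ?I = "range (\<lambda>(i :: 'd, j). {i, j})"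
  define A where "A k = {S :: real^'d^'d. \<forall>i j. S $ i $ j \<in> {- real k .. real k}}" for k :: nat
  have A: "A k \<in> sets borel" for k
    unfolding A_def by measurable
  have "emeasure sym_lborel (A k) < \<infinity>" for k
  proof -
    have "emeasure sym_lborel (A k)
      = emeasure (Pi\<^sub>M ?I (\<lambda>_. lborel)) ((\<lambda>v. \<chi> i j. v {i, j}) -` A k \<inter> space (Pi\<^sub>M ?I (\<lambda>_. lborel)))"
      unfolding sym_lborel_def by (rule emeasure_distr[OF measurable_sym_matrix A])
    also have "(\<lambda>v. \<chi> i j. v {i, j}) -` A k \<inter> space (Pi\<^sub>M ?I (\<lambda>_. lborel))
      = Pi\<^sub>E ?I (\<lambda>_. {- real k .. real k})"
      by (auto simp: A_def space_PiM PiE_iff)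
    also have "emeasure (Pi\<^sub>M ?I (\<lambda>_. lborel)) \<dots> = (\<Prod>i\<in>?I. emeasure lborel {- real k .. real k})"
      by (rule emeasure_PiM) auto
    also have "\<dots> < \<infinity>" by (simp add: ennreal_power[symmetric] less_top[symmetric] power_eq_top_ennreal)
    finally show ?thesis .
  qed
  moreover have "(\<Union>k. A k) = UNIV"
  proof -
    have "\<exists>k. S \<in> A k" for S
    proof -
      obtain k :: nat where k: "norm S \<le> real k" using real_arch_simple by blast
      have "\<bar>S $ i $ j\<bar> \<le> norm S" for i j
        using component_le_norm_cart[of "S $ i" j] Finite_Cartesian_Product.norm_nth_le[of S i] by linarith
      then have "\<bar>S $ i $ j\<bar> \<le> real k" for i j using k order_trans by blast
      then show ?thesis by (intro exI[of _ k]) (auto simp: A_def abs_le_iff minus_le_iff)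
    qed
    then show ?thesis by blast
  qed
  ultimately show "\<exists>C. countable C \<and> C \<subseteq> sets (sym_lborel :: (real^'d^'d) measure) \<and>
      \<Union> C = space (sym_lborel :: (real^'d^'d) measure) \<and>
      (\<forall>a\<in>C. emeasure (sym_lborel :: (real^'d^'d) measure) a \<noteq> \<infinity>)"
    using A by (intro exI[of _ "range A"]) (auto simp: less_top)
qed

text \<open>The definition quantifies over uncountably many vectors. The quadratic form attains a
  positive minimum on the compact unit sphere, so each positive definite matrix lies in some closed
  set \<open>C k\<close>, and countably many of these suffice.\<close>

lemma borel_pos_def [measurable]: "{S :: real^'d^'d. pos_def S} \<in> sets borel"
proof -
  define C where "C k = {S :: real^'d^'d. transpose S = S \<and> (\<forall>v. v \<bullet> (S *v v) \<ge> inverse (real (Suc k)) * (v \<bullet> v))}"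
    for k
  have "closed (C k)" for k
  proof -
    have *: "continuous_on UNIV (\<lambda>S :: real^'d^'d. v \<bullet> (S *v v))" for v
      unfolding matrix_vector_mult_def by (intro continuous_intros)
    have **: "continuous_on UNIV (\<lambda>S :: real^'d^'d. transpose S)"
      unfolding transpose_def by (intro continuous_intros)
    have "C k = {S. transpose S = S} \<inter> (\<Inter>v. {S. inverse (real (Suc k)) * (v \<bullet> v) \<le> v \<bullet> (S *v v)})"
      by (auto simp: C_def)
    moreover have "closed \<dots>"
      by (intro closed_Int closed_INT ballI closed_Collect_eq closed_Collect_le * ** continuous_on_const
          continuous_on_id)
    ultimately show ?thesis by simp
  qed
  then have C: "C k \<in> sets borel" for k by (rule borel_closed)
  have "{S :: real^'d^'d. pos_def S} = (\<Union>k. C k)"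
  proof (intro set_eqI iffI)
    fix S :: "real^'d^'d" assume "S \<in> (\<Union>k. C k)"
    then obtain k where k: "S \<in> C k" by blast
    show "S \<in> {S. pos_def S}" unfolding mem_Collect_eq pos_def_def
    proof (intro conjI allI impI)
      show "transpose S = S" using k by (simp add: C_def)
      fix v :: "real^'d" assume "v \<noteq> 0"
      then have "0 < inverse (real (Suc k)) * (v \<bullet> v)" by simp
      then show "0 < v \<bullet> (S *v v)" using k by (auto simp: C_def intro: less_le_trans)
    qed
  next
    fix S :: "real^'d^'d" assume "S \<in> {S. pos_def S}"
    then have S: "transpose S = S" "\<And>v. v \<noteq> 0 \<Longrightarrow> v \<bullet> (S *v v) > 0" by (auto simp: pos_def_def)
    have "continuous_on (sphere 0 1) (\<lambda>v :: real^'d. v \<bullet> (S *v v))"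
      by (intro continuous_intros linear_continuous_on matrix_vector_mul_bounded_linear)
    moreover have "sphere 0 1 \<noteq> ({} :: (real^'d) set)" by simp
    ultimately obtain u where u: "u \<in> sphere 0 1"
      "\<And>v :: real^'d. v \<in> sphere 0 1 \<Longrightarrow> u \<bullet> (S *v u) \<le> v \<bullet> (S *v v)"
      using continuous_attains_inf[OF compact_sphere, of 0 1] by blast
    have "u \<noteq> 0" using u(1) by auto
    then have "0 < u \<bullet> (S *v u)" by (rule S(2))
    then obtain k where k: "inverse (real (Suc k)) < u \<bullet> (S *v u)" using reals_Archimedean by blast
    have "inverse (real (Suc k)) * (v \<bullet> v) \<le> v \<bullet> (S *v v)" for v
    proof (cases "v = 0")
      case False
      define w where "w = inverse (norm v) *\<^sub>R v"
      have "w \<in> sphere 0 1" using False by (simp add: w_def)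
      from u(2)[OF this] k have "inverse (real (Suc k)) \<le> w \<bullet> (S *v w)" by linarith
      also have "\<dots> = (v \<bullet> (S *v v)) / (norm v)\<^sup>2"
        by (simp add: w_def matrix_vector_mult_scaleR power2_eq_square divide_inverse mult_ac)
      finally show ?thesis using False by (simp add: pos_le_divide_eq dot_square_norm)
    qed simp
    then have "S \<in> C k" using S(1) by (simp add: C_def)
    then show "S \<in> (\<Union>k. C k)" by blast
  qed
  then show ?thesis using C by simp
qed

lemma space_pd_lborel [simp]: "space pd_lborel = {S. pos_def S}"
  by (simp add: pd_lborel_def space_restrict_space)

lemma sigma_finite_pd_lborel: "sigma_finite_measure (pd_lborel :: (real^'d^'d) measure)"
  unfolding pd_lborel_def
  by (rule sigma_finite_measure_restrict_space[OF sigma_finite_sym_lborel]) simp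

lemma measurable_pd_lborel:
  assumes "f \<in> borel_measurable borel"
  shows "f \<in> borel_measurable pd_lborel"
  unfolding pd_lborel_def by (rule measurable_restrict_space1) (use assms in simp)

lemma measurable_pd_ident [measurable]: "(\<lambda>S. S) \<in> borel_measurable pd_lborel"
  by (rule measurable_pd_lborel) simp

lemma nn_integral_pd_lborel:
  "(\<integral>\<^sup>+S. f S \<partial>pd_lborel) = (\<integral>\<^sup>+S. f S * indicator {S. pos_def S} S \<partial>sym_lborel)"
  unfolding pd_lborel_def by (rule nn_integral_restrict_space) simp

lemma nn_integral_PiM_scale:
  fixes f :: "('i \<Rightarrow> real) \<Rightarrow> ennreal"
  assumes I: "finite I" and c: "c > 0"
    and f [measurable]: "f \<in> borel_measurable (Pi\<^sub>M I (\<lambda>_. lborel))"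
  shows "(\<integral>\<^sup>+v. f v \<partial>Pi\<^sub>M I (\<lambda>_. lborel))
    = ennreal (c ^ card I) * (\<integral>\<^sup>+v. f (\<lambda>i\<in>I. c * v i) \<partial>Pi\<^sub>M I (\<lambda>_. lborel))"
proof -
  interpret product_sigma_finite "\<lambda>_ :: 'i. lborel :: real measure" ..
  let ?P = "Pi\<^sub>M I (\<lambda>_. lborel :: real measure)"
  let ?T = "\<lambda>v. \<lambda>i\<in>I. c * v i"
  have T [measurable]: "?T \<in> measurable ?P ?P" by measurable
  have "density (distr ?P ?P ?T) (\<lambda>_. ennreal (c ^ card I)) = ?P"
  proof (rule PiM_eqI[OF I])
    fix A :: "'i \<Rightarrow> real set" assume A: "\<And>i. i \<in> I \<Longrightarrow> A i \<in> sets lborel"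
    have "Pi\<^sub>E I A \<in> sets ?P" using A I by (intro sets_PiM_I_finite) auto
    then have "emeasure (density (distr ?P ?P ?T) (\<lambda>_. ennreal (c ^ card I))) (Pi\<^sub>E I A)
      = ennreal (c ^ card I) * emeasure ?P (?T -` Pi\<^sub>E I A \<inter> space ?P)"
      by (simp add: emeasure_density_const emeasure_distr)
    also have "?T -` Pi\<^sub>E I A \<inter> space ?P = Pi\<^sub>E I (\<lambda>i. (*) c -` A i)"
      by (auto simp: space_PiM PiE_iff)
    also have "emeasure ?P \<dots> = (\<Prod>i\<in>I. emeasure lborel ((*) c -` A i))"
    proof (rule emeasure_PiM[OF I])
      fix i assume "i \<in> I"
      then have "A i \<in> sets borel" using A by simp
      then have "(*) c -` A i \<inter> space borel \<in> sets borel" by (intro measurable_sets[of _ _ borel]) auto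
      then show "(*) c -` A i \<in> sets lborel" by simp
    qed
    also have "ennreal (c ^ card I) * \<dots> = (\<Prod>i\<in>I. ennreal c * emeasure lborel ((*) c -` A i))"
      using c by (simp add: prod.distrib ennreal_power)
    also have "\<dots> = (\<Prod>i\<in>I. emeasure lborel (A i))"
    proof (rule prod.cong[OF refl])
      fix i assume "i \<in> I"
      then have Ai: "A i \<in> sets borel" using A by simp
      have "emeasure lborel (A i) = emeasure (density (distr lborel borel ((*) c)) (\<lambda>_. \<bar>c\<bar>)) (A i)"
        using lborel_distr_mult'[of c] c by simp
      also have "\<dots> = ennreal c * emeasure lborel ((*) c -` A i)"
        using Ai c by (simp add: emeasure_density_const emeasure_distr)
      finally show "ennreal c * emeasure lborel ((*) c -` A i) = emeasure lborel (A i)" by simp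
    qed
    finally show "emeasure (density (distr ?P ?P ?T) (\<lambda>_. ennreal (c ^ card I))) (Pi\<^sub>E I A)
      = (\<Prod>i\<in>I. emeasure lborel (A i))" .
  qed simp
  then have "(\<integral>\<^sup>+v. f v \<partial>?P) = (\<integral>\<^sup>+v. f v \<partial>density (distr ?P ?P ?T) (\<lambda>_. ennreal (c ^ card I)))" by simp
  also have "\<dots> = ennreal (c ^ card I) * (\<integral>\<^sup>+v. f (?T v) \<partial>?P)"
    by (simp add: nn_integral_density nn_integral_cmult nn_integral_distr)
  finally show ?thesis .
qed

lemma pos_def_scaleR:
  assumes "c > 0"
  shows "pos_def (c *\<^sub>R S) \<longleftrightarrow> pos_def S"
proof -
  have "transpose (c *\<^sub>R S) = c *\<^sub>R S \<longleftrightarrow> transpose S = S"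
    using assms by (simp add: transpose_scalar)
  then show ?thesis using assms
    by (simp add: pos_def_def scaleR_matrix_vector_assoc[symmetric] zero_less_mult_iff)
qed

text \<open>Scaling by \<open>c\<close> preserves positive definiteness and multiplies each free
  entry by \<open>c\<close>. The exponent, of value d(d+1)/2, is left as a cardinality because it
  only enters a constant later.\<close>

lemma nn_integral_pd_lborel_scale:
  fixes f :: "real^'d^'d \<Rightarrow> ennreal"
  assumes c: "c > 0" and f: "f \<in> borel_measurable pd_lborel"
  shows "(\<integral>\<^sup>+S. f S \<partial>pd_lborel)
    = ennreal (c ^ card (range (\<lambda>(i :: 'd, j). {i, j}))) * (\<integral>\<^sup>+S. f (c *\<^sub>R S) \<partial>pd_lborel)"
proof -
  let ?I = "range (\<lambda>(i :: 'd, j). {i, j})"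
  let ?P = "Pi\<^sub>M ?I (\<lambda>_. lborel :: real measure)"
  let ?m = "\<lambda>v :: 'd set \<Rightarrow> real. (\<chi> i j. v {i, j}) :: real^'d^'d"
  \<comment> \<open>Extension by 0 makes the integrand Borel on all matrices, where the coordinate
    map of \<open>sym_lborel\<close> applies.\<close>
  define g where "g S = f S * indicator {S. pos_def S} S" for S
  have [measurable]: "g \<in> borel_measurable borel"
    using f borel_measurable_restrict_space_iff_ennreal[of "{S. pos_def S}" sym_lborel f]
    by (simp add: g_def[abs_def] pd_lborel_def mult.commute cong: measurable_cong_sets)
  have sym: "(\<integral>\<^sup>+S. k S \<partial>sym_lborel) = (\<integral>\<^sup>+v. k (?m v) \<partial>?P)"
    if [measurable]: "k \<in> borel_measurable borel" for k :: "real^'d^'d \<Rightarrow> ennreal"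
    unfolding sym_lborel_def by (rule nn_integral_distr[OF measurable_sym_matrix]) (use that in simp)
  have "(\<integral>\<^sup>+S. f S \<partial>pd_lborel) = (\<integral>\<^sup>+v. g (?m v) \<partial>?P)"
    unfolding nn_integral_pd_lborel g_def[symmetric] by (rule sym) measurable
  also have "\<dots> = ennreal (c ^ card ?I) * (\<integral>\<^sup>+v. g (?m (\<lambda>i\<in>?I. c * v i)) \<partial>?P)"
    by (rule nn_integral_PiM_scale[OF _ c]) (auto intro: measurable_compose[OF measurable_sym_matrix])
  also have "(\<lambda>v. g (?m (\<lambda>i\<in>?I. c * v i))) = (\<lambda>v. g (c *\<^sub>R ?m v))"
  proof
    fix v :: "'d set \<Rightarrow> real"
    have "{i, j} \<in> ?I" for i j :: 'd by (rule range_eqI[of _ _ "(i, j)"]) simp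
    then have "?m (\<lambda>i\<in>?I. c * v i) = c *\<^sub>R ?m v" by (simp add: vec_eq_iff)
    then show "g (?m (\<lambda>i\<in>?I. c * v i)) = g (c *\<^sub>R ?m v)" by (rule arg_cong)
  qed
  also have "(\<integral>\<^sup>+v. g (c *\<^sub>R ?m v) \<partial>?P) = (\<integral>\<^sup>+S. g (c *\<^sub>R S) \<partial>sym_lborel)"
    by (rule sym[symmetric]) measurable
  also have "\<dots> = (\<integral>\<^sup>+S. f (c *\<^sub>R S) \<partial>pd_lborel)"
    unfolding nn_integral_pd_lborel g_def
    by (intro nn_integral_cong) (simp add: indicator_def pos_def_scaleR[OF c])
  finally show ?thesis .
qed

lemma measurable_det [measurable (raw)]:
  fixes f :: "'x \<Rightarrow> real^'d^'d"
  assumes [measurable]: "f \<in> borel_measurable M"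
  shows "(\<lambda>x. det (f x)) \<in> borel_measurable M"
  unfolding det_def by measurable

text \<open>\<open>matrix_inv\<close> is a choice term and gives no formula on singular matrices. On
  positive definite ones Cramer's rule expresses each entry as a quotient of determinants.\<close>

lemma measurable_matrix_inv [measurable]:
  "(matrix_inv :: real^'d^'d \<Rightarrow> real^'d^'d) \<in> borel_measurable pd_lborel"
proof -
  define adj where "adj S = (\<chi> i j. det (\<chi> a b. if b = i then axis j 1 $ a else S $ a $ b) / det S)"
    for S :: "real^'d^'d"
  have "adj \<in> borel_measurable borel"
    unfolding adj_def[abs_def] by measurable
  then have "adj \<in> borel_measurable pd_lborel" by (rule measurable_pd_lborel)
  moreover have "matrix_inv S = adj S" if "S \<in> space pd_lborel" for S :: "real^'d^'d"
  proof -
    have S: "pos_def S" using that by simp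
    then have d: "det S \<noteq> 0" using pos_def_det_pos[OF S] by simp
    have "matrix_inv S $ i $ j = adj S $ i $ j" for i j
    proof -
      have "S *v (matrix_inv S *v axis j 1) = axis j 1"
        by (simp add: matrix_vector_mul_assoc pos_def_matrix_inv(3)[OF S])
      then have "matrix_inv S *v axis j 1
        = (\<chi> k. det (\<chi> a b. if b = k then axis j 1 $ a else S $ a $ b) / det S)"
        using cramer[OF d] by blast
      then have "(matrix_inv S *v axis j 1) $ i = adj S $ i $ j"
        by (simp add: adj_def)
      then show ?thesis
        by (simp add: matrix_vector_mult_basis column_def)
    qed
    then show ?thesis by (simp add: vec_eq_iff)
  qed
  ultimately show ?thesis by (subst measurable_cong)
qed

section \<open>Completing the square in the regression model\<close>

lemma matrix_sub_ldistrib: "A ** (B - C) = A ** B - A ** (C :: real^'k^'m)"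
  for A :: "real^'m^'n"
  by (simp add: matrix_matrix_mult_def vec_eq_iff right_diff_distrib sum_subtractf)

lemma matrix_sub_rdistrib: "(A - B) ** C = A ** C - B ** (C :: real^'k^'m)"
  for A B :: "real^'m^'n"
  by (simp add: matrix_matrix_mult_def vec_eq_iff left_diff_distrib sum_subtractf)

lemma matrix_add_rdistrib: "(A + B) ** C = A ** C + B ** (C :: real^'k^'m)"
  for A B :: "real^'m^'n"
  by (simp add: matrix_matrix_mult_def vec_eq_iff distrib_right sum.distrib)

lemma transpose_diff: "transpose (A - B) = transpose A - transpose (B :: real^'m^'n)"
  by (simp add: transpose_def vec_eq_iff)

text \<open>The inverse of \<open>Q_mat z\<close> for positive \<open>z\<close>: the matrix of
  observation weights.\<close>

definition diag_mat :: "real^'n \<Rightarrow> real^'n^'n" where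
  "diag_mat z = (\<chi> i j. if i = j then z $ i else 0)"

lemma matrix_inv_Q_mat:
  assumes "\<And>i. z $ i > 0"
  shows "matrix_inv (Q_mat z) = diag_mat z"
proof (rule matrix_inv_unique)
  have "inverse (z $ i) * z $ i = 1" for i using assms[of i] by simp
  moreover have "(Q_mat z ** diag_mat z) $ i $ j = (if i = j then inverse (z $ i) * z $ j else 0)" for i j
    by (simp add: matrix_matrix_mult_def Q_mat_def diag_mat_def if_distrib[of "\<lambda>x. x * _"] cong: if_cong)
  ultimately show "Q_mat z ** diag_mat z = mat 1" by (simp add: vec_eq_iff mat_def)
qed

lemma transpose_diag_mat [simp]: "transpose (diag_mat z) = diag_mat z"
  by (simp add: transpose_def diag_mat_def vec_eq_iff)

lemma diag_mat_mult_nth: "(diag_mat z ** M) $ i = z $ i *\<^sub>R M $ i"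
  by (simp add: matrix_matrix_mult_def diag_mat_def vec_eq_iff if_distrib[of "\<lambda>x. x * _"] cong: if_cong)

lemma diag_mat_mult_vec_nth: "(diag_mat z *v v) $ i = z $ i * v $ i"
  by (simp add: matrix_vector_mult_def diag_mat_def if_distrib[of "\<lambda>x. x * _"] cong: if_cong)

lemma weighted_Gram_inner:
  fixes M :: "real^'k^'n"
  shows "v \<bullet> ((transpose M ** diag_mat z ** M) *v v) = (\<Sum>i\<in>UNIV. z $ i * ((M *v v) $ i)\<^sup>2)"
proof -
  have "v \<bullet> ((transpose M ** diag_mat z ** M) *v v)
    = v \<bullet> (transpose M *v (diag_mat z *v (M *v v)))"
    by (simp only: matrix_vector_mul_assoc matrix_mul_assoc)
  also have "\<dots> = (M *v v) \<bullet> (diag_mat z *v (M *v v))"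
    using dot_lmul_matrix[of "diag_mat z *v (M *v v)" M v]
    by (simp only: transpose_matrix_vector inner_commute[of v] inner_commute[of "M *v v"])
  finally show ?thesis
    by (simp add: inner_vec_def diag_mat_mult_vec_nth power2_eq_square mult_ac)
qed

text \<open>The quadratic form is a weighted sum of squares of the entries of \<open>M *v v\<close>.
  It is applied to the design matrix and to the matrix of fitted residuals.\<close>

lemma weighted_Gram_pos_def:
  fixes M :: "real^'k^'n"
  assumes z: "\<And>i. z $ i > 0" and inj: "\<And>v. M *v v = 0 \<Longrightarrow> v = 0"
  shows "pos_def (transpose M ** diag_mat z ** M)"
  unfolding pos_def_def
proof (intro conjI allI impI)
  show "transpose (transpose M ** diag_mat z ** M) = transpose M ** diag_mat z ** M"
    by (simp add: matrix_transpose_mul matrix_mul_assoc del: transpose_iff)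
  fix v :: "real^'k" assume "v \<noteq> 0"
  then have "M *v v \<noteq> 0" using inj by blast
  then obtain i where i: "(M *v v) $ i \<noteq> 0" by (auto simp: vec_eq_iff)
  have "0 < (\<Sum>i\<in>UNIV. z $ i * ((M *v v) $ i)\<^sup>2)"
    using z i by (intro sum_pos2[of _ i]) (auto simp: less_imp_le)
  then show "0 < v \<bullet> ((transpose M ** diag_mat z ** M) *v v)" by (simp only: weighted_Gram_inner)
qed

text \<open>Full column rank makes the columns of \<open>X\<close> and \<open>y\<close> jointly
  independent. With \<open>c = 0\<close> this gives injectivity of \<open>X\<close>, with
  \<open>b = - (\<mu> *v c)\<close> injectivity of the residual matrix.\<close>

lemma concat_cols_injective:
  fixes X :: "real^'p^'n" and y :: "real^'d^'n"
  assumes "rank (concat_cols X y) = CARD('p) + CARD('d)" and "X *v b + y *v c = 0"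
  shows "b = 0" "c = 0"
proof -
  define v :: "real^('p + 'd)" where "v = (\<chi> j. case j of Inl k \<Rightarrow> b $ k | Inr k \<Rightarrow> c $ k)"
  have "inj ((*v) (concat_cols X y))"
    using assms(1) full_rank_injective[of "concat_cols X y"] by simp
  moreover have "(concat_cols X y *v v) $ i = (X *v b + y *v c) $ i" for i
  proof -
    have "(concat_cols X y *v v) $ i = (\<Sum>j\<in>UNIV <+> UNIV. concat_cols X y $ i $ j * v $ j)"
      by (simp add: matrix_vector_mult_def)
    also have "\<dots> = (X *v b + y *v c) $ i"
      by (subst sum.Plus) (simp_all add: concat_cols_def v_def matrix_vector_mult_def)
    finally show ?thesis .
  qed
  then have "concat_cols X y *v v = concat_cols X y *v 0" using assms(2) by (simp add: vec_eq_iff)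
  ultimately have v0: "v = 0" by (simp only: inj_eq)
  then have "v $ Inl k = 0" "v $ Inr l = 0" for k l by simp_all
  then show "b = 0" "c = 0" by (simp_all add: v_def vec_eq_iff)
qed

text \<open>The weighted scatter of the residuals at the least squares fit, in the form in which it
  occurs in \<open>Sigma_cond_density\<close>.\<close>

definition resid_scatter :: "real^'p^'n \<Rightarrow> real^'d^'n \<Rightarrow> real^'n \<Rightarrow> real^'d^'d" where
  "resid_scatter X y z = transpose y ** matrix_inv (Q_mat z) ** y -
     transpose (mu_mat X y z) ** matrix_inv (Omega_mat X z) ** mu_mat X y z"

text \<open>The joint density of state and latent vector, without the factors that depend on
  \<open>z\<close> alone. The exponent of the determinant collects n/2 from the likelihood and
  \<open>a\<close> from the prior.\<close>

definition joint_kernel ::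
  "real \<Rightarrow> real^'p^'n \<Rightarrow> real^'d^'n \<Rightarrow> real^'d^'p \<Rightarrow> real^'d^'d \<Rightarrow> real^'n \<Rightarrow> real" where
  "joint_kernel a X y \<beta> \<Sigma> z =
     det \<Sigma> powr (- (real CARD('n) / 2 + a)) * exp (- (1/2) * (\<Sum>i\<in>UNIV. z $ i * sq_resid X y \<beta> \<Sigma> i))"

context
  fixes X :: "real^'p^'n" and y :: "real^'d^'n" and z :: "real^'n"
  assumes rank: "rank (concat_cols X y) = CARD('p) + CARD('d)"
    and z: "\<And>i. z $ i > 0"
begin

abbreviation "G \<equiv> transpose X ** diag_mat z ** X"
abbreviation "\<mu> \<equiv> mu_mat X y z"

lemma pos_def_G: "pos_def G"
proof (rule weighted_Gram_pos_def[OF z])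
  fix v assume "X *v v = 0"
  then show "v = 0" using concat_cols_injective(1)[OF rank, of v 0] by simp
qed

lemma Omega_eq: "Omega_mat X z = matrix_inv G"
  by (simp add: Omega_mat_def matrix_inv_Q_mat[OF z])

lemma pos_def_Omega: "pos_def (Omega_mat X z)"
  unfolding Omega_eq by (rule pos_def_matrix_inv(1)[OF pos_def_G])

lemma inv_Omega: "matrix_inv (Omega_mat X z) = G"
  unfolding Omega_eq by (rule pos_def_matrix_inv(2)[OF pos_def_G])

lemma G_mu: "G ** \<mu> = transpose X ** diag_mat z ** y"
proof -
  have "G ** \<mu> = (G ** matrix_inv G) ** (transpose X ** diag_mat z ** y)"
    by (simp add: mu_mat_def matrix_inv_Q_mat[OF z] matrix_mul_assoc)
  then show ?thesis by (simp add: pos_def_matrix_inv(3)[OF pos_def_G])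
qed

lemma normal_equations: "transpose X ** diag_mat z ** (y - X ** \<mu>) = 0"
  using G_mu by (simp add: matrix_sub_ldistrib matrix_mul_assoc)

lemma normal_equations': "transpose (y - X ** \<mu>) ** diag_mat z ** X = 0"
proof -
  have "transpose (transpose X ** diag_mat z ** (y - X ** \<mu>)) = 0"
    by (simp only: normal_equations) (simp add: transpose_def vec_eq_iff)
  then show ?thesis by (simp add: matrix_transpose_mul matrix_mul_assoc del: transpose_iff)
qed

text \<open>The normal equations remove the cross terms; the result is a weighted Gram matrix, from
  which positive definiteness can be read off.\<close>

lemma resid_scatter_eq:
  "resid_scatter X y z = transpose (y - X ** \<mu>) ** diag_mat z ** (y - X ** \<mu>)"
proof -
  have "transpose (y - X ** \<mu>) ** diag_mat z ** (y - X ** \<mu>)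
    = transpose (y - X ** \<mu>) ** diag_mat z ** y - (transpose (y - X ** \<mu>) ** diag_mat z ** X) ** \<mu>"
    by (simp only: matrix_sub_ldistrib matrix_mul_assoc)
  also have "\<dots> = transpose (y - X ** \<mu>) ** diag_mat z ** y"
    by (simp only: normal_equations') (simp add: matrix_matrix_mult_def vec_eq_iff)
  also have "\<dots> = transpose y ** diag_mat z ** y - transpose \<mu> ** (transpose X ** diag_mat z ** y)"
    by (simp add: transpose_diff matrix_sub_rdistrib matrix_transpose_mul matrix_mul_assoc)
  also have "\<dots> = resid_scatter X y z"
    unfolding G_mu[symmetric] by (simp add: resid_scatter_def matrix_inv_Q_mat[OF z] inv_Omega matrix_mul_assoc)
  finally show ?thesis by simp
qed

lemma pos_def_resid_scatter: "pos_def (resid_scatter X y z)"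
  unfolding resid_scatter_eq
proof (rule weighted_Gram_pos_def[OF z])
  fix v assume "(y - X ** \<mu>) *v v = 0"
  then have "X *v (0 - \<mu> *v v) + y *v v = 0"
    by (simp only: matrix_vector_mult_diff_rdistrib matrix_vector_mul_assoc
        matrix_vector_mult_diff_distrib matrix_vector_mult_0_right) simp
  then show "v = 0" by (rule concat_cols_injective(2)[OF rank])
qed

text \<open>Completing the square: the residual at \<open>\<beta>\<close> is the residual at
  \<open>\<mu>\<close> minus \<open>X ** (\<beta> - \<mu>)\<close>, and the normal equations kill
  the mixed terms. Writing the sum as a trace allows the factors to be rotated.\<close>

lemma sum_sq_resid:
  "(\<Sum>i\<in>UNIV. z $ i * sq_resid X y \<beta> \<Sigma> i)
    = trace (matrix_inv (Omega_mat X z) ** (\<beta> - \<mu>) ** matrix_inv \<Sigma> ** transpose (\<beta> - \<mu>))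
      + trace (resid_scatter X y z ** matrix_inv \<Sigma>)"
proof -
  define P where "P = matrix_inv \<Sigma>"
  define E where "E = \<beta> - \<mu>"
  define R where "R = y - X ** \<beta>"
  let ?D = "diag_mat z" and ?r = "y - X ** \<mu>"
  have Ri: "y $ i - transpose \<beta> *v (X $ i) = R $ i" for i
    by (simp add: R_def vec_eq_iff matrix_matrix_mult_def matrix_vector_mult_def transpose_def mult.commute
        del: transpose_matrix_vector)
  have "(\<Sum>i\<in>UNIV. z $ i * sq_resid X y \<beta> \<Sigma> i) = (\<Sum>i\<in>UNIV. z $ i * (R $ i \<bullet> (P *v R $ i)))"
    unfolding sq_resid_def Ri P_def ..
  also have "\<dots> = trace (?D ** (R ** (P ** transpose R)))"
  proof -
    have "(R ** (P ** transpose R)) $ i $ i = R $ i \<bullet> (P *v R $ i)" for i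
      by (simp add: matrix_matrix_mult_def matrix_vector_mult_def transpose_def inner_vec_def)
    then show ?thesis by (simp add: trace_def diag_mat_mult_nth)
  qed
  also have "\<dots> = trace ((?D ** R ** P) ** transpose R)" by (simp only: matrix_mul_assoc)
  also have "\<dots> = trace (transpose R ** (?D ** R ** P))" by (rule trace_mul_sym)
  also have "\<dots> = trace ((transpose R ** ?D ** R) ** P)" by (simp only: matrix_mul_assoc)
  also have "transpose R ** ?D ** R = resid_scatter X y z + transpose E ** G ** E"
  proof -
    have R: "R = ?r - X ** E" by (simp add: R_def E_def matrix_sub_ldistrib)
    have "transpose R ** ?D ** R = transpose ?r ** ?D ** ?r - (transpose ?r ** ?D ** X) ** E
      - transpose E ** (transpose X ** ?D ** ?r) + transpose E ** G ** E"
      unfolding R by (simp add: transpose_diff matrix_sub_ldistrib matrix_sub_rdistrib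
          matrix_transpose_mul matrix_mul_assoc)
    then show ?thesis unfolding normal_equations normal_equations' resid_scatter_eq
      by (simp add: matrix_matrix_mult_def vec_eq_iff)
  qed
  also have "trace ((resid_scatter X y z + transpose E ** G ** E) ** P)
    = trace (resid_scatter X y z ** P) + trace (transpose E ** (G ** E ** P))"
    by (simp add: matrix_add_rdistrib trace_add matrix_mul_assoc)
  also have "trace (transpose E ** (G ** E ** P)) = trace (G ** E ** P ** transpose E)"
    by (rule trace_mul_sym)
  finally show ?thesis by (simp add: P_def E_def inv_Omega)
qed

text \<open>The part of the normal density's constant that depends on \<open>z\<close> alone; the
  remaining power of \<open>det \<Sigma>\<close> is absorbed into
  \<open>joint_kernel\<close>.\<close>

definition normal_const where
  "normal_const = (2 * pi) powr (- (real CARD('p) * real CARD('d)) / 2) * det (Omega_mat X z) powr (- real CARD('d) / 2)"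

lemma normal_const_pos: "normal_const > 0"
  using pos_def_det_pos[OF pos_def_Omega] by (simp add: normal_const_def)

text \<open>The powers -p/2 and -(n - p + 2a)/2 of \<open>det \<Sigma>\<close> add up to -(n/2 + a),
  and the two trace terms add up to the weighted sum of squares.\<close>

lemma cond_density_joint_kernel:
  fixes \<beta> :: "real^'d^'p" and \<Sigma> :: "real^'d^'d"
  assumes S: "pos_def \<Sigma>"
  shows "beta_cond_density X y \<Sigma> z \<beta> *
      inv_wishart_kernel (real CARD('n) - real CARD('p) + 2 * a - real CARD('d) - 1)
        (matrix_inv (resid_scatter X y z)) \<Sigma>
    = normal_const * joint_kernel a X y \<beta> \<Sigma> z"
proof -
  have "det \<Sigma> powr (- real CARD('p) / 2) *
      det \<Sigma> powr (- ((real CARD('n) - real CARD('p) + 2 * a - real CARD('d) - 1) + real CARD('d) + 1) / 2)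
    = det \<Sigma> powr (- (real CARD('n) / 2 + a))"
    unfolding powr_add[symmetric] by (rule arg_cong[where f="\<lambda>e. det \<Sigma> powr e"]) (simp add: field_simps)
  then show ?thesis
    unfolding joint_kernel_def beta_cond_density_def matrix_normal_density_def inv_wishart_kernel_def
      sum_sq_resid pos_def_matrix_inv(2)[OF pos_def_resid_scatter] normal_const_def distrib_left exp_add
    by (simp add: mult_ac)
qed

text \<open>Integrating \<open>\<beta>\<close> out of the joint kernel therefore leaves the inverse
  Wishart kernel up to a constant, which identifies the normalising integral of the latter.\<close>

lemma nn_integral_beta_cond_density:
  assumes S: "pos_def \<Sigma>"
  shows "(\<integral>\<^sup>+\<beta>. ennreal (beta_cond_density X y \<Sigma> z \<beta>) \<partial>lborel) = 1"
proof -
  define c where "c = normal_const * det \<Sigma> powr (- real CARD('p) / 2)"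
  have c0: "0 \<le> c" using normal_const_pos by (simp add: c_def)
  note dS = pos_def_det_pos[OF S] and dO = pos_def_det_pos[OF pos_def_Omega]
  let ?A = "matrix_inv (Omega_mat X z)" and ?B = "matrix_inv \<Sigma>"
  let ?w = "(2 * pi) powr (real CARD('p) * real CARD('d) / 2) *
    det ?A powr (- real CARD('d) / 2) * det ?B powr (- real CARD('p) / 2)"
  let ?e = "\<lambda>\<beta>. ennreal (exp (- (1/2) * trace (?A ** (\<beta> - \<mu>) ** ?B ** transpose (\<beta> - \<mu>))))"
  have "(\<integral>\<^sup>+\<beta>. ennreal (beta_cond_density X y \<Sigma> z \<beta>) \<partial>lborel)
    = (\<integral>\<^sup>+\<beta>. ennreal c * ?e \<beta> \<partial>lborel)"
    using c0 by (intro nn_integral_cong)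
      (simp add: beta_cond_density_def matrix_normal_density_def c_def normal_const_def ennreal_mult[symmetric])
  also have "\<dots> = ennreal c * (\<integral>\<^sup>+\<beta>. ?e \<beta> \<partial>lborel)"
  proof (rule nn_integral_cmult)
    show "(\<lambda>\<beta>. ?e \<beta>) \<in> borel_measurable lborel"
      unfolding trace_def matrix_matrix_mult_def transpose_def by measurable
  qed
  also have "\<dots> = ennreal c * ennreal ?w"
    by (subst nn_integral_matrix_gaussian[OF pos_def_matrix_inv(1)[OF pos_def_Omega] pos_def_matrix_inv(1)[OF S]]) simp
  also have "\<dots> = ennreal (c * ?w)"
    using c0 by (simp add: ennreal_mult)
  also have "\<dots> = 1"
  proof -
    have cancel: "x powr (- q / 2) * inverse x powr (- q / 2) = 1" if "x > 0" for x q :: real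
      using that powr_mult[of x "inverse x" "- q / 2"] by simp
    have cancel_pi: "(2 * pi) powr (- q / 2) * (2 * pi) powr (q / 2) = 1" for q :: real
      by (simp add: powr_add[symmetric])
    have "c * ?w
      = ((2 * pi) powr (- (real CARD('p) * real CARD('d)) / 2) * (2 * pi) powr (real CARD('p) * real CARD('d) / 2))
        * (det (Omega_mat X z) powr (- real CARD('d) / 2) * inverse (det (Omega_mat X z)) powr (- real CARD('d) / 2))
        * (det \<Sigma> powr (- real CARD('p) / 2) * inverse (det \<Sigma>) powr (- real CARD('p) / 2))"
      unfolding pos_def_matrix_inv(5)[OF pos_def_Omega] pos_def_matrix_inv(5)[OF S] c_def normal_const_def
      by (simp only: mult_ac)
    then show ?thesis by (simp only: cancel_pi cancel[OF dS] cancel[OF dO]) simp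
  qed
  finally show ?thesis .
qed

end

section \<open>The data augmentation operator as a latent variable operator\<close>

lemma trace_class_null_measure:
  assumes null: "emeasure P (space P) = 0"
    and K: "\<And>f. f \<in> borel_measurable P \<Longrightarrow> K f \<in> borel_measurable P"
  shows "trace_class P K"
proof -
  interpret finite_measure P by standard (simp add: null)
  have ae: "AE x in P. Q x" for Q
    using null by (intro AE_I[of _ _ "space P"]) auto
  have int0: "(\<integral>x. f x \<partial>P) = 0" for f :: "_ \<Rightarrow> real"
    by (rule integral_eq_zero_AE) (rule ae)
  have int: "integrable P f" if "f \<in> borel_measurable P" for f :: "_ \<Rightarrow> real"
  proof -
    have "integrable P (\<lambda>_. 0 :: real)" by simp
    then show ?thesis by (rule integrable_cong_AE_imp) (use that ae in auto)
  qed
  have "bounded_trace_operator P K 0"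
  proof
    show "positive_selfadjoint P K"
      unfolding positive_selfadjoint_def
      by (auto simp: L2_inner_def int0 L2_zero_def intro!: K int borel_measurable_power)
  qed (simp add: L2_inner_def int0)
  then show ?thesis by (rule bounded_trace_operator.trace_class)
qed

lemma nn_integral_vec_prod:
  fixes f :: "'n::finite \<Rightarrow> real \<Rightarrow> ennreal"
  assumes [measurable]: "\<And>i. f i \<in> borel_measurable borel"
  shows "(\<integral>\<^sup>+z. (\<Prod>i\<in>UNIV. f i (z $ i)) \<partial>(lborel :: (real^'n) measure)) = (\<Prod>i\<in>UNIV. \<integral>\<^sup>+u. f i u \<partial>lborel)"
proof -
  interpret product_sigma_finite "\<lambda>_ :: 'n. lborel :: real measure" ..
  have "(\<integral>\<^sup>+z. (\<Prod>i\<in>UNIV. f i (z $ i)) \<partial>(lborel :: (real^'n) measure))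
    = (\<integral>\<^sup>+v. (\<Prod>i\<in>UNIV. f i (v i)) \<partial>Pi\<^sub>M UNIV (\<lambda>_ :: 'n. lborel))"
    by (subst lborel_vec_eq_PiM) (simp add: nn_integral_distr)
  also have "\<dots> = (\<Prod>i\<in>UNIV. \<integral>\<^sup>+u. f i u \<partial>lborel)"
    by (rule product_nn_integral_prod) auto
  finally show ?thesis .
qed

section \<open>The Laplace transform of the mixing weight\<close>

locale mixing_weight =
  fixes \<phi> :: "real \<Rightarrow> real" \<comment> \<open>the function \<open>u \<mapsto> u\<^bsup>d/2\<^esup> h(u)\<close>, extended by 0\<close>
  assumes weight_integrable: "integrable lborel \<phi>"
    and weight_nonneg: "\<And>u. 0 \<le> \<phi> u"
    and weight_supp: "\<And>u. u \<le> 0 \<Longrightarrow> \<phi> u = 0"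
    and weight_pos: "\<exists>\<epsilon>>0. \<forall>u. 0 < u \<and> u < \<epsilon> \<longrightarrow> 0 < \<phi> u"
begin

lemma weight_measurable [measurable]: "\<phi> \<in> borel_measurable borel"
  using borel_measurable_integrable[OF weight_integrable] by simp

text \<open>The reciprocal of the normalising constant b(s) of \<open>psi\<close>.\<close>

definition laplace :: "real \<Rightarrow> real" where
  "laplace s = (\<integral>v. \<phi> v * exp (- s * v / 2) \<partial>lborel)"

text \<open>At \<open>\<zeta> * u\<close> this is the denominator in the hypothesis of the
  theorem.\<close>

definition partial_mass :: "real \<Rightarrow> real" where
  "partial_mass t = (\<integral>v. indicator {0<..<t} v * \<phi> v \<partial>lborel)"

lemma laplace_measurable [measurable]: "laplace \<in> borel_measurable borel"
  unfolding laplace_def[abs_def] by measurable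

lemma laplace_integrable:
  assumes "0 \<le> s"
  shows "integrable lborel (\<lambda>v. \<phi> v * exp (- s * v / 2))"
proof (rule Bochner_Integration.integrable_bound[OF weight_integrable])
  have "\<phi> v * exp (- s * v / 2) \<le> \<phi> v" for v
  proof (cases "v \<le> 0")
    case False
    then show ?thesis using assms weight_nonneg[of v] by (simp add: mult_left_le)
  qed (simp add: weight_supp)
  then show "AE v in lborel. norm (\<phi> v * exp (- s * v / 2)) \<le> norm (\<phi> v)"
    by (simp add: weight_nonneg)
qed measurable

lemma partial_mass_integrable: "integrable lborel (\<lambda>v. indicator {0<..<t} v * \<phi> v)"
  using integrable_mult_indicator[of "{0<..<t}" lborel \<phi>] weight_integrable by simp

text \<open>Positivity of the weight near the origin enters here: the integrand is positive on
  \<open>{0<..<min t \<epsilon>}\<close>, an interval of positive length.\<close>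

lemma partial_mass_pos:
  assumes "t > 0"
  shows "partial_mass t > 0"
proof -
  obtain \<epsilon> where \<epsilon>: "\<epsilon> > 0" "\<And>u. 0 < u \<Longrightarrow> u < \<epsilon> \<Longrightarrow> 0 < \<phi> u" using weight_pos by blast
  have nn: "0 \<le> indicator {0<..<t} v * \<phi> v" for v by (simp add: weight_nonneg)
  have "partial_mass t \<noteq> 0"
  proof
    assume "partial_mass t = 0"
    then have "AE v in lborel. indicator {0<..<t} v * \<phi> v = 0"
      using integral_nonneg_eq_0_iff_AE[OF partial_mass_integrable] nn by (simp add: partial_mass_def)
    then have "AE v in lborel. v \<notin> {0<..<min t \<epsilon>}"
    proof eventually_elim
      case (elim v)
      then show ?case using \<epsilon>(2)[of v] by (auto simp: indicator_def)
    qed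
    then have "emeasure lborel {0<..<min t \<epsilon>} = 0"
      by (subst (asm) AE_iff_measurable[of "{0<..<min t \<epsilon>}"]) auto
    then show False using \<epsilon>(1) assms by simp
  qed
  moreover have "0 \<le> partial_mass t" unfolding partial_mass_def by (simp add: integral_nonneg_AE nn)
  ultimately show ?thesis by simp
qed

lemma laplace_ge:
  assumes s: "0 \<le> s"
  shows "exp (- s * t / 2) * partial_mass t \<le> laplace s"
proof -
  have "exp (- s * t / 2) * partial_mass t = (\<integral>v. exp (- s * t / 2) * (indicator {0<..<t} v * \<phi> v) \<partial>lborel)"
    unfolding partial_mass_def by simp
  also have "\<dots> \<le> laplace s"
    unfolding laplace_def
  proof (rule integral_mono)
    show "exp (- s * t / 2) * (indicator {0<..<t} v * \<phi> v) \<le> \<phi> v * exp (- s * v / 2)" for v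
    proof (cases "v \<in> {0<..<t}")
      case True
      then have "exp (- s * t / 2) \<le> exp (- s * v / 2)" using s by (simp add: mult_left_mono)
      then show ?thesis using True weight_nonneg[of v] by (simp add: mult.commute mult_left_mono)
    qed (simp add: weight_nonneg)
  qed (use partial_mass_integrable laplace_integrable[OF s] in simp_all)
  finally show ?thesis .
qed

lemma laplace_pos:
  assumes "0 \<le> s"
  shows "laplace s > 0"
  using laplace_ge[OF assms, of 1] partial_mass_pos[of 1]
  by (meson exp_gt_zero less_le_trans mult_pos_pos zero_less_one)

lemma nn_integral_laplace:
  assumes "0 \<le> s"
  shows "(\<integral>\<^sup>+v. ennreal (\<phi> v * exp (- s * v / 2)) \<partial>lborel) = ennreal (laplace s)"
  unfolding laplace_def
  by (rule nn_integral_eq_integral[OF laplace_integrable[OF assms]]) (simp add: weight_nonneg)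

text \<open>The cap at \<open>\<eta>\<close> freezes the denominator for large \<open>u\<close>,
  where the hypothesis says nothing. It costs nothing in the exponent, since
  \<open>\<zeta> * min u \<eta>\<close> is at most \<open>\<zeta> * u\<close>.\<close>

lemma tilted_weight_bound:
  assumes s: "0 \<le> s" and \<zeta>: "1 < \<zeta>" and \<eta>: "0 < \<eta>" and u: "0 < u"
  shows "\<phi> u * exp (- s * u / 2) / laplace s
    \<le> \<phi> u / partial_mass (\<zeta> * min u \<eta>) * exp ((\<zeta> - 1) * s * u / 2)"
proof -
  let ?t = "\<zeta> * min u \<eta>"
  have t: "0 < ?t" using \<zeta> \<eta> u by simp
  note m = partial_mass_pos[OF t]
  have "\<phi> u * exp (- s * u / 2) / laplace s \<le> \<phi> u * exp (- s * u / 2) / (exp (- s * ?t / 2) * partial_mass ?t)"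
    using laplace_ge[OF s, of ?t] m weight_nonneg[of u] by (intro divide_left_mono mult_pos_pos laplace_pos s) auto
  also have "\<dots> = \<phi> u / partial_mass ?t * exp (- s * u / 2 + s * ?t / 2)"
  proof -
    have "exp (- s * u / 2 + s * ?t / 2) = exp (- s * u / 2) / exp (- s * ?t / 2)"
      by (simp add: exp_diff[symmetric])
    then show ?thesis by simp
  qed
  also have "\<dots> \<le> \<phi> u / partial_mass ?t * exp ((\<zeta> - 1) * s * u / 2)"
  proof (intro mult_left_mono)
    have "s * ?t \<le> s * (\<zeta> * u)" using s \<zeta> by (intro mult_left_mono) auto
    then show "exp (- s * u / 2 + s * ?t / 2) \<le> exp ((\<zeta> - 1) * s * u / 2)"
      by (simp add: algebra_simps)
    show "0 \<le> \<phi> u / partial_mass ?t" using weight_nonneg[of u] m by simp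
  qed
  finally show ?thesis .
qed

end

lemma sq_resid_nonneg:
  assumes "pos_def \<Sigma>"
  shows "0 \<le> sq_resid X y \<beta> \<Sigma> i"
proof -
  have "v = 0 \<or> 0 < v \<bullet> (matrix_inv \<Sigma> *v v)" for v
    using pos_def_matrix_inv(1)[OF assms] by (auto simp: pos_def_def)
  then show ?thesis unfolding sq_resid_def by (metis inner_zero_left less_imp_le order_refl)
qed

lemma sq_resid_scaleR:
  assumes "pos_def \<Sigma>" "c > 0"
  shows "sq_resid X y \<beta> (c *\<^sub>R \<Sigma>) i = sq_resid X y \<beta> \<Sigma> i / c"
proof -
  have "matrix_inv (c *\<^sub>R \<Sigma>) = inverse c *\<^sub>R matrix_inv \<Sigma>"
  proof (rule matrix_inv_unique)
    have "(c *\<^sub>R \<Sigma>) ** (inverse c *\<^sub>R matrix_inv \<Sigma>) = (c * inverse c) *\<^sub>R (\<Sigma> ** matrix_inv \<Sigma>)"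
      by (simp add: matrix_matrix_mult_def vec_eq_iff sum_distrib_left mult_ac)
    then show "(c *\<^sub>R \<Sigma>) ** (inverse c *\<^sub>R matrix_inv \<Sigma>) = mat 1"
      using assms by (simp add: pos_def_matrix_inv(3))
  qed
  then show ?thesis
    by (simp add: sq_resid_def scaleR_matrix_vector_assoc[symmetric] divide_inverse mult.commute)
qed

text \<open>The exponent involves \<open>z\<close> linearly and \<open>\<Sigma>\<close> through its
  inverse, so a common factor cancels there; what remains is the power of \<open>c\<close> from the
  determinant.\<close>

lemma joint_kernel_scale:
  fixes \<Sigma> :: "real^'d^'d" and z :: "real^'n"
  assumes "pos_def \<Sigma>" "c > 0"
  shows "joint_kernel a X y \<beta> (c *\<^sub>R \<Sigma>) (c *\<^sub>R z)
    = c powr (- (real CARD('d) * (real CARD('n) / 2 + a))) * joint_kernel a X y \<beta> \<Sigma> z"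
proof -
  have "det (c *\<^sub>R \<Sigma>) = c ^ CARD('d) * det \<Sigma>"
    using det_rows_mul[of "\<lambda>_. c" "\<lambda>i. \<Sigma> $ i"] by (simp add: scaleR_vec_def scalar_mult_eq_scaleR vec_nth_inverse)
  then have "det (c *\<^sub>R \<Sigma>) powr (- (real CARD('n) / 2 + a))
    = c powr (- (real CARD('d) * (real CARD('n) / 2 + a))) * det \<Sigma> powr (- (real CARD('n) / 2 + a))"
    using assms pos_def_det_pos[OF assms(1)]
    by (simp add: powr_mult powr_realpow[symmetric] powr_powr algebra_simps)
  moreover have "(\<Sum>i\<in>UNIV. (c *\<^sub>R z) $ i * sq_resid X y \<beta> (c *\<^sub>R \<Sigma>) i)
    = (\<Sum>i\<in>UNIV. z $ i * sq_resid X y \<beta> \<Sigma> i)"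
    using assms by (intro sum.cong) (simp_all add: sq_resid_scaleR)
  ultimately show ?thesis by (simp add: joint_kernel_def)
qed

section \<open>The conditional densities in terms of the joint kernel\<close>

type_synonym ('d, 'p) state = "(real^'d^'p) \<times> (real^'d^'d)"

locale DA_chain =
  fixes X :: "real^'p^'n" and y :: "real^'d^'n" and a :: real and h :: "real \<Rightarrow> real"
  assumes rank: "rank (concat_cols X y) = CARD('p) + CARD('d)"
    and h_nonneg: "\<And>u. u > 0 \<Longrightarrow> h u \<ge> 0"
    and h_moment: "set_integrable lborel {0<..} (\<lambda>u. u powr (real CARD('d) / 2) * h u)"
    and h_pos: "\<exists>\<epsilon>>0. \<forall>u. 0 < u \<and> u < \<epsilon> \<longrightarrow> h u > 0"
begin

definition \<phi> :: "real \<Rightarrow> real" where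
  "\<phi> u = indicator {0<..} u * (u powr (real CARD('d) / 2) * h u)"

sublocale mixing_weight \<phi>
proof
  show "integrable lborel \<phi>" using h_moment by (simp add: set_integrable_def \<phi>_def[abs_def])
  show "\<exists>\<epsilon>>0. \<forall>u. 0 < u \<and> u < \<epsilon> \<longrightarrow> 0 < \<phi> u" using h_pos by (auto simp: \<phi>_def)
qed (auto simp: \<phi>_def indicator_def h_nonneg)

abbreviation states :: "('d, 'p) state measure" where
  "states \<equiv> state_lborel"

abbreviation latents :: "(real^'n) measure" where
  "latents \<equiv> lborel"

abbreviation kern :: "('d, 'p) state \<Rightarrow> real^'n \<Rightarrow> real" where
  "kern x z \<equiv> joint_kernel a X y (fst x) (snd x) z"

abbreviation resid :: "('d, 'p) state \<Rightarrow> 'n \<Rightarrow> real" where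
  "resid x i \<equiv> sq_resid X y (fst x) (snd x) i"

text \<open>It vanishes outside the positive orthant, so integrals over the latent vector may range
  over the whole space.\<close>

definition weight :: "real^'n \<Rightarrow> real" where
  "weight z = (\<Prod>i\<in>UNIV. \<phi> (z $ i))"

text \<open>Likelihood times prior without the power of \<open>2 * pi\<close>.\<close>

definition target :: "('d, 'p) state \<Rightarrow> real" where
  "target x = det (snd x) powr (- (real CARD('n) / 2 + a)) * (\<Prod>i\<in>UNIV. laplace (resid x i))"

definition kmass :: "real^'n \<Rightarrow> ennreal" where
  "kmass z = (\<integral>\<^sup>+x. ennreal (kern x z) \<partial>state_lborel)"

text \<open>An infinite \<open>kmass z\<close> becomes 0 here, and division by it then gives 0; such
  \<open>z\<close> drop out of all later integrals.\<close>

definition kmass_real :: "real^'n \<Rightarrow> real" where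
  "kmass_real z = enn2real (kmass z)"

lemma space_state: "space states = UNIV \<times> {S. pos_def S}"
  by (simp add: state_lborel_def space_pair_measure)

lemma state_pos_def: "x \<in> space states \<Longrightarrow> pos_def (snd x)"
  by (auto simp: space_state)

sublocale pd: sigma_finite_measure "pd_lborel :: (real^'d^'d) measure"
  by (rule sigma_finite_pd_lborel)

sublocale bp: pair_sigma_finite "lborel :: (real^'d^'p) measure" "pd_lborel :: (real^'d^'d) measure" ..

sublocale state: sigma_finite_measure states
  unfolding state_lborel_def by (rule bp.sigma_finite_measure_axioms)

sublocale state_z: pair_sigma_finite
  states latents ..

lemma measurable_snd_state [measurable]:
  "snd \<in> measurable states pd_lborel"
  unfolding state_lborel_def by simp

lemma measurable_fst_state [measurable]:
  "fst \<in> borel_measurable states"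
  unfolding state_lborel_def by (rule measurable_compose[OF measurable_fst]) simp

lemma measurable_snd_state' [measurable]:
  "snd \<in> borel_measurable states"
  by (rule measurable_compose[OF measurable_snd_state measurable_pd_ident])

lemma measurable_inv_state [measurable]:
  "(\<lambda>x. matrix_inv (snd x)) \<in> borel_measurable states"
  by (rule measurable_compose[OF measurable_snd_state measurable_matrix_inv])

lemma measurable_resid [measurable]: "(\<lambda>x. resid x i) \<in> borel_measurable state_lborel"
proof -
  have "(\<lambda>x. y $ i - transpose (fst x) *v (X $ i)) \<in> borel_measurable states"
    unfolding matrix_vector_mult_def transpose_def by measurable
  note [measurable] = this
  show ?thesis unfolding sq_resid_def matrix_vector_mult_def[of "matrix_inv _"] by measurable
qed

lemma measurable_weight [measurable]: "weight \<in> borel_measurable borel"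
  unfolding weight_def[abs_def] by measurable

lemma measurable_target [measurable]: "target \<in> borel_measurable state_lborel"
  unfolding target_def[abs_def] by measurable

lemma measurable_kern [measurable]:
  "case_prod kern \<in> borel_measurable (state_lborel \<Otimes>\<^sub>M latents)"
  unfolding joint_kernel_def case_prod_beta' by measurable

lemma measurable_kern_section [measurable]: "(\<lambda>x. kern x z) \<in> borel_measurable state_lborel"
  unfolding joint_kernel_def by measurable

lemma measurable_kmass [measurable]: "kmass \<in> borel_measurable (borel :: (real^'n) measure)"
proof -
  have "(\<lambda>(z, x). ennreal (kern x z)) \<in> borel_measurable (latents \<Otimes>\<^sub>M state_lborel)"
    using measurable_kern[THEN measurable_pair_swap] by (simp add: case_prod_beta')
  then have "kmass \<in> borel_measurable latents"
    unfolding kmass_def[abs_def] by (rule state.borel_measurable_nn_integral)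
  then show ?thesis by simp
qed

lemma measurable_kmass_real [measurable]: "kmass_real \<in> borel_measurable (borel :: (real^'n) measure)"
  unfolding kmass_real_def[abs_def] by measurable

lemma det_state_pos: "x \<in> space states \<Longrightarrow> 0 < det (snd x)"
  by (rule pos_def_det_pos[OF state_pos_def])

lemma kern_pos:
  assumes "x \<in> space states"
  shows "0 < kern x z"
  using det_state_pos[OF assms] by (simp add: joint_kernel_def)

lemma kern_nonneg: "0 \<le> kern x z"
  by (simp add: joint_kernel_def)

lemma weight_z_nonneg: "0 \<le> weight z"
  by (simp add: weight_def prod_nonneg weight_nonneg)

lemma weight_z_supp: "weight z \<noteq> 0 \<Longrightarrow> 0 < z $ i"
  using weight_supp[of "z $ i"] by (force simp: weight_def)

lemma kmass_real_nonneg: "0 \<le> kmass_real z"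
  by (simp add: kmass_real_def)

lemma target_pos:
  assumes "x \<in> space states"
  shows "0 < target x"
  using det_state_pos[OF assms] assms
  by (auto simp: target_def intro!: mult_pos_pos prod_pos laplace_pos sq_resid_nonneg state_pos_def)

lemma kern_weight: "kern x z * weight z = det (snd x) powr (- (real CARD('n) / 2 + a)) *
    (\<Prod>i\<in>UNIV. \<phi> (z $ i) * exp (- resid x i * (z $ i) / 2))"
proof -
  have "exp (- (1/2) * (\<Sum>i\<in>UNIV. z $ i * resid x i)) = (\<Prod>i\<in>UNIV. exp (- resid x i * (z $ i) / 2))"
    by (simp add: exp_sum[symmetric] sum_distrib_left mult.commute)
  then show ?thesis by (simp add: joint_kernel_def weight_def prod.distrib mult_ac)
qed

text \<open>Given the state, the coordinates of \<open>z\<close> separate, and each contributes one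
  Laplace transform.\<close>

lemma nn_integral_kern_weight:
  assumes x: "x \<in> space states"
  shows "(\<integral>\<^sup>+z. ennreal (kern x z * weight z) \<partial>lborel) = ennreal (target x)"
proof -
  let ?D = "det (snd x) powr (- (real CARD('n) / 2 + a))"
  note r = sq_resid_nonneg[OF state_pos_def[OF x]]
  have "(\<integral>\<^sup>+z. ennreal (kern x z * weight z) \<partial>lborel)
    = (\<integral>\<^sup>+z. ennreal ?D * (\<Prod>i\<in>UNIV. ennreal (\<phi> (z $ i) * exp (- resid x i * (z $ i) / 2))) \<partial>lborel)"
    unfolding kern_weight
    by (subst prod_ennreal) (simp_all add: ennreal_mult[symmetric] weight_nonneg prod_nonneg)
  also have "\<dots> = ennreal ?D * (\<integral>\<^sup>+z. (\<Prod>i\<in>UNIV. ennreal (\<phi> (z $ i) * exp (- resid x i * (z $ i) / 2))) \<partial>lborel)"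
    by (rule nn_integral_cmult) measurable
  also have "(\<integral>\<^sup>+z. (\<Prod>i\<in>UNIV. ennreal (\<phi> (z $ i) * exp (- resid x i * (z $ i) / 2))) \<partial>latents)
    = (\<Prod>i\<in>UNIV. \<integral>\<^sup>+u. ennreal (\<phi> u * exp (- resid x i * u / 2)) \<partial>lborel)"
    by (rule nn_integral_vec_prod) measurable
  also have "\<dots> = (\<Prod>i\<in>UNIV. ennreal (laplace (resid x i)))"
    by (rule prod.cong[OF refl], rule nn_integral_laplace, rule r)
  also have "ennreal ?D * \<dots> = ennreal (target x)"
  proof -
    have l: "0 \<le> laplace (resid x i)" for i by (rule less_imp_le[OF laplace_pos[OF r]])
    then show ?thesis unfolding target_def
      by (subst prod_ennreal) (simp_all add: ennreal_mult prod_nonneg)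
  qed
  finally show ?thesis .
qed

text \<open>Since the normal density in \<open>\<beta>\<close> has integral 1, the inverse Wishart
  kernel has the integral \<open>c * kmass_real z\<close>, with the factor \<open>c\<close> that
  also occurs in the numerator. For infinite mass both the Bochner integral and
  \<open>kmass_real z\<close> are 0, so the identity persists.\<close>

lemma cond_density_eq:
  assumes x: "x \<in> space states" and z: "\<And>i. z $ i > 0"
  shows "beta_cond_density X y (snd x) z (fst x) * Sigma_cond_density a X y z (snd x)
    = kern x z / kmass_real z"
proof -
  define c where "c = normal_const TYPE('d) X z"
  define m where "m = real CARD('n) - real CARD('p) + 2 * a - real CARD('d) - 1"
  define k where "k S = inv_wishart_kernel m (matrix_inv (resid_scatter X y z)) S" for S
  define b where "b \<beta> S = beta_cond_density X y S z \<beta>" for \<beta> :: "real^'d^'p" and S :: "real^'d^'d"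
  have c: "c > 0" unfolding c_def by (rule normal_const_pos[OF rank z])
  have bk: "b \<beta> S * k S = c * kern (\<beta>, S) z" if "pos_def S" for \<beta> S
    using cond_density_joint_kernel[OF rank z that, of \<beta> a] by (simp add: b_def k_def c_def m_def)
  have k_nonneg: "0 \<le> k S" for S by (simp add: k_def inv_wishart_kernel_def)
  have b_nonneg: "0 \<le> b \<beta> S" for \<beta> S by (simp add: b_def beta_cond_density_def matrix_normal_density_def)
  have k_meas [measurable]: "k \<in> borel_measurable pd_lborel"
    unfolding k_def[abs_def] inv_wishart_kernel_def trace_def matrix_matrix_mult_def by measurable
  have b_meas [measurable]: "(\<lambda>\<beta>. b \<beta> S) \<in> borel_measurable lborel" for S
    unfolding b_def beta_cond_density_def matrix_normal_density_def trace_def matrix_matrix_mult_def transpose_def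
    by measurable
  have "(\<integral>\<^sup>+S. ennreal (k S) \<partial>pd_lborel) = (\<integral>\<^sup>+S. (\<integral>\<^sup>+\<beta>. ennreal c * ennreal (kern (\<beta>, S) z) \<partial>lborel) \<partial>pd_lborel)"
  proof (rule nn_integral_cong)
    fix S :: "real^'d^'d" assume "S \<in> space pd_lborel"
    then have S: "pos_def S" by simp
    have "ennreal (k S) = ennreal (k S) * (\<integral>\<^sup>+\<beta>. ennreal (b \<beta> S) \<partial>lborel)"
      using nn_integral_beta_cond_density[OF rank z S] by (simp add: b_def)
    also have "\<dots> = (\<integral>\<^sup>+\<beta>. ennreal (k S) * ennreal (b \<beta> S) \<partial>lborel)"
      by (rule nn_integral_cmult[symmetric]) measurable
    also have "\<dots> = (\<integral>\<^sup>+\<beta>. ennreal c * ennreal (kern (\<beta>, S) z) \<partial>lborel)"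
    proof (rule nn_integral_cong)
      fix \<beta> :: "real^'d^'p"
      have "ennreal (k S) * ennreal (b \<beta> S) = ennreal (b \<beta> S * k S)"
        using b_nonneg k_nonneg by (simp add: ennreal_mult mult.commute)
      then show "ennreal (k S) * ennreal (b \<beta> S) = ennreal c * ennreal (kern (\<beta>, S) z)"
        unfolding bk[OF S] using c kern_nonneg by (simp only: ennreal_mult less_imp_le)
    qed
    finally show "ennreal (k S) = (\<integral>\<^sup>+\<beta>. ennreal c * ennreal (kern (\<beta>, S) z) \<partial>lborel)" .
  qed
  also have "\<dots> = (\<integral>\<^sup>+x. ennreal c * ennreal (kern x z) \<partial>state_lborel)"
    using bp.nn_integral_snd[of "\<lambda>x. ennreal c * ennreal (kern x z)"] measurable_kern_section[of z]
    unfolding state_lborel_def by simp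
  also have "\<dots> = ennreal c * kmass z"
    unfolding kmass_def by (rule nn_integral_cmult) measurable
  finally have "(\<integral>S. k S \<partial>pd_lborel) = c * kmass_real z"
    using integral_eq_nn_integral[of k pd_lborel] k_nonneg c
    by (simp add: kmass_real_def enn2real_mult)
  then have "Sigma_cond_density a X y z (snd x) = k (snd x) / (c * kmass_real z)"
    by (simp add: Sigma_cond_density_def inv_wishart_density_def k_def[abs_def] m_def resid_scatter_def)
  then have "beta_cond_density X y (snd x) z (fst x) * Sigma_cond_density a X y z (snd x)
    = (b (fst x) (snd x) * k (snd x)) / (c * kmass_real z)" by (simp add: b_def)
  also have "\<dots> = kern x z / kmass_real z"
    using bk[OF state_pos_def[OF x]] c by simp
  finally show ?thesis .
qed

lemma z_cond_density_eq:
  assumes x: "x \<in> space states" and z: "\<And>i. z $ i > 0"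
  shows "z_cond_density h X y (fst x) (snd x) z = kern x z * weight z / target x"
proof -
  have "psi CARD('d) h u s = \<phi> u * exp (- s * u / 2) / laplace s" if "u > 0" for u s
  proof -
    have "(LBINT v:{0<..}. v powr (real CARD('d) / 2) * exp (- s * v / 2) * h v) = laplace s"
      unfolding set_lebesgue_integral_def laplace_def
      by (intro Bochner_Integration.integral_cong) (auto simp: \<phi>_def)
    then show ?thesis using that by (simp add: psi_def \<phi>_def mult_ac)
  qed
  then have "z_cond_density h X y (fst x) (snd x) z
    = (\<Prod>i\<in>UNIV. \<phi> (z $ i) * exp (- resid x i * (z $ i) / 2) / laplace (resid x i))"
    using z by (simp add: z_cond_density_def)
  also have "\<dots> = kern x z * weight z / target x"
    using pos_def_det_pos[OF state_pos_def[OF x]]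
    unfolding kern_weight target_def by (simp add: prod_dividef)
  finally show ?thesis .
qed

text \<open>The first factor is the density of the new state given \<open>z\<close>, the second the
  density of \<open>z\<close> given the old state.\<close>

abbreviation step ::
  "('d, 'p) state \<Rightarrow> ('d, 'p) state \<Rightarrow> real^'n \<Rightarrow> real" where
  "step x' x z \<equiv> kern x' z / kmass_real z * (kern x z * weight z / target x)"

lemma DA_density_eq:
  assumes x: "x \<in> space states" and x': "x' \<in> space states"
  shows "DA_density h a X y x' x
    = (\<integral>z. step x' x z \<partial>lborel)"
proof -
  have "DA_density h a X y x' x = (\<integral>z. indicator {z. \<forall>i. z $ i > 0} z *
      (beta_cond_density X y (snd x') z (fst x') * Sigma_cond_density a X y z (snd x') *
       z_cond_density h X y (fst x) (snd x) z) \<partial>lborel)"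
    by (simp add: DA_density_def case_prod_beta' set_lebesgue_integral_def)
  also have "\<dots> = (\<integral>z. step x' x z \<partial>lborel)"
  proof (rule Bochner_Integration.integral_cong[OF refl])
    fix z :: "real^'n"
    show "indicator {z. \<forall>i. z $ i > 0} z *
        (beta_cond_density X y (snd x') z (fst x') * Sigma_cond_density a X y z (snd x') *
         z_cond_density h X y (fst x) (snd x) z)
      = step x' x z"
    proof (cases "\<forall>i. z $ i > 0")
      case True
      then show ?thesis using cond_density_eq[OF x'] z_cond_density_eq[OF x] by simp
    next
      case False
      then have "weight z = 0" using weight_z_supp by blast
      then show ?thesis using False by simp
    qed
  qed
  finally show ?thesis .
qed

lemma measurable_DA_operator:
  assumes [measurable]: "f \<in> borel_measurable state_lborel"
  shows "DA_operator h a X y f \<in> borel_measurable state_lborel"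
proof -
  have [measurable]: "(\<lambda>((x, x'), z). kern x z) \<in> borel_measurable ((state_lborel \<Otimes>\<^sub>M state_lborel) \<Otimes>\<^sub>M latents)"
    "(\<lambda>((x, x'), z). kern x' z) \<in> borel_measurable ((state_lborel \<Otimes>\<^sub>M state_lborel) \<Otimes>\<^sub>M latents)"
    unfolding joint_kernel_def case_prod_beta' by measurable
  have "(\<lambda>x. \<integral>x'. f x' * (\<integral>z. step x' x z \<partial>lborel) \<partial>state_lborel)
    \<in> borel_measurable state_lborel"
    by measurable
  then show ?thesis
    by (rule measurable_cong[THEN iffD1, rotated])
      (auto simp: DA_operator_def DA_density_eq intro!: Bochner_Integration.integral_cong)
qed

text \<open>A Bochner integral, hence 0 if \<open>target\<close> is not integrable, in accordance
  with \<open>marginal\<close>.\<close>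

definition total :: real where
  "total = (\<integral>x. target x \<partial>state_lborel)"

lemma likelihood_prior_eq:
  assumes x: "x \<in> space states"
  shows "likelihood h X y (fst x) (snd x) * prior a (fst x) (snd x)
    = (1 / (2 * pi) powr (real CARD('d) / 2)) ^ CARD('n) * target x"
proof -
  note S = state_pos_def[OF x]
  note dS = pos_def_det_pos[OF S]
  let ?c = "1 / (2 * pi) powr (real CARD('d) / 2)"
  have "(LBINT u:{0<..}. u powr (real CARD('d) / 2) / ((2 * pi) powr (real CARD('d) / 2) * sqrt (det (snd x))) *
        exp (- (u / 2) * resid x i) * h u) = ?c / sqrt (det (snd x)) * laplace (resid x i)" for i
  proof -
    have "(LBINT u:{0<..}. u powr (real CARD('d) / 2) / ((2 * pi) powr (real CARD('d) / 2) * sqrt (det (snd x))) *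
        exp (- (u / 2) * resid x i) * h u)
      = (\<integral>u. ?c / sqrt (det (snd x)) * (\<phi> u * exp (- resid x i * u / 2)) \<partial>lborel)"
      unfolding set_lebesgue_integral_def
      by (intro Bochner_Integration.integral_cong) (auto simp: \<phi>_def mult_ac)
    then show ?thesis by (simp add: laplace_def)
  qed
  then have "likelihood h X y (fst x) (snd x)
    = (\<Prod>i\<in>UNIV. ?c / sqrt (det (snd x)) * laplace (resid x i))"
    unfolding likelihood_def by (intro prod.cong refl)
  also have "\<dots> = ?c ^ CARD('n) * (inverse (sqrt (det (snd x))) ^ CARD('n) * (\<Prod>i\<in>UNIV. laplace (resid x i)))"
    by (simp only: prod.distrib prod_constant power_mult_distrib divide_inverse mult.assoc)
  also have "inverse (sqrt (det (snd x))) ^ CARD('n) = det (snd x) powr (- (real CARD('n) / 2))"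
  proof -
    have "inverse (sqrt (det (snd x))) = det (snd x) powr (- (1 / 2))"
      using dS by (simp add: powr_half_sqrt[symmetric] powr_minus)
    then show ?thesis using dS by (simp add: powr_realpow[symmetric] powr_powr)
  qed
  finally have "likelihood h X y (fst x) (snd x) = ?c ^ CARD('n) * (det (snd x) powr (- (real CARD('n) / 2))
    * (\<Prod>i\<in>UNIV. laplace (resid x i)))" .
  moreover have "prior a (fst x) (snd x) = det (snd x) powr (- a)" using S by (simp add: prior_def)
  moreover have "det (snd x) powr (- (real CARD('n) / 2)) * det (snd x) powr (- a)
    = det (snd x) powr (- (real CARD('n) / 2 + a))"
    by (simp add: powr_add[symmetric])
  ultimately show ?thesis by (simp add: target_def mult_ac)
qed

text \<open>The power of \<open>2 * pi\<close> cancels between likelihood and marginal. For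
  \<open>total = 0\<close> both densities are 0, as quotients by 0.\<close>

lemma posterior_eq: "posterior h a X y = density state_lborel (\<lambda>x. ennreal (target x / total))"
proof -
  let ?C = "(1 / (2 * pi) powr (real CARD('d) / 2)) ^ CARD('n)"
  have "marginal h a X y = (\<integral>x. ?C * target x \<partial>state_lborel)"
    unfolding marginal_def case_prod_beta'
    by (intro Bochner_Integration.integral_cong refl) (rule likelihood_prior_eq)
  then have m: "marginal h a X y = ?C * total" by (simp add: total_def)
  have C: "?C \<noteq> 0" by simp
  have "posterior_density h a X y x = target x / total" if "x \<in> space states" for x
    using C unfolding posterior_density_def case_prod_beta' m likelihood_prior_eq[OF that] by simp
  then have eq: "\<And>x. x \<in> space states \<Longrightarrow>
    ennreal (posterior_density h a X y x) = ennreal (target x / total)" by simp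
  have "(\<lambda>x. ennreal (posterior_density h a X y x)) \<in> borel_measurable state_lborel"
    by (rule measurable_cong[THEN iffD2, OF eq]) measurable
  then show ?thesis unfolding posterior_def
    by (intro density_cong) (auto simp: eq)
qed

end

section \<open>The Hilbert-Schmidt norm of the kernel and the conclusion\<close>

context DA_chain
begin

definition latent_density :: "real^'n \<Rightarrow> real" where
  "latent_density z = weight z * kmass_real z / total"

text \<open>The kernel W of the overview in the form p(x | z) / p(x), which avoids a division by
  \<open>weight z\<close>, a factor that may vanish.\<close>

definition ratio :: "('d, 'p) state \<Rightarrow> real^'n \<Rightarrow> real" where
  "ratio x z = kern x z / kmass_real z * (total / target x)"

lemma measurable_ratio [measurable]:
  "case_prod ratio \<in> borel_measurable (state_lborel \<Otimes>\<^sub>M latents)"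
proof -
  have [measurable]: "(\<lambda>p. kern (fst p) (snd p)) \<in> borel_measurable (state_lborel \<Otimes>\<^sub>M latents)"
    using measurable_kern by (simp add: case_prod_beta')
  show ?thesis unfolding ratio_def case_prod_beta' by measurable
qed

lemma measurable_latent_density [measurable]: "latent_density \<in> borel_measurable borel"
  unfolding latent_density_def[abs_def] by measurable

lemma total_nonneg: "0 \<le> total"
  unfolding total_def by (rule Bochner_Integration.integral_nonneg_AE) (auto intro!: AE_I2 less_imp_le target_pos)

lemma latent_density_nonneg: "0 \<le> latent_density z"
  by (simp add: latent_density_def weight_z_nonneg kmass_real_nonneg total_nonneg)

text \<open>The integral over \<open>\<Sigma>\<close> is taken innermost, where the scaling of
  \<open>\<Sigma>\<close> compensates that of \<open>z\<close>. The equation is one of extended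
  reals and covers infinite masses; \<open>C\<close> is left unspecified because only its finiteness
  matters.\<close>

lemma kmass_scale:
  assumes c: "c > 0"
  obtains C where "0 \<le> C" "\<And>z. kmass (c *\<^sub>R z) = ennreal C * kmass z"
proof -
  let ?N = "card (range (\<lambda>(i :: 'd, j). {i, j}))"
  define e where "e = c powr (- (real CARD('d) * (real CARD('n) / 2 + a)))"
  have e: "0 \<le> e" by (simp add: e_def)
  have fub: "kmass z = (\<integral>\<^sup>+\<beta>. (\<integral>\<^sup>+S. ennreal (kern (\<beta>, S) z) \<partial>pd_lborel) \<partial>lborel)" for z
    using pd.nn_integral_fst[of "\<lambda>x. ennreal (kern x z)" lborel] measurable_kern_section[of z]
    unfolding kmass_def state_lborel_def by simp
  have sec: "(\<lambda>S. ennreal (kern (\<beta>, S) z)) \<in> borel_measurable pd_lborel" for \<beta> z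
    using measurable_kern_section[of z] unfolding state_lborel_def
    by (intro measurable_compose[OF measurable_Pair1' measurable_compose[OF _ measurable_ennreal]]) auto
  have "kmass (c *\<^sub>R z) = ennreal (c ^ ?N * e) * kmass z" for z
  proof -
    have inner: "(\<integral>\<^sup>+S. ennreal (kern (\<beta>, S) (c *\<^sub>R z)) \<partial>pd_lborel)
      = ennreal (c ^ ?N * e) * (\<integral>\<^sup>+S. ennreal (kern (\<beta>, S) z) \<partial>pd_lborel)" for \<beta>
    proof -
      have "(\<integral>\<^sup>+S. ennreal (kern (\<beta>, S) (c *\<^sub>R z)) \<partial>pd_lborel)
        = ennreal (c ^ ?N) * (\<integral>\<^sup>+S. ennreal (kern (\<beta>, c *\<^sub>R S) (c *\<^sub>R z)) \<partial>pd_lborel)"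
        by (rule nn_integral_pd_lborel_scale[OF c sec])
      also have "(\<integral>\<^sup>+S. ennreal (kern (\<beta>, c *\<^sub>R S) (c *\<^sub>R z)) \<partial>pd_lborel)
        = (\<integral>\<^sup>+S. ennreal e * ennreal (kern (\<beta>, S) z) \<partial>pd_lborel)"
        by (rule nn_integral_cong) (simp add: joint_kernel_scale[OF _ c] e_def[symmetric] ennreal_mult e kern_nonneg[of "(_, _)", simplified])
      also have "\<dots> = ennreal e * (\<integral>\<^sup>+S. ennreal (kern (\<beta>, S) z) \<partial>pd_lborel)"
        by (rule nn_integral_cmult[OF sec])
      finally show ?thesis using c e by (simp add: ennreal_mult mult.assoc)
    qed
    have "kmass (c *\<^sub>R z) = (\<integral>\<^sup>+\<beta>. ennreal (c ^ ?N * e) * (\<integral>\<^sup>+S. ennreal (kern (\<beta>, S) z) \<partial>pd_lborel) \<partial>lborel)"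
      unfolding fub[of "c *\<^sub>R z"] inner ..
    also have "\<dots> = ennreal (c ^ ?N * e) * kmass z"
      unfolding fub[of z]
    proof (rule nn_integral_cmult)
      have "(\<lambda>(\<beta>, S). ennreal (kern (\<beta>, S) z)) \<in> borel_measurable (lborel \<Otimes>\<^sub>M pd_lborel)"
        using measurable_kern_section[of z] unfolding state_lborel_def by (simp add: case_prod_beta')
      then show "(\<lambda>\<beta>. \<integral>\<^sup>+S. ennreal (kern (\<beta>, S) z) \<partial>pd_lborel) \<in> borel_measurable lborel"
        by (rule pd.borel_measurable_nn_integral)
    qed
    finally show ?thesis .
  qed
  moreover have "0 \<le> c ^ ?N * e" using c e by simp
  ultimately show ?thesis using that by blast
qed

text \<open>The transition density integrated along its diagonal; it coincides with the squared norm
  of \<open>ratio\<close> with respect to the two marginal laws.\<close>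

abbreviation trace_integral :: ennreal where
  "trace_integral \<equiv> \<integral>\<^sup>+z. (\<integral>\<^sup>+x. ennreal (step x x z) \<partial>state_lborel) \<partial>lborel"

lemma Hilbert_Schmidt_bound:
  assumes \<zeta>: "1 < \<zeta>" "\<zeta> < 2" and \<eta>: "0 < \<eta>"
    and cond: "set_integrable lborel {0<..<\<eta>} (\<lambda>u. \<phi> u / partial_mass (\<zeta> * u))"
  shows "trace_integral < \<infinity>"
proof -
  define g where "g u = \<phi> u / partial_mass (\<zeta> * min u \<eta>)" for u
  \<comment> \<open>The same function as \<open>g\<close>, split at \<open>\<eta>\<close>: the first
    part is integrable by hypothesis, the second is a constant multiple of the integrable
    weight.\<close>
  define \<psi> where "\<psi> u = indicator {0<..<\<eta>} u * (\<phi> u / partial_mass (\<zeta> * u))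
      + indicator {\<eta>..} u * \<phi> u * (1 / partial_mass (\<zeta> * \<eta>))" for u
  have "integrable lborel \<psi>"
    unfolding \<psi>_def[abs_def]
  proof (rule Bochner_Integration.integrable_add)
    show "integrable lborel (\<lambda>u. indicator {0<..<\<eta>} u * (\<phi> u / partial_mass (\<zeta> * u)))"
      using cond by (simp add: set_integrable_def)
    have "integrable lborel (\<lambda>u. indicator {\<eta>..} u * \<phi> u)"
      using integrable_mult_indicator[of "{\<eta>..}" lborel \<phi>] weight_integrable by simp
    then show "integrable lborel (\<lambda>u. indicator {\<eta>..} u * \<phi> u * (1 / partial_mass (\<zeta> * \<eta>)))"
      by (rule integrable_mult_left)
  qed
  moreover have "\<psi> = g"
  proof
    fix u
    consider "u \<le> 0" | "0 < u" "u < \<eta>" | "\<eta> \<le> u" by linarith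
    then show "\<psi> u = g u"
    proof cases
      case 1
      then show ?thesis using \<eta> by (simp add: \<psi>_def g_def weight_supp)
    next
      case 2
      then show ?thesis by (simp add: \<psi>_def g_def min_def)
    next
      case 3
      then show ?thesis using \<eta> by (simp add: \<psi>_def g_def min_def)
    qed
  qed
  ultimately have g: "integrable lborel g" by simp
  then have [measurable]: "g \<in> borel_measurable borel" using borel_measurable_integrable by fastforce
  have g_nonneg: "0 \<le> g u" for u
  proof (cases "u \<le> 0")
    case False
    then have "0 < partial_mass (\<zeta> * min u \<eta>)" using \<zeta> \<eta> by (intro partial_mass_pos) auto
    then show ?thesis by (simp add: g_def weight_nonneg)
  qed (simp add: g_def weight_supp)
  \<comment> \<open>The exponent -1 of the kernel and the growth \<open>\<zeta> - 1\<close> of the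
    bound combine to \<open>- (2 - \<zeta>)\<close>.\<close>
  define c where "c = 2 - \<zeta>"
  have c: "c > 0" using \<zeta> by (simp add: c_def)
  obtain C where C: "0 \<le> C" "\<And>z. kmass (c *\<^sub>R z) = ennreal C * kmass z" by (rule kmass_scale[OF c]) blast
  have bound: "kern x z * weight z / target x * kern x z \<le> (\<Prod>i\<in>UNIV. g (z $ i)) * kern x (c *\<^sub>R z)"
    if x: "x \<in> space states" and z: "\<And>i. z $ i > 0" for x z
  proof -
    let ?D = "det (snd x) powr (- (real CARD('n) / 2 + a))"
    note r = sq_resid_nonneg[OF state_pos_def[OF x]]
    have D: "?D > 0" using det_state_pos[OF x] by simp
    have "kern x z * weight z / target x
      = (\<Prod>i\<in>UNIV. \<phi> (z $ i) * exp (- resid x i * (z $ i) / 2) / laplace (resid x i))"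
      using D unfolding kern_weight target_def by (simp add: prod_dividef)
    also have "\<dots> \<le> (\<Prod>i\<in>UNIV. g (z $ i) * exp ((\<zeta> - 1) * resid x i * (z $ i) / 2))"
      unfolding g_def
      by (intro prod_mono conjI tilted_weight_bound divide_nonneg_nonneg mult_nonneg_nonneg
          weight_nonneg less_imp_le[OF laplace_pos] exp_ge_zero r \<zeta> \<eta> z)
    also have "\<dots> = (\<Prod>i\<in>UNIV. g (z $ i)) * exp ((\<zeta> - 1) / 2 * (\<Sum>i\<in>UNIV. z $ i * resid x i))"
      by (simp add: prod.distrib exp_sum[symmetric] sum_distrib_left mult_ac)
    finally have "kern x z * weight z / target x * kern x z
      \<le> (\<Prod>i\<in>UNIV. g (z $ i)) * exp ((\<zeta> - 1) / 2 * (\<Sum>i\<in>UNIV. z $ i * resid x i)) * kern x z"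
      by (rule mult_right_mono) (rule kern_nonneg)
    also have "\<dots> = (\<Prod>i\<in>UNIV. g (z $ i)) * kern x (c *\<^sub>R z)"
    proof -
      have "exp ((\<zeta> - 1) / 2 * (\<Sum>i\<in>UNIV. z $ i * resid x i)) * exp (- (1/2) * (\<Sum>i\<in>UNIV. z $ i * resid x i))
        = exp (- (1/2) * (\<Sum>i\<in>UNIV. (c *\<^sub>R z) $ i * resid x i))"
        by (simp add: exp_add[symmetric] c_def sum_distrib_left[symmetric] mult.assoc) (simp add: algebra_simps diff_divide_distrib add_divide_distrib)
      then show ?thesis by (simp add: joint_kernel_def mult_ac)
    qed
    finally show ?thesis .
  qed
  have inner: "(\<integral>\<^sup>+x. ennreal (step x x z) \<partial>state_lborel)
    \<le> ennreal C * (\<Prod>i\<in>UNIV. ennreal (g (z $ i)))" for z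
  \<comment> \<open>Outside this case the integrand is 0, because \<open>weight z\<close> vanishes
    or the division is by 0.\<close>
  proof (cases "(\<forall>i. z $ i > 0) \<and> kmass_real z \<noteq> 0")
    case False
    then have "kmass_real z = 0 \<or> weight z = 0" using weight_z_supp by blast
    then show ?thesis by auto
  next
    case True
    then have z: "\<And>i. z $ i > 0" and J: "kmass_real z > 0" using kmass_real_nonneg[of z] by auto
    then have kJ: "kmass z = ennreal (kmass_real z)"
      by (cases "kmass z") (auto simp: kmass_real_def)
    let ?P = "(\<Prod>i\<in>UNIV. g (z $ i)) / kmass_real z"
    have P: "0 \<le> ?P" using J by (simp add: prod_nonneg g_nonneg)
    have "(\<integral>\<^sup>+x. ennreal (step x x z) \<partial>state_lborel)
      \<le> (\<integral>\<^sup>+x. ennreal ?P * ennreal (kern x (c *\<^sub>R z)) \<partial>state_lborel)"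
    proof (rule nn_integral_mono)
      fix x assume x: "x \<in> space states"
      have "step x x z
        = (kern x z * weight z / target x * kern x z) / kmass_real z" by (simp add: mult_ac)
      also have "\<dots> \<le> ((\<Prod>i\<in>UNIV. g (z $ i)) * kern x (c *\<^sub>R z)) / kmass_real z"
        using J by (intro divide_right_mono bound x z) simp
      finally show "ennreal (step x x z)
        \<le> ennreal ?P * ennreal (kern x (c *\<^sub>R z))"
        using P by (simp add: ennreal_mult[symmetric] kern_nonneg ennreal_leI)
    qed
    also have "\<dots> = ennreal ?P * kmass (c *\<^sub>R z)"
      unfolding kmass_def by (rule nn_integral_cmult) measurable
    \<comment> \<open>After rescaling, the mass in the numerator cancels the one in
      \<open>?P\<close>; what remains is a product over the coordinates of \<open>z\<close>.\<close>
    also have "\<dots> = ennreal (?P * (C * kmass_real z))"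
      unfolding C(2) kJ using P C(1) J by (simp only: ennreal_mult mult_nonneg_nonneg less_imp_le)
    also have "?P * (C * kmass_real z) = C * (\<Prod>i\<in>UNIV. g (z $ i))" using J by simp
    also have "ennreal \<dots> = ennreal C * (\<Prod>i\<in>UNIV. ennreal (g (z $ i)))"
      using C(1) g_nonneg by (subst prod_ennreal) (simp_all add: ennreal_mult prod_nonneg)
    finally show ?thesis .
  qed
  have "trace_integral
    \<le> (\<integral>\<^sup>+z. ennreal C * (\<Prod>i\<in>UNIV. ennreal (g (z $ i))) \<partial>latents)"
    by (rule nn_integral_mono) (rule inner)
  also have "\<dots> = ennreal C * (\<integral>\<^sup>+z. (\<Prod>i\<in>UNIV. ennreal (g (z $ i))) \<partial>latents)"
    by (rule nn_integral_cmult) measurable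
  also have "(\<integral>\<^sup>+z. (\<Prod>i\<in>UNIV. ennreal (g (z $ i))) \<partial>latents)
    = (\<Prod>i\<in>(UNIV :: 'n set). \<integral>\<^sup>+u. ennreal (g u) \<partial>lborel)"
    by (rule nn_integral_vec_prod) measurable
  also have "(\<integral>\<^sup>+u. ennreal (g u) \<partial>lborel) = ennreal (\<integral>u. g u \<partial>lborel)"
    by (rule nn_integral_eq_integral[OF g]) (simp add: g_nonneg)
  also have "ennreal C * (\<Prod>i\<in>(UNIV :: 'n set). ennreal (\<integral>u. g u \<partial>lborel)) < \<infinity>"
    by (simp add: ennreal_mult_less_top power_less_top_ennreal)
  finally show ?thesis .
qed

theorem trace_class_DA_operator:
  assumes HS: "trace_integral < \<infinity>"
  shows "trace_class (posterior h a X y) (DA_operator h a X y)"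
proof (cases "total = 0")
  case True
  show ?thesis
  proof (rule trace_class_null_measure)
    show "emeasure (posterior h a X y) (space (posterior h a X y)) = 0"
      by (simp add: posterior_eq True emeasure_density)
    show "DA_operator h a X y f \<in> borel_measurable (posterior h a X y)"
      if "f \<in> borel_measurable (posterior h a X y)" for f
      using that measurable_DA_operator by (simp add: posterior_eq)
  qed
next
  case False
  then have total: "total > 0" using total_nonneg by simp
  \<comment> \<open>A nonzero Bochner integral certifies integrability.\<close>
  have int_target: "integrable state_lborel target"
    using False not_integrable_integral_eq unfolding total_def by blast
  have nn_target: "(\<integral>\<^sup>+x. ennreal (target x) \<partial>state_lborel) = ennreal total"
    unfolding total_def
    by (rule nn_integral_eq_integral[OF int_target]) (auto intro!: AE_I2 less_imp_le target_pos)
  have kw_meas: "(\<lambda>p. ennreal (kern (fst p) (snd p) * weight (snd p)))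
      \<in> borel_measurable (state_lborel \<Otimes>\<^sub>M latents)"
  proof -
    have [measurable]: "(\<lambda>p. kern (fst p) (snd p)) \<in> borel_measurable (state_lborel \<Otimes>\<^sub>M latents)"
      using measurable_kern by (simp add: case_prod_beta')
    show ?thesis by measurable
  qed
  have kmass_weight: "(\<integral>\<^sup>+z. ennreal (weight z) * kmass z \<partial>lborel) = ennreal total"
  proof -
    have "(\<integral>\<^sup>+z. ennreal (weight z) * kmass z \<partial>lborel)
      = (\<integral>\<^sup>+z. (\<integral>\<^sup>+x. ennreal (kern x z * weight z) \<partial>state_lborel) \<partial>lborel)"
    proof (rule nn_integral_cong)
      fix z :: "real^'n"
      have "ennreal (weight z) * kmass z = (\<integral>\<^sup>+x. ennreal (weight z) * ennreal (kern x z) \<partial>state_lborel)"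
        unfolding kmass_def by (rule nn_integral_cmult[symmetric]) measurable
      then show "ennreal (weight z) * kmass z = (\<integral>\<^sup>+x. ennreal (kern x z * weight z) \<partial>state_lborel)"
        by (simp add: ennreal_mult[symmetric] weight_z_nonneg kern_nonneg mult.commute)
    qed
    also have "\<dots> = (\<integral>\<^sup>+x. (\<integral>\<^sup>+z. ennreal (kern x z * weight z) \<partial>lborel) \<partial>state_lborel)"
      using state_z.Fubini[OF kw_meas] by simp
    also have "\<dots> = (\<integral>\<^sup>+x. ennreal (target x) \<partial>state_lborel)"
      by (rule nn_integral_cong) (rule nn_integral_kern_weight)
    finally show ?thesis by (simp add: nn_target)
  qed
  \<comment> \<open>The kernel is strictly positive on states, so zero mass would make the state
    measure null and force the integral of \<open>target\<close> to be 0.\<close>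
  have kmass_nz: "kmass z \<noteq> 0" for z
  proof
    assume "kmass z = 0"
    then have "AE x in state_lborel. ennreal (kern x z) = 0"
      unfolding kmass_def by (subst (asm) nn_integral_0_iff_AE) measurable
    then have "AE x in states. ennreal (target x) = 0"
      using AE_space by eventually_elim (use kern_pos[of _ z] in \<open>force simp: ennreal_eq_0_iff\<close>)
    then have "(\<integral>\<^sup>+x. ennreal (target x) \<partial>state_lborel) = 0"
      by (subst nn_integral_0_iff_AE) simp_all
    then show False using nn_target total by simp
  qed
  \<comment> \<open>The product of \<open>weight\<close> and \<open>kmass\<close> has the finite
    integral \<open>total\<close>, so it is finite almost everywhere; where the weight is positive,
    the mass itself is finite.\<close>
  have finite_ae: "AE z in lborel. weight z \<noteq> 0 \<longrightarrow> kmass z = ennreal (kmass_real z) \<and> 0 < kmass_real z"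
  proof -
    have "AE z in latents. ennreal (weight z) * kmass z \<noteq> \<infinity>"
      by (rule nn_integral_PInf_AE) (measurable, simp add: kmass_weight)
    then show ?thesis
    proof eventually_elim
      case (elim z)
      show ?case
      proof
        assume "weight z \<noteq> 0"
        then have "0 < weight z" using weight_z_nonneg[of z] by simp
        then have "kmass z \<noteq> \<infinity>" using elim by (auto simp: ennreal_mult_top)
        then obtain r where "kmass z = ennreal r" "0 \<le> r" by (cases "kmass z") auto
        then show "kmass z = ennreal (kmass_real z) \<and> 0 < kmass_real z"
          using kmass_nz[of z] by (cases "r = 0") (auto simp: kmass_real_def)
      qed
    qed
  qed
  define R where "R = density lborel (\<lambda>z. ennreal (latent_density z))"
  let ?P = "posterior h a X y"
  have sets: "sets ?P = sets state_lborel" "sets R = sets latents"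
    by (simp_all add: posterior_eq R_def)
  have P_density: "ennreal (target x / total) = ennreal (target x) * ennreal (1 / total)"
    if "x \<in> space states" for x
    using target_pos[OF that] total by (simp add: ennreal_mult[symmetric])
  have finite_P: "finite_measure ?P"
  proof
    have "emeasure ?P (space ?P) = (\<integral>\<^sup>+x. ennreal (target x / total) \<partial>state_lborel)"
      unfolding posterior_eq by (simp add: emeasure_density cong: nn_integral_cong_simp)
    also have "\<dots> = (\<integral>\<^sup>+x. ennreal (target x) * ennreal (1 / total) \<partial>state_lborel)"
      by (rule nn_integral_cong) (rule P_density)
    also have "\<dots> = ennreal total * ennreal (1 / total)"
      by (subst nn_integral_multc) (simp_all add: nn_target)
    finally show "emeasure ?P (space ?P) \<noteq> \<infinity>" by (simp add: ennreal_mult_eq_top_iff)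
  qed
  have finite_R: "finite_measure R"
  proof
    have "emeasure R (space R) = (\<integral>\<^sup>+z. ennreal (latent_density z) \<partial>lborel)"
      unfolding R_def by (simp add: emeasure_density)
    also have "\<dots> = (\<integral>\<^sup>+z. ennreal (weight z) * kmass z * ennreal (1 / total) \<partial>lborel)"
    proof (rule nn_integral_cong_AE)
      show "AE z in lborel. ennreal (latent_density z) = ennreal (weight z) * kmass z * ennreal (1 / total)"
        using finite_ae
      proof eventually_elim
        case (elim z)
        show ?case
        proof (cases "weight z = 0")
          case False
          then have "kmass z = ennreal (kmass_real z)" using elim by simp
          then show ?thesis
            using total by (simp add: latent_density_def ennreal_mult[symmetric] weight_z_nonneg kmass_real_nonneg)
        qed (simp add: latent_density_def)
      qed
    qed
    also have "\<dots> = ennreal total * ennreal (1 / total)"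
      by (subst nn_integral_multc) (simp_all add: kmass_weight)
    finally show "emeasure R (space R) \<noteq> \<infinity>" by (simp add: ennreal_mult_eq_top_iff)
  qed
  have P_int: "(\<integral>x. f x \<partial>?P) = (\<integral>x. target x / total * f x \<partial>state_lborel)"
    if "f \<in> borel_measurable state_lborel" for f :: "_ \<Rightarrow> real"
    unfolding posterior_eq
  proof (rule integral_real_density)
    show "AE x in state_lborel. 0 \<le> target x / total"
      using total target_pos by (intro AE_I2) (simp add: less_imp_le)
  qed (use that in measurable)
  have R_int: "(\<integral>z. f z \<partial>R) = (\<integral>z. latent_density z * f z \<partial>lborel)"
    if "f \<in> borel_measurable borel" for f :: "_ \<Rightarrow> real"
    unfolding R_def
    by (rule integral_real_density) (use that latent_density_nonneg in auto)
  have ratio_sec [measurable]: "(\<lambda>x. ratio x z) \<in> borel_measurable state_lborel" for z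
    unfolding ratio_def by measurable
  have kern_sec [measurable]: "kern x \<in> borel_measurable borel" for x
    unfolding joint_kernel_def[abs_def] by measurable
  have ratio_sec' [measurable]: "ratio x \<in> borel_measurable borel" for x
    unfolding ratio_def[abs_def] by measurable
  have "latent_operator ?P R ratio (DA_operator h a X y)"
  proof (intro latent_operator.intro latent_operator_axioms.intro finite_P finite_R)
    show meas: "case_prod ratio \<in> borel_measurable (?P \<Otimes>\<^sub>M R)"
      using measurable_ratio measurable_cong_sets[OF sets_pair_measure_cong[OF sets] refl] by blast
    show "AE z in R. (\<integral>x. ratio x z \<partial>?P) = 1"
      unfolding R_def
    proof (subst AE_density)
      show "AE z in lborel. 0 < ennreal (latent_density z) \<longrightarrow> (\<integral>x. ratio x z \<partial>?P) = 1"
        using finite_ae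
      proof eventually_elim
        case (elim z)
        show ?case
        proof
          assume "0 < ennreal (latent_density z)"
          then have "weight z \<noteq> 0" by (auto simp: latent_density_def)
          with elim have J: "kmass z = ennreal (kmass_real z)" "0 < kmass_real z" by auto
          have "(\<integral>x. ratio x z \<partial>?P) = (\<integral>x. kern x z / kmass_real z \<partial>state_lborel)"
            unfolding P_int[OF ratio_sec]
          proof (rule Bochner_Integration.integral_cong[OF refl])
            fix x assume "x \<in> space states"
            from target_pos[OF this] total show "target x / total * ratio x z = kern x z / kmass_real z"
              by (simp add: ratio_def)
          qed
          also have "(\<integral>x. kern x z \<partial>state_lborel) = kmass_real z"
            unfolding kmass_real_def kmass_def
            by (rule integral_eq_nn_integral) (simp_all add: kern_nonneg)
          then have "(\<integral>x. kern x z / kmass_real z \<partial>state_lborel) = 1" using J by simp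
          finally show "(\<integral>x. ratio x z \<partial>?P) = 1" .
        qed
      qed
    qed measurable
    show "AE x in ?P. (\<integral>z. ratio x z \<partial>R) = 1"
    proof (rule AE_I2)
      fix x assume "x \<in> space ?P"
      then have x: "x \<in> space states" by (simp add: posterior_eq)
      have "(\<integral>z. ratio x z \<partial>R) = (\<integral>z. kern x z * weight z / target x \<partial>lborel)"
        unfolding R_int[OF ratio_sec']
      proof (rule integral_cong_AE)
        show "AE z in lborel. latent_density z * ratio x z = kern x z * weight z / target x"
          using finite_ae
        proof eventually_elim
          case (elim z)
          then show ?case using total target_pos[OF x]
            by (cases "weight z = 0") (simp_all add: latent_density_def ratio_def)
        qed
      qed measurable
      also have "(\<integral>z. kern x z * weight z \<partial>lborel) = target x"
        using integral_eq_nn_integral[of "\<lambda>z. kern x z * weight z" lborel] nn_integral_kern_weight[OF x]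
          target_pos[OF x]
        by (simp add: kern_nonneg weight_z_nonneg)
      then have "(\<integral>z. kern x z * weight z / target x \<partial>lborel) = 1" using target_pos[OF x] by simp
      finally show "(\<integral>z. ratio x z \<partial>R) = 1" .
    qed
    show "DA_operator h a X y f x = (\<integral>x'. f x' * (\<integral>z. ratio x' z * ratio x z \<partial>R) \<partial>?P)"
      if f: "f \<in> borel_measurable ?P" and x: "x \<in> space ?P" for f x
    proof -
      have [measurable]: "f \<in> borel_measurable state_lborel" using f by (simp add: posterior_eq)
      have x': "x \<in> space states" using x by (simp add: posterior_eq)
      interpret R: finite_measure R by (rule finite_R)
      have rr: "(\<lambda>x'. \<integral>z. ratio x' z * ratio x z \<partial>R) \<in> borel_measurable state_lborel"
      proof (rule R.borel_measurable_lebesgue_integral)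
        have [measurable]: "(\<lambda>p. ratio (fst p) (snd p)) \<in> borel_measurable (state_lborel \<Otimes>\<^sub>M latents)"
          using measurable_ratio by (simp add: case_prod_beta')
        have "(\<lambda>p. ratio (fst p) (snd p) * ratio x (snd p)) \<in> borel_measurable (state_lborel \<Otimes>\<^sub>M latents)"
          by measurable
        then show "(\<lambda>(x', z). ratio x' z * ratio x z) \<in> borel_measurable (state_lborel \<Otimes>\<^sub>M R)"
          by (simp add: case_prod_beta' R_def cong: measurable_cong_sets sets_pair_measure_cong)
      qed
      \<comment> \<open>The factor \<open>total / target x'\<close> in \<open>ratio x' z\<close>
        cancels the posterior density at \<open>x'\<close>, so that integration against the
        posterior becomes integration of the transition density.\<close>
      have "(\<integral>x'. f x' * (\<integral>z. ratio x' z * ratio x z \<partial>R) \<partial>?P)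
        = (\<integral>x'. target x' / total * (f x' * (\<integral>z. ratio x' z * ratio x z \<partial>R)) \<partial>state_lborel)"
        by (rule P_int) (use rr in measurable)
      also have "\<dots> = (\<integral>x'. f x' * DA_density h a X y x' x \<partial>state_lborel)"
      proof (rule Bochner_Integration.integral_cong[OF refl])
        fix x' assume x'': "x' \<in> space states"
        have "(\<integral>z. ratio x' z * ratio x z \<partial>R) = (\<integral>z. latent_density z * (ratio x' z * ratio x z) \<partial>lborel)"
          by (rule R_int) measurable
        also have "\<dots> = (\<integral>z. total / target x' * (step x' x z) \<partial>lborel)"
        proof (rule Bochner_Integration.integral_cong[OF refl])
          fix z show "latent_density z * (ratio x' z * ratio x z)
            = total / target x' * (step x' x z)"
            using total by (cases "kmass_real z = 0") (simp_all add: latent_density_def ratio_def field_simps)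
        qed
        also have "\<dots> = total / target x' * DA_density h a X y x' x"
          unfolding DA_density_eq[OF x' x''] by (rule integral_mult_right_zero)
        finally show "target x' / total * (f x' * (\<integral>z. ratio x' z * ratio x z \<partial>R)) = f x' * DA_density h a X y x' x"
          using total target_pos[OF x''] by simp
      qed
      finally show ?thesis by (simp add: DA_operator_def)
    qed
    show "integrable (?P \<Otimes>\<^sub>M R) (\<lambda>(x, z). (ratio x z)\<^sup>2)"
    proof (rule integrableI_nonneg)
      interpret PR: pair_sigma_finite ?P R
        by (intro pair_sigma_finite.intro finite_measure.axioms(1) finite_P finite_R)
      note [measurable] = meas
      show m2: "(\<lambda>(x, z). (ratio x z)\<^sup>2) \<in> borel_measurable (?P \<Otimes>\<^sub>M R)"
        using meas by (simp add: case_prod_beta')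
      have "(\<integral>\<^sup>+p. ennreal (case p of (x, z) \<Rightarrow> (ratio x z)\<^sup>2) \<partial>(?P \<Otimes>\<^sub>M R))
        = (\<integral>\<^sup>+z. (\<integral>\<^sup>+x. ennreal ((ratio x z)\<^sup>2) \<partial>?P) \<partial>R)"
        using PR.nn_integral_snd[of "\<lambda>p. ennreal (case p of (x, z) \<Rightarrow> (ratio x z)\<^sup>2)"] m2 by simp
      also have "\<dots> = (\<integral>\<^sup>+z. ennreal (latent_density z) * (\<integral>\<^sup>+x. ennreal ((ratio x z)\<^sup>2) \<partial>?P) \<partial>lborel)"
      proof -
        have "(\<lambda>z. \<integral>\<^sup>+x. ennreal ((ratio x z)\<^sup>2) \<partial>?P) \<in> borel_measurable R"
          using measurable_pair_swap[OF m2]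
          by (intro PR.M1.borel_measurable_nn_integral) (simp add: case_prod_beta')
        then show ?thesis unfolding R_def by (intro nn_integral_density) simp_all
      qed
      also have "\<dots> = trace_integral"
      proof (rule nn_integral_cong)
        fix z :: "real^'n"
        have "ennreal (latent_density z) * (\<integral>\<^sup>+x. ennreal ((ratio x z)\<^sup>2) \<partial>?P)
          = ennreal (latent_density z) * (\<integral>\<^sup>+x. ennreal (target x / total) * ennreal ((ratio x z)\<^sup>2) \<partial>state_lborel)"
          unfolding posterior_eq by (subst nn_integral_density) measurable
        also have "\<dots> = (\<integral>\<^sup>+x. ennreal (latent_density z) * (ennreal (target x / total) * ennreal ((ratio x z)\<^sup>2)) \<partial>state_lborel)"
          by (rule nn_integral_cmult[symmetric]) measurable
        also have "\<dots> = (\<integral>\<^sup>+x. ennreal (step x x z) \<partial>state_lborel)"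
        proof (rule nn_integral_cong)
          fix x assume "x \<in> space states"
          note t = target_pos[OF this]
          \<comment> \<open>One factor \<open>kmass_real z\<close> and one factor
            \<open>target x\<close> of the square cancel against the two marginal densities; if
            \<open>kmass_real z\<close> is 0, both sides are 0.\<close>
          have "latent_density z * (target x / total * (ratio x z)\<^sup>2)
            = step x x z"
            using total t by (cases "kmass_real z = 0")
              (simp_all add: latent_density_def ratio_def power2_eq_square field_simps)
          then show "ennreal (latent_density z) * (ennreal (target x / total) * ennreal ((ratio x z)\<^sup>2))
            = ennreal (step x x z)"
            using total t latent_density_nonneg[of z] by (simp add: ennreal_mult[symmetric])
        qed
        finally show "ennreal (latent_density z) * (\<integral>\<^sup>+x. ennreal ((ratio x z)\<^sup>2) \<partial>?P)
          = (\<integral>\<^sup>+x. ennreal (step x x z) \<partial>state_lborel)" .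
      qed
      finally show "(\<integral>\<^sup>+p. ennreal (case p of (x, z) \<Rightarrow> (ratio x z)\<^sup>2) \<partial>(?P \<Otimes>\<^sub>M R)) < \<infinity>"
        using HS by simp
    qed auto
  qed
  then show ?thesis by (rule latent_operator.trace_class)
qed

end

theorem lemma2:
  fixes X :: "real^'p^'n" and y :: "real^'d^'n" and a :: real and h :: "real \<Rightarrow> real"
  assumes mixing: "mixing_density h"
    and S1: "rank (concat_cols X y) = CARD('p) + CARD('d)"
    and S2: "real CARD('n) > real CARD('p) + 2 * real CARD('d) - 2 * a"
    and S3: "set_integrable lborel {0<..} (\<lambda>u. u powr (real CARD('d) / 2) * h u)"
    and S4: "set_integrable lborel {0<..}
               (\<lambda>u. u powr (- (real CARD('n) - real CARD('p) + 2 * a - 2 * real CARD('d) - 1) / 2) * h u)"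
    and pos_near_0: "\<exists>\<epsilon>>0. \<forall>u. 0 < u \<and> u < \<epsilon> \<longrightarrow> h u > 0"
    and cond: "\<exists>\<zeta> \<eta>. 1 < \<zeta> \<and> \<zeta> < 2 \<and> \<eta> > 0 \<and>
                 set_integrable lborel {0<..<\<eta>}
                   (\<lambda>u. u powr (real CARD('d) / 2) * h u /
                        (LBINT v:{0<..<\<zeta> * u}. v powr (real CARD('d) / 2) * h v))"
  shows "trace_class (posterior h a X y) (DA_operator h a X y)"
proof -
  interpret DA_chain X y a h
    by unfold_locales (use mixing S1 S3 pos_near_0 in \<open>auto simp: mixing_density_def\<close>)
  obtain \<zeta> \<eta> where \<zeta>: "1 < \<zeta>" "\<zeta> < 2" "0 < \<eta>" and
    int: "set_integrable lborel {0<..<\<eta>} (\<lambda>u. u powr (real CARD('d) / 2) * h u /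
      (LBINT v:{0<..<\<zeta> * u}. v powr (real CARD('d) / 2) * h v))"
    using cond by blast
  have "(LBINT v:{0<..<t}. v powr (real CARD('d) / 2) * h v) = partial_mass t" for t
    unfolding set_lebesgue_integral_def partial_mass_def
    by (intro Bochner_Integration.integral_cong) (auto simp: \<phi>_def indicator_def)
  then have "set_integrable lborel {0<..<\<eta>} (\<lambda>u. \<phi> u / partial_mass (\<zeta> * u))"
    using int unfolding set_integrable_def
    by (subst Bochner_Integration.integrable_cong[OF refl]) (auto simp: \<phi>_def indicator_def)
  from Hilbert_Schmidt_bound[OF \<zeta> this] show ?thesis by (rule trace_class_DA_operator)
qed

end
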